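(* Let $L=L_K(E)$ be the Leavitt path algebra of an arbitrary graph $E$ over an arbitrary field $K$. The following are equivalent. (1) Every irreducible ideal of $L$ is completely irreducible. (2) Every graded prime ideal of $L$ is completely irreducible. (3) Every ideal of $L$ is graded, and every prime ideal of $L$ is completely irreducible. (4) The graph $E$ satisfies condition (K), and $(E\backslash(H,B_H))^0$ satisfies the strong CSP for each admissible pair $(H,B_H)$ such that $E^0\setminus H$ is downward directed.
   Context: A graph $E=(E^0,E^1,r,s)$ is a directed graph: a nonempty set $E^0$ of vertices, a set $E^1$ of edges, and range and source maps $r,s:E^1\to E^0$ (no finiteness or countability assumptions). A vertex $v$ is regular if $s^{-1}(v)$ is finite and nonempty, and an infinite emitter if $s^{-1}(v)$ is infinite. For a field $K$, the Leavitt path algebra $L_K(E)$ is the (associative, not necessarily unital) $K$-algebra generated by $\{v\mid v\in E^0\}\cup\{e,e^*\mid e\in E^1\}$ subject to: $vw=\delta_{v,w}v$ for $v,w\in E^0$; $s(e)e=er(e)=e$ and $r(e)e^*=e^*s(e)=e^*$ for $e\in E^1$; $e^*f=\delta_{e,f}r(e)$ for $e,f\in E^1$; and $v=\sum_{e\in s^{-1}(v)}ee^*$ for every regular $v\in E^0$. A path is a finite sequence $\mu=e_1\cdots e_n$ of edges with $r(e_i)=s(e_{i+1})$; $s(\mu)=s(e_1)$, $r(\mu)=r(e_n)$, $|\mu|=n$; vertices are paths of length $0$; $\mu^*=e_n^*\cdots e_1^*$. $L$ is $\mathbb Z$-graded with $L_n$ the $K$-span of the elements $\mu\nu^*$ with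 $\mu,\nu$ paths and $|\mu|-|\nu|=n$; an ideal $I$ is graded if $I=\bigoplus_n(I\cap L_n)$. A closed path is a path $e_1\cdots e_n$ ($n\ge1$) with $r(e_n)=s(e_1)$. The graph satisfies condition (K) if any vertex on a closed path $\mu$ is also the source of a closed path different from $\mu$ (i.e. having a different set of edges). Write $u\ge v$ if there is a path (possibly of length $0$) from $u$ to $v$. A set $X$ of vertices is downward directed if it is nonempty and for all $u,v\in X$ there is $w\in X$ with $u\ge w$ and $v\ge w$; hereditary if $u\in X$ and $u\ge v$ imply $v\in X$; saturated if for every regular vertex $v$, $r(s^{-1}(v))\subseteq X$ implies $v\in X$. For $H\subseteq E^0$ hereditary and saturated, the set $B_H$ of breaking vertices consists of the infinite emitters $v\in E^0\setminus H$ with $0<|s^{-1}(v)\cap r^{-1}(E^0\setminus H)|<\aleph_0$. An admissible pair is $(H,S)$ with $H$ hereditary saturated and $S\subseteq B_H$. The quotient graph $E\backslash(H,B_H)$ has vertex set $E^0\setminus H$ and edge set $\{e\in E^1\mid r(e)\notin H\}$, with $r,s$ restricted from $E$. A nonempty set $X$ of vertices of a graph $F$ satisfies the countable separation property (CSP) with respect to a countable subset $T\subseteq X$ if for every $u\in X$ there is $v\in T$ with $u\ge v$. $X$ satisfies the strong CSP if it satisfies the CSP with respect to some countable $T\subseteq X$ that is contained in every nonempty hereditary saturated subset of $X$ (hereditary and saturated as subsets of $F^0$). For $X=(E\backslash(H,B_H))^0$ the graph $F$ is $E\backslash(H,B_H)$. "Ideal" means two-sided ideal; products of ideals consist of finite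 sums of products. A prime ideal is a proper ideal $P$ such that $IJ\subseteq P$ implies $I\subseteq P$ or $J\subseteq P$ for all ideals $I,J$. A proper ideal $I$ is irreducible if it is not the intersection of any two ideals properly containing $I$, and completely irreducible if it is not the intersection of any set of ideals properly containing $I$. *)

theory Defs
  imports
    "HOL-Library.Poly_Mapping"
    "HOL-Library.Countable_Set"
    "HOL-Algebra.QuotRing"
    "HOL-Algebra.Ideal_Product"
    "HOL-Algebra.Module"
    "Graph_Theory.Arc_Walk"
begin

section \<open>Graphs\<close>

text \<open>
  A graph \<open>(E\<^sup>0, E\<^sup>1, r, s)\<close> is a \<^locale>\<open>wf_digraph\<close> with \<open>E\<^sup>0 = verts E\<close>, \<open>E\<^sup>1 = arcs E\<close>,
  \<open>s = tail E\<close>, \<open>r = head E\<close>, so that \<open>s\<^sup>-\<^sup>1(v) = out_arcs E v\<close>.  The paths with source \<open>u\<close> and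
  range \<open>v\<close> are the lists \<open>p\<close> with \<open>awalk u p v\<close>; the empty list stands for the vertex \<open>u\<close>.
\<close>

definition regular_vertex :: "('v, 'e) pre_digraph \<Rightarrow> 'v \<Rightarrow> bool" where
  "regular_vertex E v \<longleftrightarrow> v \<in> verts E \<and> finite (out_arcs E v) \<and> out_arcs E v \<noteq> {}"

definition infinite_emitter :: "('v, 'e) pre_digraph \<Rightarrow> 'v \<Rightarrow> bool" where
  "infinite_emitter E v \<longleftrightarrow> v \<in> verts E \<and> infinite (out_arcs E v)"

definition closed_path :: "('v, 'e) pre_digraph \<Rightarrow> 'v \<Rightarrow> 'e list \<Rightarrow> bool" where
  "closed_path E u p \<longleftrightarrow> p \<noteq> [] \<and> pre_digraph.awalk E u p u"

definition condition_K :: "('v, 'e) pre_digraph \<Rightarrow> bool" where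
  "condition_K E \<longleftrightarrow>
     (\<forall>u p. closed_path E u p \<longrightarrow>
        (\<forall>v \<in> set (pre_digraph.awalk_verts E u p). \<exists>q. closed_path E v q \<and> set q \<noteq> set p))"

definition connects :: "('v, 'e) pre_digraph \<Rightarrow> 'v \<Rightarrow> 'v \<Rightarrow> bool" where
  "connects E u v \<longleftrightarrow> (\<exists>p. pre_digraph.awalk E u p v)"

definition downward_directed :: "('v, 'e) pre_digraph \<Rightarrow> 'v set \<Rightarrow> bool" where
  "downward_directed E X \<longleftrightarrow>
     X \<noteq> {} \<and> (\<forall>u \<in> X. \<forall>v \<in> X. \<exists>w \<in> X. connects E u w \<and> connects E v w)"

definition hereditary :: "('v, 'e) pre_digraph \<Rightarrow> 'v set \<Rightarrow> bool" where
  "hereditary E X \<longleftrightarrow> X \<subseteq> verts E \<and> (\<forall>u v. u \<in> X \<longrightarrow> connects E u v \<longrightarrow> v \<in> X)"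

definition saturated :: "('v, 'e) pre_digraph \<Rightarrow> 'v set \<Rightarrow> bool" where
  "saturated E X \<longleftrightarrow>
     X \<subseteq> verts E \<and> (\<forall>v. regular_vertex E v \<longrightarrow> head E ` out_arcs E v \<subseteq> X \<longrightarrow> v \<in> X)"

definition breaking_vertices :: "('v, 'e) pre_digraph \<Rightarrow> 'v set \<Rightarrow> 'v set" where
  "breaking_vertices E H =
     {v \<in> verts E - H. infinite_emitter E v \<and>
        finite {e \<in> out_arcs E v. head E e \<in> verts E - H} \<and>
        {e \<in> out_arcs E v. head E e \<in> verts E - H} \<noteq> {}}"

definition admissible_pair :: "('v, 'e) pre_digraph \<Rightarrow> 'v set \<Rightarrow> 'v set \<Rightarrow> bool" where
  "admissible_pair E H S \<longleftrightarrow> hereditary E H \<and> saturated E H \<and> S \<subseteq> breaking_vertices E H"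

text \<open>The quotient graph \<open>E\(H, B\<^sub>H)\<close>.\<close>

definition quotient_graph :: "('v, 'e) pre_digraph \<Rightarrow> 'v set \<Rightarrow> ('v, 'e) pre_digraph" where
  "quotient_graph E H =
     \<lparr>verts = verts E - H, arcs = {e \<in> arcs E. head E e \<notin> H}, tail = tail E, head = head E\<rparr>"

definition CSP :: "('v, 'e) pre_digraph \<Rightarrow> 'v set \<Rightarrow> 'v set \<Rightarrow> bool" where
  "CSP F X T \<longleftrightarrow> countable T \<and> T \<subseteq> X \<and> (\<forall>u \<in> X. \<exists>v \<in> T. connects F u v)"

definition strong_CSP :: "('v, 'e) pre_digraph \<Rightarrow> 'v set \<Rightarrow> bool" where
  "strong_CSP F X \<longleftrightarrow>
     X \<noteq> {} \<and>
     (\<exists>T. CSP F X T \<and>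
        (\<forall>Y. Y \<noteq> {} \<longrightarrow> Y \<subseteq> X \<longrightarrow> hereditary F Y \<longrightarrow> saturated F Y \<longrightarrow> T \<subseteq> Y))"


section \<open>Leavitt path algebras\<close>

text \<open>
  Lists form the free monoid, so \<open>'g list \<Rightarrow>\<^sub>0 'k\<close> is the free unital \<open>'k\<close>-algebra on \<open>'g\<close>, with the
  multiplication of \<^typ>\<open>'a \<Rightarrow>\<^sub>0 'b\<close>.
\<close>

instantiation list :: (type) monoid_add
begin
definition zero_list :: "'a list" where "zero_list = []"
definition plus_list :: "'a list \<Rightarrow> 'a list \<Rightarrow> 'a list" where "plus_list = append"
instance by standard (simp_all add: zero_list_def plus_list_def)
end

text \<open>
  The free non-unital algebra on \<open>G\<close> is spanned by the nonempty words.  Since it has no unit, the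
  field \<^const>\<open>one\<close> of this record (and of its quotients) is meaningless.
\<close>

definition free_algebra :: "'g set \<Rightarrow> ('g list \<Rightarrow>\<^sub>0 'k::field) ring" where
  "free_algebra G =
     \<lparr>carrier = {a. Poly_Mapping.keys a \<subseteq> lists G - {[]}},
      mult = (*), one = undefined, zero = 0, add = (+)\<rparr>"

definition word :: "'g list \<Rightarrow> 'g list \<Rightarrow>\<^sub>0 'k::field" where
  "word w = Poly_Mapping.single w 1"

definition scale :: "'k \<Rightarrow> ('g list \<Rightarrow>\<^sub>0 'k) \<Rightarrow> ('g list \<Rightarrow>\<^sub>0 'k::field)" where
  "scale c = Poly_Mapping.map ((*) c)"

inductive_set algebra_ideal_generated ::
    "'g set \<Rightarrow> ('g list \<Rightarrow>\<^sub>0 'k::field) set \<Rightarrow> ('g list \<Rightarrow>\<^sub>0 'k) set"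
  for G :: "'g set" and R :: "('g list \<Rightarrow>\<^sub>0 'k) set" where
  base: "a \<in> R \<Longrightarrow> a \<in> algebra_ideal_generated G R"
| zero: "0 \<in> algebra_ideal_generated G R"
| add: "a \<in> algebra_ideal_generated G R \<Longrightarrow> b \<in> algebra_ideal_generated G R \<Longrightarrow>
     a + b \<in> algebra_ideal_generated G R"
| scale: "a \<in> algebra_ideal_generated G R \<Longrightarrow> scale c a \<in> algebra_ideal_generated G R"
| lmult: "a \<in> algebra_ideal_generated G R \<Longrightarrow> x \<in> carrier (free_algebra G) \<Longrightarrow>
     x * a \<in> algebra_ideal_generated G R"
| rmult: "a \<in> algebra_ideal_generated G R \<Longrightarrow> x \<in> carrier (free_algebra G) \<Longrightarrow>
     a * x \<in> algebra_ideal_generated G R"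

datatype ('v, 'e) lpa_gen = Vertex 'v | Edge 'e | Ghost 'e

definition lpa_gens :: "('v, 'e) pre_digraph \<Rightarrow> ('v, 'e) lpa_gen set" where
  "lpa_gens E = Vertex ` verts E \<union> Edge ` arcs E \<union> Ghost ` arcs E"

definition lpa_rels :: "('v, 'e) pre_digraph \<Rightarrow> (('v, 'e) lpa_gen list \<Rightarrow>\<^sub>0 'k::field) set" where
  "lpa_rels E =
     {word [Vertex v, Vertex w] - (if v = w then word [Vertex v] else 0) | v w.
        v \<in> verts E \<and> w \<in> verts E} \<union>
     {word [Vertex (tail E e), Edge e] - word [Edge e] | e. e \<in> arcs E} \<union>
     {word [Edge e, Vertex (head E e)] - word [Edge e] | e. e \<in> arcs E} \<union>
     {word [Vertex (head E e), Ghost e] - word [Ghost e] | e. e \<in> arcs E} \<union>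
     {word [Ghost e, Vertex (tail E e)] - word [Ghost e] | e. e \<in> arcs E} \<union>
     {word [Ghost e, Edge f] - (if e = f then word [Vertex (head E e)] else 0) | e f.
        e \<in> arcs E \<and> f \<in> arcs E} \<union>
     {word [Vertex v] - (\<Sum>e \<in> out_arcs E v. word [Edge e, Ghost e]) | v. regular_vertex E v}"

definition lpa_ideal :: "('v, 'e) pre_digraph \<Rightarrow> (('v, 'e) lpa_gen list \<Rightarrow>\<^sub>0 'k::field) set" where
  "lpa_ideal E = algebra_ideal_generated (lpa_gens E) (lpa_rels E)"

definition lpa_class ::
    "('v, 'e) pre_digraph \<Rightarrow> (('v, 'e) lpa_gen list \<Rightarrow>\<^sub>0 'k::field) \<Rightarrow> (('v, 'e) lpa_gen list \<Rightarrow>\<^sub>0 'k) set"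
  where "lpa_class E a = lpa_ideal E +>\<^bsub>free_algebra (lpa_gens E)\<^esub> a"

definition leavitt_path_algebra ::
    "'k itself \<Rightarrow> ('v, 'e) pre_digraph \<Rightarrow> ('k::field, (('v, 'e) lpa_gen list \<Rightarrow>\<^sub>0 'k) set) module"
  where
  "leavitt_path_algebra K E =
     (let Q = free_algebra (lpa_gens E) Quot lpa_ideal E in
      \<lparr>carrier = carrier Q, mult = mult Q, one = one Q, zero = zero Q, add = add Q,
       smult = (\<lambda>c X. \<Union>a\<in>X. lpa_class E (scale c a))\<rparr>)"

fun path_word :: "'v \<Rightarrow> 'e list \<Rightarrow> ('v, 'e) lpa_gen list" where
  "path_word u [] = [Vertex u]"
| "path_word u (e # p) = map Edge (e # p)"

fun ghost_path_word :: "'v \<Rightarrow> 'e list \<Rightarrow> ('v, 'e) lpa_gen list" where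
  "ghost_path_word u [] = [Vertex u]"
| "ghost_path_word u (e # p) = map Ghost (rev (e # p))"

inductive_set lpa_component ::
    "'k itself \<Rightarrow> ('v, 'e) pre_digraph \<Rightarrow> int \<Rightarrow> (('v, 'e) lpa_gen list \<Rightarrow>\<^sub>0 'k::field) set set"
  for K :: "'k itself" and E :: "('v, 'e) pre_digraph" and n :: int where
  zero: "\<zero>\<^bsub>leavitt_path_algebra K E\<^esub> \<in> lpa_component K E n"
| step: "x \<in> lpa_component K E n \<Longrightarrow>
     pre_digraph.awalk E u p u' \<Longrightarrow> pre_digraph.awalk E v q v' \<Longrightarrow>
     int (length p) - int (length q) = n \<Longrightarrow>
     (c \<odot>\<^bsub>leavitt_path_algebra K E\<^esub>
        (lpa_class E (word (path_word u p)) \<otimes>\<^bsub>leavitt_path_algebra K E\<^esub>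
         lpa_class E (word (ghost_path_word v q))))
       \<oplus>\<^bsub>leavitt_path_algebra K E\<^esub> x \<in> lpa_component K E n"


section \<open>Ideals of rings without unit\<close>

text \<open>The library locale \<^locale>\<open>ideal\<close> presupposes a unit.\<close>

definition two_sided_ideal :: "('a, 'm) ring_scheme \<Rightarrow> 'a set \<Rightarrow> bool" where
  "two_sided_ideal R I \<longleftrightarrow>
     additive_subgroup I R \<and>
     (\<forall>a \<in> I. \<forall>x \<in> carrier R. x \<otimes>\<^bsub>R\<^esub> a \<in> I \<and> a \<otimes>\<^bsub>R\<^esub> x \<in> I)"

definition proper_ideal :: "('a, 'm) ring_scheme \<Rightarrow> 'a set \<Rightarrow> bool" where
  "proper_ideal R I \<longleftrightarrow> two_sided_ideal R I \<and> I \<noteq> carrier R"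

definition prime_ideal :: "('a, 'm) ring_scheme \<Rightarrow> 'a set \<Rightarrow> bool" where
  "prime_ideal R P \<longleftrightarrow>
     proper_ideal R P \<and>
     (\<forall>I J. two_sided_ideal R I \<longrightarrow> two_sided_ideal R J \<longrightarrow>
        ideal_prod R I J \<subseteq> P \<longrightarrow> I \<subseteq> P \<or> J \<subseteq> P)"

definition irreducible_ideal :: "('a, 'm) ring_scheme \<Rightarrow> 'a set \<Rightarrow> bool" where
  "irreducible_ideal R I \<longleftrightarrow>
     proper_ideal R I \<and>
     \<not> (\<exists>A B. two_sided_ideal R A \<and> two_sided_ideal R B \<and> I \<subset> A \<and> I \<subset> B \<and> I = A \<inter> B)"

text \<open>
  The empty intersection is the whole ring by convention, which a proper ideal never equals; hence
  only nonempty \<open>\<A>\<close> matter.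
\<close>

definition completely_irreducible_ideal :: "('a, 'm) ring_scheme \<Rightarrow> 'a set \<Rightarrow> bool" where
  "completely_irreducible_ideal R I \<longleftrightarrow>
     proper_ideal R I \<and>
     \<not> (\<exists>\<A>. \<A> \<noteq> {} \<and> (\<forall>A \<in> \<A>. two_sided_ideal R A \<and> I \<subset> A) \<and> I = \<Inter>\<A>)"

text \<open>
  \<open>I = \<Oplus>\<^sub>n (I \<inter> L\<^sub>n)\<close>: every element of \<open>I\<close> is in exactly one way the sum of a finitely supported
  family with members in the \<open>I \<inter> L\<^sub>n\<close>.
\<close>

definition graded_ideal ::
    "('a, 'm) ring_scheme \<Rightarrow> (int \<Rightarrow> 'a set) \<Rightarrow> 'a set \<Rightarrow> bool" where
  "graded_ideal R L I \<longleftrightarrow>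
     two_sided_ideal R I \<and>
     (\<forall>x \<in> I. \<exists>!f. (\<forall>n. f n \<in> I \<inter> L n) \<and> finite {n. f n \<noteq> \<zero>\<^bsub>R\<^esub>} \<and>
        x = finsum R f {n. f n \<noteq> \<zero>\<^bsub>R\<^esub>})"

end

theory Submission
  imports Defs
begin

text \<open>
  The graph controls the ideals of the Leavitt path algebra \<open>L\<close> through a reduction.  Let \<open>P\<close> be
  a graded ideal and \<open>H\<close> the set of vertices in \<open>P\<close>.  Every \<open>x \<notin> P\<close> can be multiplied from both
  sides so that it becomes, modulo \<open>P\<close>, an element \<open>h + z\<close>.  Here \<open>h \<notin> P\<close> is a vertex \<open>v\<close> or the
  idempotent \<open>v\<^sup>H = v - \<Sum> e e\<^sup>*\<close> of a breaking vertex \<open>v\<close>, the sum being over the edges from \<open>v\<close> to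
  \<open>E\<^sup>0 - H\<close>, and \<open>z\<close> is a combination of closed paths at \<open>v\<close> of positive length, which is \<open>0\<close> if
  \<open>h\<close> is not a vertex (\<open>reduction\<close>).

  An ideal that contains \<open>h + z\<close> contains \<open>h\<close> in two situations.  If the ideal is graded, then \<open>h\<close>
  is the component of degree \<open>0\<close>.  If the graph satisfies condition (K), then conjugation with
  suitable closed paths removes the terms of \<open>z\<close> one after the other (\<open>condition_K_vertex\<close>).  In
  both situations an ideal above \<open>P\<close> is determined by the idempotents \<open>h\<close> in it
  (\<open>vertices_determine_ideal\<close>).  Comparing an ideal with the largest graded ideal inside it shows
  that under (K) all ideals are graded.  If all ideals are graded, irreducible ideals are prime: for
  \<open>A B \<subseteq> J\<close> the ideal \<open>C = (A + J) \<inter> (B + J)\<close> satisfies \<open>C C \<subseteq> J\<close>, so the idempotents of \<open>C\<close> lie in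
  \<open>J\<close> and \<open>C = J\<close>.  Prime ideals are irreducible in any ring.  Thus the theorem is about prime
  ideals.

  Strong CSP holds for the vertex set of a graph if and only if some vertex \<open>w\<close> lies in all nonempty
  hereditary saturated sets (\<open>strong_CSP_iff\<close>): the countable set can be recovered from \<open>w\<close> by
  following edges out of regular vertices.  Let (K) hold and let \<open>P\<close> be prime.  Then \<open>E\<^sup>0 - H\<close> is
  downward directed.  If \<open>P\<close> contains all \<open>v\<^sup>H\<close>, every ideal properly above \<open>P\<close> contains a vertex
  outside \<open>H\<close>, and its vertices outside \<open>H\<close> form a hereditary saturated set of the quotient graph, so they
  include \<open>w\<close>.  If \<open>u\<^sup>H \<notin> P\<close> for a breaking vertex \<open>u\<close>, primeness puts \<open>u\<^sup>H\<close> into every ideal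
  properly above \<open>P\<close>.  In both cases \<open>P\<close> is completely irreducible.

  For the converse, ideals with a given set of vertices are needed.  \<open>L\<close> acts on the functions on
  the infinite paths of the quotient graph; the vertices in the kernel are those of \<open>H\<close>, and the
  largest graded ideal \<open>P(H)\<close> inside the kernel is prime if \<open>E\<^sup>0 - H\<close> is downward directed.  Under
  (K), if \<open>P(H)\<close> is completely irreducible, the least ideal properly above it contains a vertex \<open>w \<notin> H\<close>; this
  \<open>w\<close> lies in every nonempty hereditary saturated set \<open>Y\<close> of the quotient graph because
  \<open>P(H \<union> Y)\<close> lies properly above \<open>P(H)\<close>.  If (K) fails, some closed path \<open>c\<close> at \<open>v\<close> uses the same edges as
  every other closed path at \<open>v\<close>.  Take for \<open>H\<close> the vertices that do not reach \<open>v\<close>.  Then \<open>ccc...\<close>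
  is the only infinite path from \<open>v\<close>, so \<open>v - c\<^sup>n\<close> lies in the kernel, and also in the largest ideal
  inside it that is graded modulo \<open>n \<bar>c\<bar>\<close>.  These ideals lie properly above \<open>P(H)\<close>, and they intersect in
  \<open>P(H)\<close> because an element has only finitely many degrees.

  The calculations take place in the free algebra, modulo the preimages of the ideals of \<open>L\<close>.
\<close>

section \<open>The free algebra\<close>

abbreviation supp :: "('a \<Rightarrow>\<^sub>0 'b::zero) \<Rightarrow> 'a set" where
  "supp \<equiv> Poly_Mapping.keys"

abbreviation coef :: "('a \<Rightarrow>\<^sub>0 'b::zero) \<Rightarrow> 'a \<Rightarrow> 'b" where
  "coef \<equiv> Poly_Mapping.lookup"

abbreviation scal :: "'k \<Rightarrow> 'g list \<Rightarrow>\<^sub>0 'k::field" where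
  "scal c \<equiv> Poly_Mapping.single [] c"

lemma word_Nil: "word [] = 1"
  unfolding word_def by (metis single_one zero_list_def)

lemma word_append: "word (u @ v) = word u * word v"
  by (simp add: word_def mult_single plus_list_def)

lemma word_Cons: "word (g # w) = word [g] * word w"
  using word_append[of "[g]" w] by simp

lemma scal_mult_word: "scal c * word w = Poly_Mapping.single w c"
  by (simp add: word_def mult_single plus_list_def)

lemma scal_one: "scal 1 = 1"
  by (metis single_one zero_list_def)

lemma scal_mult: "scal c * scal d = scal (c * d)"
  by (simp add: mult_single plus_list_def)

lemma scale_conv_scal: "scale c a = scal c * a"
  unfolding scale_def by (metis mult_map_scale_conv_mult zero_list_def)

lemma lookup_scal_mult: "coef (scal c * a) w = c * coef a w"
proof -
  have "scal c * a = Poly_Mapping.map ((*) c) a"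
    using scale_conv_scal[of c a] by (simp add: scale_def)
  then show ?thesis by (simp add: Poly_Mapping.map.rep_eq when_def)
qed

lemma sum_monomials: "a = (\<Sum>w\<in>supp a. Poly_Mapping.single w (coef a w))"
proof (rule poly_mapping_eqI)
  fix v
  have "coef (\<Sum>w\<in>supp a. Poly_Mapping.single w (coef a w)) v
      = (\<Sum>w\<in>supp a. if w = v then coef a w else 0)"
    by (simp add: lookup_sum lookup_single when_def)
  also have "\<dots> = coef a v"
    by (simp add: in_keys_iff)
  finally show "coef a v = coef
     (\<Sum>w\<in>supp a. Poly_Mapping.single w (coef a w)) v" by simp
qed

lemma keys_subset_induct [consumes 1, case_names zero add monomial]:
  assumes "supp a \<subseteq> W"
    and z: "Q 0"
    and add: "\<And>a b. supp a \<subseteq> W \<Longrightarrow> supp b \<subseteq> W \<Longrightarrow> Q a \<Longrightarrow> Q b \<Longrightarrow> Q (a + b)"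
    and mon: "\<And>c w. w \<in> W \<Longrightarrow> Q (scal c * word w)"
  shows "Q a"
proof -
  define part where "part S = (\<Sum>w\<in>S. Poly_Mapping.single w (coef a w))" for S
  have "supp (part S) \<subseteq> W \<and> Q (part S)" if "finite S" "S \<subseteq> W" for S
    using that
  proof (induction S)
    case empty
    then show ?case using z by (simp add: part_def)
  next
    case (insert w S)
    let ?m = "Poly_Mapping.single w (coef a w)"
    have step: "part (insert w S) = ?m + part S"
      using insert.hyps by (simp add: part_def)
    have w: "w \<in> W" using insert.prems by auto
    have kw: "supp ?m \<subseteq> W"
      using w by auto
    have qw: "Q ?m"
      using mon[OF w] by (simp add: scal_mult_word)
    have IH: "supp (part S) \<subseteq> W" "Q (part S)" using insert by auto
    have "supp (?m + part S) \<subseteq> W"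
      using Poly_Mapping.keys_add[of ?m "part S"] kw IH(1) by (meson Un_least order_trans)
    then show ?case using add[OF kw IH(1) qw IH(2)] by (simp only: step)
  qed
  from this[of "supp a"] assms(1) have "Q (part (supp a))" by simp
  then show ?thesis
    unfolding part_def by (simp only: sum_monomials[symmetric])
qed

lemma scal_commute: "scal c * a = a * scal c"
proof -
  have "supp a \<subseteq> UNIV" by simp
  then show ?thesis
  proof (induction rule: keys_subset_induct)
    case (monomial d w)
    then show ?case by (simp add: word_def mult_single plus_list_def mult.commute)
  qed (simp_all add: algebra_simps)
qed

lemma scal_left_commute: "a * (scal c * b) = scal c * (a * b)"
  by (metis mult.assoc scal_commute)

text \<open>
  The carrier of the free algebra omits the empty word.  Ideals are closed under multiplication by
  this larger unital algebra, which contains the scalars; closure under negatives and scalar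
  multiples then needs no separate mention.
\<close>

definition multipliers :: "'g set \<Rightarrow> ('g list \<Rightarrow>\<^sub>0 'k::field) set" where
  "multipliers S = {a. supp a \<subseteq> lists S}"

lemma multipliers_add [intro]: "a \<in> multipliers S \<Longrightarrow> b \<in> multipliers S \<Longrightarrow> a + b \<in> multipliers S"
  using Poly_Mapping.keys_add[of a b] unfolding multipliers_def by blast

lemma keys_uminus [simp]: "supp (- a) = supp (a :: 'a \<Rightarrow>\<^sub>0 'b::ab_group_add)"
  by (auto simp: in_keys_iff)

lemma keys_minus_subset:
  "supp (a - b) \<subseteq> supp a \<union> supp (b :: 'a \<Rightarrow>\<^sub>0 'b::ab_group_add)"
  using Poly_Mapping.keys_add[of a "- b"] by simp

lemma multipliers_minus [intro]: "a \<in> multipliers S \<Longrightarrow> b \<in> multipliers S \<Longrightarrow> a - b \<in> multipliers S"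
  using keys_minus_subset[of a b] unfolding multipliers_def by blast

lemma multipliers_mult [intro]: "a \<in> multipliers S \<Longrightarrow> b \<in> multipliers S \<Longrightarrow> a * b \<in> multipliers S"
  using keys_mult[of a b] unfolding multipliers_def by (fastforce simp: plus_list_def)

lemma multipliers_scal [simp]: "scal c \<in> multipliers S"
  unfolding multipliers_def by (cases "c = 0") auto

lemma multipliers_word [simp]: "word w \<in> multipliers S \<longleftrightarrow> w \<in> lists S"
  unfolding multipliers_def word_def by auto

lemma multipliers_one [simp]: "1 \<in> multipliers S"
  using multipliers_word[of "[]" S] by (simp add: word_Nil)

lemma multipliers_zero [simp]: "0 \<in> multipliers S"
  unfolding multipliers_def by auto

lemma free_algebra_subset_multipliers: "a \<in> carrier (free_algebra S) \<Longrightarrow> a \<in> multipliers S"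
  unfolding free_algebra_def multipliers_def by auto

lemma free_algebra_zero [simp]: "0 \<in> carrier (free_algebra S)"
  unfolding free_algebra_def by auto

lemma free_algebra_add: "a \<in> carrier (free_algebra S) \<Longrightarrow> b \<in> carrier (free_algebra S) \<Longrightarrow>
    a + b \<in> carrier (free_algebra S)"
  using Poly_Mapping.keys_add[of a b] unfolding free_algebra_def by auto

lemma free_algebra_word: "word w \<in> carrier (free_algebra S) \<longleftrightarrow> w \<in> lists S \<and> w \<noteq> []"
  unfolding free_algebra_def word_def by auto

lemma free_algebra_lmult:
  assumes "a \<in> carrier (free_algebra S)" "x \<in> multipliers S"
  shows "x * a \<in> carrier (free_algebra S)"
proof -
  have "w \<in> lists S - {[]}" if w: "w \<in> supp (x * a)" for w
  proof -
    obtain u v where "w = u @ v" "u \<in> supp x" "v \<in> supp a"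
      using subsetD[OF keys_mult w] by (auto simp: plus_list_def)
    then show ?thesis using assms unfolding free_algebra_def multipliers_def by auto
  qed
  then show ?thesis unfolding free_algebra_def by auto
qed

lemma free_algebra_rmult:
  assumes "a \<in> carrier (free_algebra S)" "x \<in> multipliers S"
  shows "a * x \<in> carrier (free_algebra S)"
proof -
  have "w \<in> lists S - {[]}" if w: "w \<in> supp (a * x)" for w
  proof -
    obtain u v where "w = u @ v" "u \<in> supp a" "v \<in> supp x"
      using subsetD[OF keys_mult w] by (auto simp: plus_list_def)
    then show ?thesis using assms unfolding free_algebra_def multipliers_def by auto
  qed
  then show ?thesis unfolding free_algebra_def by auto
qed

lemma multipliers_induct [consumes 1, case_names zero add monomial]:
  assumes "a \<in> multipliers S"
    and "Q 0"
    and "\<And>a b. a \<in> multipliers S \<Longrightarrow> b \<in> multipliers S \<Longrightarrow> Q a \<Longrightarrow> Q b \<Longrightarrow> Q (a + b)"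
    and "\<And>c w. w \<in> lists S \<Longrightarrow> Q (scal c * word w)"
  shows "Q a"
  using assms(1) unfolding multipliers_def mem_Collect_eq
  by (induction rule: keys_subset_induct) (use assms(2-) in \<open>auto simp: multipliers_def\<close>)

lemma free_algebra_induct [consumes 1, case_names zero add monomial]:
  assumes "a \<in> carrier (free_algebra S)"
    and "Q 0"
    and "\<And>a b. a \<in> carrier (free_algebra S) \<Longrightarrow> b \<in> carrier (free_algebra S) \<Longrightarrow> Q a \<Longrightarrow> Q b \<Longrightarrow> Q (a + b)"
    and "\<And>c w. w \<in> lists S \<Longrightarrow> w \<noteq> [] \<Longrightarrow> Q (scal c * word w)"
  shows "Q a"
proof -
  have "supp a \<subseteq> lists S - {[]}" using assms(1) by (simp add: free_algebra_def)
  then show ?thesis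
    by (induction rule: keys_subset_induct) (use assms(2-) in \<open>auto simp: free_algebra_def\<close>)
qed

section \<open>Ideals above the Leavitt relations\<close>

locale leavitt = wf_digraph E for E :: "('v, 'e) pre_digraph" +
  fixes K :: "'k::field itself"
begin

definition Alg :: "(('v, 'e) lpa_gen list \<Rightarrow>\<^sub>0 'k) set" where
  "Alg = carrier (free_algebra (lpa_gens E))"

definition Mul :: "(('v, 'e) lpa_gen list \<Rightarrow>\<^sub>0 'k) set" where
  "Mul = multipliers (lpa_gens E)"

text \<open>
  The preimages of the ideals of the Leavitt path algebra.  Closure under scalars is automatic for the
  ring ideals of the quotient, because it has local units.
\<close>

definition lifted_ideal :: "(('v, 'e) lpa_gen list \<Rightarrow>\<^sub>0 'k) set \<Rightarrow> bool" where
  "lifted_ideal J \<longleftrightarrow> J \<subseteq> Alg \<and> lpa_ideal E \<subseteq> J \<and> (\<forall>a\<in>J. \<forall>b\<in>J. a + b \<in> J) \<and>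
     (\<forall>a\<in>J. \<forall>x\<in>Mul. x * a \<in> J \<and> a * x \<in> J)"

abbreviation V :: "'v \<Rightarrow> ('v, 'e) lpa_gen list \<Rightarrow>\<^sub>0 'k" where "V v \<equiv> word [Vertex v]"
abbreviation Ed :: "'e \<Rightarrow> ('v, 'e) lpa_gen list \<Rightarrow>\<^sub>0 'k" where "Ed e \<equiv> word [Edge e]"
abbreviation Gh :: "'e \<Rightarrow> ('v, 'e) lpa_gen list \<Rightarrow>\<^sub>0 'k" where "Gh e \<equiv> word [Ghost e]"

text \<open>
  The leading letter \<open>u\<close> makes the trivial path the vertex \<open>u\<close>, and different paths are different
  words, so that combinations of paths have unique coefficients in the free algebra.
\<close>

definition path :: "'v \<Rightarrow> 'e list \<Rightarrow> ('v, 'e) lpa_gen list \<Rightarrow>\<^sub>0 'k" where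
  "path u p = word (Vertex u # map Edge p)"

definition ghost :: "'v \<Rightarrow> 'e list \<Rightarrow> ('v, 'e) lpa_gen list \<Rightarrow>\<^sub>0 'k" where
  "ghost u p = word (map Ghost (rev p) @ [Vertex u])"

lemma gens [simp]: "Vertex v \<in> lpa_gens E \<longleftrightarrow> v \<in> verts E" "Edge e \<in> lpa_gens E \<longleftrightarrow> e \<in> arcs E"
  "Ghost e \<in> lpa_gens E \<longleftrightarrow> e \<in> arcs E"
  unfolding lpa_gens_def by auto

lemma Mul_intros [simp, intro]:
  "1 \<in> Mul" "0 \<in> Mul" "scal c \<in> Mul" "a \<in> Mul \<Longrightarrow> b \<in> Mul \<Longrightarrow> a + b \<in> Mul"
  "a \<in> Mul \<Longrightarrow> b \<in> Mul \<Longrightarrow> a - b \<in> Mul" "a \<in> Mul \<Longrightarrow> b \<in> Mul \<Longrightarrow> a * b \<in> Mul"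
  unfolding Mul_def by auto

lemma Mul_word: "word w \<in> Mul \<longleftrightarrow> w \<in> lists (lpa_gens E)"
  unfolding Mul_def by simp

lemma Mul_gens [simp, intro]: "v \<in> verts E \<Longrightarrow> V v \<in> Mul" "e \<in> arcs E \<Longrightarrow> Ed e \<in> Mul"
  "e \<in> arcs E \<Longrightarrow> Gh e \<in> Mul"
  unfolding Mul_word by auto

lemma Mul_path [simp, intro]: "awalk u p v \<Longrightarrow> path u p \<in> Mul"
  unfolding path_def Mul_word by (auto simp: awalk_def subset_iff)

lemma Mul_ghost [simp, intro]: "awalk u p v \<Longrightarrow> ghost u p \<in> Mul"
  unfolding ghost_def Mul_word by (auto simp: awalk_def subset_iff)

lemma Alg_Mul: "a \<in> Alg \<Longrightarrow> a \<in> Mul"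
  unfolding Alg_def Mul_def by (rule free_algebra_subset_multipliers)

lemma Alg_intros [simp, intro]: "0 \<in> Alg" "a \<in> Alg \<Longrightarrow> b \<in> Alg \<Longrightarrow> a + b \<in> Alg"
  "a \<in> Alg \<Longrightarrow> x \<in> Mul \<Longrightarrow> x * a \<in> Alg" "a \<in> Alg \<Longrightarrow> x \<in> Mul \<Longrightarrow> a * x \<in> Alg"
  unfolding Alg_def Mul_def
  by (auto intro: free_algebra_add free_algebra_lmult free_algebra_rmult)

lemma Alg_uminus [simp, intro]: "a \<in> Alg \<Longrightarrow> - a \<in> Alg"
  unfolding Alg_def free_algebra_def by simp

lemma Alg_minus [simp, intro]: "a \<in> Alg \<Longrightarrow> b \<in> Alg \<Longrightarrow> a - b \<in> Alg"
  using Alg_intros(2)[of a "- b"] by simp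

lemma Alg_word: "word w \<in> Alg \<longleftrightarrow> w \<in> lists (lpa_gens E) \<and> w \<noteq> []"
  unfolding Alg_def by (rule free_algebra_word)

lemma Alg_gens [simp, intro]: "v \<in> verts E \<Longrightarrow> V v \<in> Alg" "e \<in> arcs E \<Longrightarrow> Ed e \<in> Alg"
  "e \<in> arcs E \<Longrightarrow> Gh e \<in> Alg"
  unfolding Alg_word by auto

lemma Alg_path [simp, intro]: "awalk u p v \<Longrightarrow> path u p \<in> Alg"
  unfolding path_def Alg_word by (auto simp: awalk_def subset_iff)

lemma Alg_ghost [simp, intro]: "awalk u p v \<Longrightarrow> ghost u p \<in> Alg"
  unfolding ghost_def Alg_word by (auto simp: awalk_def subset_iff)

lemma Mul_induct [consumes 1, case_names zero add monomial]:
  assumes "a \<in> Mul" "Q 0"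
    and "\<And>a b. a \<in> Mul \<Longrightarrow> b \<in> Mul \<Longrightarrow> Q a \<Longrightarrow> Q b \<Longrightarrow> Q (a + b)"
    and "\<And>c w. w \<in> lists (lpa_gens E) \<Longrightarrow> Q (scal c * word w)"
  shows "Q a"
  using assms unfolding Mul_def by (rule multipliers_induct)

lemma Alg_induct [consumes 1, case_names zero add monomial]:
  assumes "a \<in> Alg" "Q 0"
    and "\<And>a b. a \<in> Alg \<Longrightarrow> b \<in> Alg \<Longrightarrow> Q a \<Longrightarrow> Q b \<Longrightarrow> Q (a + b)"
    and "\<And>c w. w \<in> lists (lpa_gens E) \<Longrightarrow> w \<noteq> [] \<Longrightarrow> Q (scal c * word w)"
  shows "Q a"
  using assms unfolding Alg_def by (rule free_algebra_induct)

lemma lifted_idealD: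
  assumes "lifted_ideal J"
  shows "lpa_ideal E \<subseteq> J" "J \<subseteq> Alg" "a \<in> J \<Longrightarrow> b \<in> J \<Longrightarrow> a + b \<in> J" "0 \<in> J"
    "a \<in> J \<Longrightarrow> x \<in> Mul \<Longrightarrow> x * a \<in> J" "a \<in> J \<Longrightarrow> x \<in> Mul \<Longrightarrow> a * x \<in> J"
  using assms algebra_ideal_generated.zero unfolding lifted_ideal_def lpa_ideal_def by blast+

lemma lpa_rels_Alg: "lpa_rels E \<subseteq> Alg"
proof -
  have *: "finite S \<Longrightarrow> S \<subseteq> arcs E \<Longrightarrow> (\<Sum>e\<in>S. word [Edge e, Ghost e]) \<in> Alg" for S
    by (induction S rule: finite_induct) (auto simp: Alg_word)
  have "(\<Sum>e\<in>out_arcs E v. word [Edge e, Ghost e]) \<in> Alg" if "regular_vertex E v" for v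
    using that by (intro *) (auto simp: regular_vertex_def)
  then show ?thesis
    unfolding lpa_rels_def by (auto simp: Alg_word regular_vertex_def)
qed

lemma lpa_ideal_lifted: "lifted_ideal (lpa_ideal E)"
proof -
  note defs = lpa_ideal_def
  have sub: "a \<in> Alg" if "a \<in> lpa_ideal E" for a
    using that unfolding defs
  proof (induction rule: algebra_ideal_generated.induct)
    case (base a)
    then show ?case using lpa_rels_Alg by auto
  next
    case (lmult a x)
    then show ?case by (metis Alg_def Alg_Mul Alg_intros(3))
  next
    case (rmult a x)
    then show ?case by (metis Alg_def Alg_Mul Alg_intros(4))
  qed (auto simp: scale_conv_scal)
  have "x * a \<in> lpa_ideal E \<and> a * x \<in> lpa_ideal E" if a: "a \<in> lpa_ideal E" and x: "x \<in> Mul" for a x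
    using x
  proof (induction rule: Mul_induct)
    case zero
    then show ?case unfolding defs using algebra_ideal_generated.zero by simp
  next
    case (add x y)
    then show ?case unfolding defs by (simp add: algebra_simps algebra_ideal_generated.add)
  next
    case (monomial c w)
    have "word w * a \<in> lpa_ideal E \<and> a * word w \<in> lpa_ideal E"
    proof (cases "w = []")
      case True
      then show ?thesis using a by (simp add: word_Nil)
    next
      case False
      then have "word w \<in> carrier (free_algebra (lpa_gens E))"
        using monomial by (simp add: free_algebra_word)
      then show ?thesis
        using a unfolding defs by (blast intro: algebra_ideal_generated.lmult algebra_ideal_generated.rmult)
    qed
    moreover have "a * (scal c * word w) = scale c (a * word w)"
      "scal c * word w * a = scale c (word w * a)"
      by (simp_all add: scale_conv_scal scal_left_commute mult.assoc)
    ultimately show ?case unfolding defs by (simp add: algebra_ideal_generated.scale)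
  qed
  then show ?thesis
    unfolding lifted_ideal_def using sub algebra_ideal_generated.add unfolding defs by blast
qed

end

section \<open>Congruence modulo an ideal\<close>

locale leavitt_ideal = leavitt E K for E :: "('v, 'e) pre_digraph" and K :: "'k::field itself" +
  fixes J :: "(('v, 'e) lpa_gen list \<Rightarrow>\<^sub>0 'k) set"
  assumes J: "lifted_ideal J"
begin

definition cong :: "(('v, 'e) lpa_gen list \<Rightarrow>\<^sub>0 'k) \<Rightarrow> (('v, 'e) lpa_gen list \<Rightarrow>\<^sub>0 'k) \<Rightarrow> bool"
  (infix "\<approx>" 50) where "a \<approx> b \<longleftrightarrow> a - b \<in> J"

lemmas J_add = lifted_idealD(3)[OF J]
lemmas J_zero [simp] = lifted_idealD(4)[OF J]
lemmas J_lmult = lifted_idealD(5)[OF J]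
lemmas J_rmult = lifted_idealD(6)[OF J]

lemma J_Alg: "a \<in> J \<Longrightarrow> a \<in> Alg" using lifted_idealD(2)[OF J] by auto

lemma J_uminus: "a \<in> J \<Longrightarrow> - a \<in> J"
proof -
  assume "a \<in> J"
  then have "scal (- 1) * a \<in> J" by (intro J_lmult) auto
  moreover have "scal (- 1) * a = - a" by (simp add: single_uminus scal_one)
  ultimately show "- a \<in> J" by simp
qed

lemma J_minus: "a \<in> J \<Longrightarrow> b \<in> J \<Longrightarrow> a - b \<in> J"
  using J_add[of a "- b"] J_uminus by simp

lemma J_sum: "(\<And>i. i \<in> I \<Longrightarrow> f i \<in> J) \<Longrightarrow> sum f I \<in> J"
  by (induction I rule: infinite_finite_induct) (auto intro: J_add)

lemma cong_refl [simp, intro]: "a \<approx> a" by (simp add: cong_def)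

lemma cong_sym: "a \<approx> b \<Longrightarrow> b \<approx> a"
  using J_uminus[of "a - b"] by (simp add: cong_def)

lemma cong_trans [trans]: "a \<approx> b \<Longrightarrow> b \<approx> c \<Longrightarrow> a \<approx> c"
  using J_add[of "a - b" "b - c"] by (simp add: cong_def)

lemma cong_add: "a \<approx> b \<Longrightarrow> c \<approx> d \<Longrightarrow> a + c \<approx> b + d"
  using J_add[of "a - b" "c - d"] by (simp add: cong_def algebra_simps)

lemma cong_diff: "a \<approx> b \<Longrightarrow> c \<approx> d \<Longrightarrow> a - c \<approx> b - d"
  using J_minus[of "a - b" "c - d"] by (simp add: cong_def algebra_simps)

lemma cong_sum: "(\<And>i. i \<in> I \<Longrightarrow> f i \<approx> g i) \<Longrightarrow> sum f I \<approx> sum g I"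
  using J_sum[of I "\<lambda>i. f i - g i"] by (simp add: cong_def sum_subtractf)

lemma cong_lmult: "a \<approx> b \<Longrightarrow> x \<in> Mul \<Longrightarrow> x * a \<approx> x * b"
  using J_lmult[of "a - b" x] by (simp add: cong_def algebra_simps)

lemma cong_rmult: "a \<approx> b \<Longrightarrow> x \<in> Mul \<Longrightarrow> a * x \<approx> b * x"
  using J_rmult[of "a - b" x] by (simp add: cong_def algebra_simps)

lemma cong_mult: "a \<approx> b \<Longrightarrow> c \<approx> d \<Longrightarrow> a \<in> Mul \<Longrightarrow> d \<in> Mul \<Longrightarrow> a * c \<approx> b * d"
  by (rule cong_trans[OF cong_lmult[of c d a] cong_rmult[of a b d]])

lemma cong_scal: "a \<approx> b \<Longrightarrow> scal c * a \<approx> scal c * b"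
  by (simp add: cong_lmult)

lemma cong_zero_iff: "a \<approx> 0 \<longleftrightarrow> a \<in> J"
  by (simp add: cong_def)

lemma cong_mem: "a \<approx> b \<Longrightarrow> a \<in> J \<longleftrightarrow> b \<in> J"
  unfolding cong_zero_iff[symmetric] by (metis cong_trans cong_sym)

lemma zero_lmult: "a \<approx> 0 \<Longrightarrow> x \<in> Mul \<Longrightarrow> x * a \<approx> 0"
  using cong_lmult[of a 0 x] by simp

lemma zero_rmult: "a \<approx> 0 \<Longrightarrow> x \<in> Mul \<Longrightarrow> a * x \<approx> 0"
  using cong_rmult[of a 0 x] by simp

lemma rel_cong:
  assumes "a - b \<in> lpa_rels E"
  shows "a \<approx> b"
  using algebra_ideal_generated.base[OF assms] lifted_idealD(1)[OF J]
  unfolding cong_def lpa_ideal_def by auto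

lemma word2: "word [a, b] = word [a] * word [b]"
  using word_append[of "[a]" "[b]"] by simp

lemma V_V:
  assumes "v \<in> verts E" "w \<in> verts E"
  shows "V v * V w \<approx> (if v = w then V v else 0)"
proof -
  have "word [Vertex v, Vertex w] - (if v = w then word [Vertex v] else 0) \<in> lpa_rels E"
    using assms unfolding lpa_rels_def by blast
  then show ?thesis unfolding word2 by (rule rel_cong)
qed

lemma
  assumes "e \<in> arcs E"
  shows V_Ed: "V (tail E e) * Ed e \<approx> Ed e"
    and Ed_V: "Ed e * V (head E e) \<approx> Ed e"
    and V_Gh: "V (head E e) * Gh e \<approx> Gh e"
    and Gh_V: "Gh e * V (tail E e) \<approx> Gh e"
proof -
  have "word [Vertex (tail E e), Edge e] - word [Edge e] \<in> lpa_rels E"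
    "word [Edge e, Vertex (head E e)] - word [Edge e] \<in> lpa_rels E"
    "word [Vertex (head E e), Ghost e] - word [Ghost e] \<in> lpa_rels E"
    "word [Ghost e, Vertex (tail E e)] - word [Ghost e] \<in> lpa_rels E"
    using assms unfolding lpa_rels_def by blast+
  then show "V (tail E e) * Ed e \<approx> Ed e" "Ed e * V (head E e) \<approx> Ed e"
    "V (head E e) * Gh e \<approx> Gh e" "Gh e * V (tail E e) \<approx> Gh e"
    unfolding word2 by (blast intro: rel_cong)+
qed

lemma Gh_Ed:
  assumes "e \<in> arcs E" "f \<in> arcs E"
  shows "Gh e * Ed f \<approx> (if e = f then V (head E e) else 0)"
proof -
  have "word [Ghost e, Edge f] - (if e = f then word [Vertex (head E e)] else 0) \<in> lpa_rels E"
    using assms unfolding lpa_rels_def by blast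
  then show ?thesis unfolding word2 by (rule rel_cong)
qed

lemma cuntz_krieger:
  assumes "regular_vertex E v"
  shows "V v \<approx> (\<Sum>e\<in>out_arcs E v. Ed e * Gh e)"
proof -
  have "word [Vertex v] - (\<Sum>e\<in>out_arcs E v. word [Edge e, Ghost e]) \<in> lpa_rels E"
    using assms unfolding lpa_rels_def by blast
  then show ?thesis unfolding word2 by (rule rel_cong)
qed

lemma tail_verts [simp, intro]: "e \<in> arcs E \<Longrightarrow> tail E e \<in> verts E"
  and head_verts [simp, intro]: "e \<in> arcs E \<Longrightarrow> head E e \<in> verts E"
  using wellformed by auto

lemma Gh_V_if: assumes e: "e \<in> arcs E" and v: "v \<in> verts E"
  shows "Gh e * V v \<approx> (if v = tail E e then Gh e else 0)"
proof (cases "v = tail E e")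
  case False
  have "Gh e * V v \<approx> (Gh e * V (tail E e)) * V v"
    using assms by (intro cong_rmult cong_sym[OF Gh_V]) auto
  also have "\<dots> = Gh e * (V (tail E e) * V v)" by (simp add: mult.assoc)
  also have "\<dots> \<approx> 0"
    by (rule zero_lmult) (use V_V[of "tail E e" v] assms False in auto)
  finally show ?thesis using False by simp
qed (use Gh_V e in auto)

lemma Ed_V_if: assumes e: "e \<in> arcs E" and v: "v \<in> verts E"
  shows "Ed e * V v \<approx> (if v = head E e then Ed e else 0)"
proof (cases "v = head E e")
  case False
  have "Ed e * V v \<approx> (Ed e * V (head E e)) * V v"
    using assms by (intro cong_rmult cong_sym[OF Ed_V]) auto
  also have "\<dots> = Ed e * (V (head E e) * V v)" by (simp add: mult.assoc)
  also have "\<dots> \<approx> 0"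
    by (rule zero_lmult) (use V_V[of "head E e" v] assms False in auto)
  finally show ?thesis using False by simp
qed (use Ed_V e in auto)

section \<open>Calculating with paths\<close>

lemma path_alt: "path u p = V u * word (map Edge p)"
  unfolding path_def by (rule word_Cons)

lemma ghost_alt: "ghost u p = word (map Ghost (rev p)) * V u"
  unfolding ghost_def by (rule word_append)

lemma word_map_Edge_Cons: "word (map Edge (e # p)) = Ed e * word (map Edge p)"
  unfolding list.map by (rule word_Cons)

lemma path_Nil: "path u [] = V u" by (simp add: path_def)
lemma ghost_Nil: "ghost u [] = V u" by (simp add: ghost_def)

lemma awalk_ConsD: "awalk u (e # p) v \<Longrightarrow> e \<in> arcs E \<and> tail E e = u \<and> awalk (head E e) p v"
  by (auto simp: awalk_Cons_iff)

lemma Edges_Mul: "set p \<subseteq> arcs E \<Longrightarrow> word (map Edge p) \<in> Mul"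
  "set p \<subseteq> arcs E \<Longrightarrow> word (map Ghost p) \<in> Mul"
  by (auto simp: Mul_word subset_iff)

lemma path_Cons:
  assumes "awalk u (e # p) v"
  shows "path u (e # p) \<approx> Ed e * path (head E e) p"
proof -
  have e: "e \<in> arcs E" "tail E e = u" "set p \<subseteq> arcs E" and p: "awalk (head E e) p v"
    using awalk_ConsD[OF assms] by auto
  have "path u (e # p) = (V (tail E e) * Ed e) * word (map Edge p)"
    using e by (simp only: path_alt word_map_Edge_Cons mult.assoc)
  also have "\<dots> \<approx> Ed e * word (map Edge p)"
    using e by (intro cong_rmult V_Ed Edges_Mul) auto
  also have "\<dots> \<approx> (Ed e * V (head E e)) * word (map Edge p)"
    using e by (intro cong_rmult cong_sym[OF Ed_V] Edges_Mul) auto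
  also have "\<dots> = Ed e * path (head E e) p"
    by (simp add: path_alt mult.assoc)
  finally show ?thesis .
qed

lemma ghost_Cons:
  assumes "awalk u (e # p) v"
  shows "ghost u (e # p) \<approx> ghost (head E e) p * Gh e"
proof -
  have e: "e \<in> arcs E" "tail E e = u" "set p \<subseteq> arcs E" and p: "awalk (head E e) p v"
    using awalk_ConsD[OF assms] by auto
  have "ghost u (e # p) = word (map Ghost (rev p)) * (Gh e * V (tail E e))"
    using e by (simp add: ghost_alt word_append mult.assoc)
  also have "\<dots> \<approx> word (map Ghost (rev p)) * Gh e"
    using e by (intro cong_lmult Gh_V Edges_Mul) auto
  also have "\<dots> \<approx> word (map Ghost (rev p)) * (V (head E e) * Gh e)"
    using e by (intro cong_lmult cong_sym[OF V_Gh] Edges_Mul) auto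
  also have "\<dots> = ghost (head E e) p * Gh e"
    by (simp add: ghost_alt word_append mult.assoc)
  finally show ?thesis .
qed

lemma V_path:
  assumes "awalk u p v" "w \<in> verts E"
  shows "V w * path u p \<approx> (if w = u then path u p else 0)"
proof -
  have "V w * path u p = (V w * V u) * word (map Edge p)"
    by (simp add: path_alt mult.assoc)
  also have "\<dots> \<approx> (if w = u then V w else 0) * word (map Edge p)"
    using assms by (intro cong_rmult V_V Edges_Mul) auto
  also have "\<dots> = (if w = u then path u p else 0)"
    by (simp add: path_alt)
  finally show ?thesis .
qed

lemma ghost_V:
  assumes "awalk u p v" "w \<in> verts E"
  shows "ghost u p * V w \<approx> (if w = u then ghost u p else 0)"
proof -
  have "ghost u p * V w = word (map Ghost (rev p)) * (V u * V w)"
    by (simp add: ghost_alt word_append mult.assoc)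
  also have "\<dots> \<approx> word (map Ghost (rev p)) * (if u = w then V u else 0)"
    using assms by (intro cong_lmult V_V Edges_Mul) auto
  also have "\<dots> = (if w = u then ghost u p else 0)"
    by (simp add: ghost_alt word_append)
  finally show ?thesis .
qed

lemma path_V:
  assumes "awalk u p v" "w \<in> verts E"
  shows "path u p * V w \<approx> (if w = v then path u p else 0)"
  using assms(1)
proof (induction p arbitrary: u)
  case Nil
  then show ?case using V_V[of u w] assms(2) by (auto simp: path_Nil awalk_Nil_iff)
next
  case (Cons e p)
  have e: "e \<in> arcs E" "tail E e = u" and p: "awalk (head E e) p v"
    using awalk_ConsD[OF Cons.prems] by auto
  note pc = path_Cons[OF Cons.prems]
  have "path u (e # p) * V w \<approx> (Ed e * path (head E e) p) * V w"
    using pc assms by (intro cong_rmult) auto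
  also have "\<dots> = Ed e * (path (head E e) p * V w)" by (simp add: mult.assoc)
  also have "\<dots> \<approx> Ed e * (if w = v then path (head E e) p else 0)"
    using Cons.IH[OF p] e by (intro cong_lmult) auto
  also have "\<dots> \<approx> (if w = v then path u (e # p) else 0)"
    using cong_sym[OF pc] by simp
  finally show ?case .
qed

lemma V_ghost:
  assumes "awalk u p v" "w \<in> verts E"
  shows "V w * ghost u p \<approx> (if w = v then ghost u p else 0)"
  using assms(1)
proof (induction p arbitrary: u)
  case Nil
  then show ?case using V_V[of w u] assms(2) by (auto simp: ghost_Nil awalk_Nil_iff)
next
  case (Cons e p)
  have e: "e \<in> arcs E" "tail E e = u" and p: "awalk (head E e) p v"
    using awalk_ConsD[OF Cons.prems] by auto
  note pc = ghost_Cons[OF Cons.prems]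
  have "V w * ghost u (e # p) \<approx> V w * (ghost (head E e) p * Gh e)"
    using pc assms by (intro cong_lmult) auto
  also have "\<dots> = (V w * ghost (head E e) p) * Gh e" by (simp add: mult.assoc)
  also have "\<dots> \<approx> (if w = v then ghost (head E e) p else 0) * Gh e"
    using Cons.IH[OF p] e by (intro cong_rmult) auto
  also have "\<dots> \<approx> (if w = v then ghost u (e # p) else 0)"
    using cong_sym[OF pc] by simp
  finally show ?case .
qed

lemma path_path:
  assumes "awalk u p v" "awalk v q w"
  shows "path u p * path v q \<approx> path u (p @ q)"
  using assms(1)
proof (induction p arbitrary: u)
  case Nil
  then show ?case using V_path[OF assms(2), of v] assms by (auto simp: path_Nil awalk_Nil_iff)
next
  case (Cons e p)
  have e: "e \<in> arcs E" "tail E e = u" and p: "awalk (head E e) p v"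
    using awalk_ConsD[OF Cons.prems] by auto
  have pq: "awalk u (e # p @ q) w"
    using Cons.prems assms(2) by (metis awalk_appendI append_Cons)
  have "path u (e # p) * path v q \<approx> (Ed e * path (head E e) p) * path v q"
    using path_Cons[OF Cons.prems] assms by (intro cong_rmult) auto
  also have "\<dots> = Ed e * (path (head E e) p * path v q)" by (simp add: mult.assoc)
  also have "\<dots> \<approx> Ed e * path (head E e) (p @ q)"
    using Cons.IH[OF p] e by (intro cong_lmult) auto
  also have "\<dots> \<approx> path u (e # p @ q)"
    using cong_sym[OF path_Cons[OF pq]] .
  finally show ?case by simp
qed

lemma ghost_path_zero:
  assumes "awalk u p v" "awalk u' q w" "u \<noteq> u'"
  shows "ghost u p * path u' q \<approx> 0"
proof -
  have v: "u \<in> verts E" using assms by auto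
  have "ghost u p * path u' q \<approx> (ghost u p * V u) * path u' q"
    using cong_sym[OF ghost_V[OF assms(1) v]] assms by (intro cong_rmult) auto
  also have "\<dots> = ghost u p * (V u * path u' q)" by (simp add: mult.assoc)
  also have "\<dots> \<approx> 0"
    by (rule zero_lmult) (use V_path[OF assms(2) v] assms in auto)
  finally show ?thesis .
qed

text \<open>
  The relation \<open>e\<^sup>* f = \<delta>\<^sub>e\<^sub>f r(e)\<close> compares the first edges; the lemmas below iterate it until one path is
  exhausted or the two paths diverge.
\<close>

lemma ghost_path_cancel:
  assumes "awalk u (e # p) v" "awalk u (f # q) w"
  shows "ghost u (e # p) * path u (f # q) \<approx> (if e = f then ghost (head E e) p * path (head E e) q else 0)"
proof -
  have e: "e \<in> arcs E" "tail E e = u" and p: "awalk (head E e) p v"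
    using awalk_ConsD[OF assms(1)] by auto
  have f: "f \<in> arcs E" "tail E f = u" and q: "awalk (head E f) q w"
    using awalk_ConsD[OF assms(2)] by auto
  have "ghost u (e # p) * path u (f # q) \<approx> (ghost (head E e) p * Gh e) * (Ed f * path (head E f) q)"
    using ghost_Cons[OF assms(1)] path_Cons[OF assms(2)] e f p q assms by (intro cong_mult) auto
  also have "\<dots> = ghost (head E e) p * (Gh e * Ed f) * path (head E f) q" by (simp add: mult.assoc)
  also have "\<dots> \<approx> ghost (head E e) p * (if e = f then V (head E e) else 0) * path (head E f) q"
    using Gh_Ed e f p q by (intro cong_rmult cong_lmult) auto
  also have "\<dots> \<approx> (if e = f then ghost (head E e) p * path (head E e) q else 0)"
    using ghost_V[OF p, of "head E e"] e p q by (auto intro!: cong_rmult)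
  finally show ?thesis .
qed

lemma ghost_path_prefix:
  assumes "awalk u p v" "awalk v q w"
  shows "ghost u p * path u (p @ q) \<approx> path v q"
  using assms(1)
proof (induction p arbitrary: u)
  case Nil
  then show ?case using V_path[OF assms(2), of v] assms by (auto simp: ghost_Nil awalk_Nil_iff)
next
  case (Cons e p)
  have p: "awalk (head E e) p v" using awalk_ConsD[OF Cons.prems] by auto
  have pq: "awalk u (e # p @ q) w"
    using Cons.prems assms(2) by (metis awalk_appendI append_Cons)
  show ?case
    using cong_trans[OF ghost_path_cancel[OF Cons.prems pq]] Cons.IH[OF p] by simp
qed

lemma ghost_path_diverge:
  assumes "awalk u p v" "awalk u q w" "\<And>r. q \<noteq> p @ r" "\<And>r. p \<noteq> q @ r"
  shows "ghost u p * path u q \<approx> 0"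
  using assms
proof (induction p arbitrary: u q)
  case Nil
  then show ?case using Nil.prems(3)[of q] by simp
next
  case (Cons e p)
  obtain f q' where q: "q = f # q'" using Cons.prems(4)[of "e # p"] by (cases q) auto
  have p: "awalk (head E e) p v" using awalk_ConsD[OF Cons.prems(1)] by auto
  have q': "awalk (head E f) q' w" using awalk_ConsD[of u f q'] Cons.prems(2) q by auto
  have "ghost u (e # p) * path u q \<approx> (if e = f then ghost (head E e) p * path (head E e) q' else 0)"
    using ghost_path_cancel[of u e p v f q' w] Cons.prems q by simp
  also have "\<dots> \<approx> 0"
  proof (cases "e = f")
    case True
    have "ghost (head E e) p * path (head E e) q' \<approx> 0"
    proof (rule Cons.IH[OF p])
      show "awalk (head E e) q' w" using q' True by simp
      show "q' \<noteq> p @ r" for r using Cons.prems(3)[of r] q True by simp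
      show "p \<noteq> q' @ r" for r using Cons.prems(4)[of r] q True by simp
    qed
    then show ?thesis using True by simp
  qed auto
  finally show ?case .
qed

lemma ghost_path_same:
  assumes "awalk u p v"
  shows "ghost u p * path u p \<approx> V v"
  using ghost_path_prefix[OF assms, of "[]" v] assms by (auto simp: path_Nil awalk_Nil_iff)

end

section \<open>The grading\<close>

fun gen_degree :: "('v, 'e) lpa_gen \<Rightarrow> int" where
  "gen_degree (Vertex v) = 0"
| "gen_degree (Edge e) = 1"
| "gen_degree (Ghost e) = - 1"

definition word_degree :: "('v, 'e) lpa_gen list \<Rightarrow> int" where
  "word_degree w = sum_list (map gen_degree w)"

lemma word_degree_simps [simp]:
  "word_degree [] = 0" "word_degree (g # w) = gen_degree g + word_degree w"
  "word_degree (u @ w) = word_degree u + word_degree w"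
  by (auto simp: word_degree_def)

lemma word_degree_Edges [simp]: "word_degree (map Edge p) = int (length p)"
  "word_degree (map Ghost p) = - int (length p)"
  by (induction p) auto

text \<open>
  For \<open>N = 0\<close> this is the homogeneous component of degree \<open>i\<close>, because \<open>mod 0\<close> is the identity; for
  \<open>N > 0\<close> it is the component for the grading by the integers modulo \<open>N\<close>.
\<close>

definition degree_part :: "int \<Rightarrow> int \<Rightarrow> (('v, 'e) lpa_gen list \<Rightarrow>\<^sub>0 'k::field) \<Rightarrow> (('v, 'e) lpa_gen list \<Rightarrow>\<^sub>0 'k)"
  where "degree_part N i a =
    (\<Sum>w | w \<in> supp a \<and> word_degree w mod N = i mod N. Poly_Mapping.single w (coef a w))"

lemma lookup_degree_part:
  "coef (degree_part N i a) w = (if word_degree w mod N = i mod N then coef a w else 0)"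
proof -
  let ?S = "{w. w \<in> supp a \<and> word_degree w mod N = i mod N}"
  have fin: "finite ?S" by simp
  have "coef (degree_part N i a) w = (\<Sum>u\<in>?S. if u = w then coef a u else 0)"
    by (simp add: degree_part_def lookup_sum lookup_single when_def)
  also have "\<dots> = (if w \<in> ?S then coef a w else 0)"
    using sum.delta[OF fin, of w "coef a"] by (simp add: eq_commute)
  also have "\<dots> = (if word_degree w mod N = i mod N then coef a w else 0)"
    by (auto simp: in_keys_iff)
  finally show ?thesis .
qed

lemma degree_part_zero [simp]: "degree_part N i 0 = 0"
  by (rule poly_mapping_eqI) (simp add: lookup_degree_part)

lemma degree_part_add: "degree_part N i (a + b) = degree_part N i a + degree_part N i b"
  by (rule poly_mapping_eqI) (simp add: lookup_degree_part lookup_add)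

lemma degree_part_minus: "degree_part N i (a - b) = degree_part N i a - degree_part N i b"
  by (rule poly_mapping_eqI) (simp add: lookup_degree_part lookup_minus)

lemma degree_part_sum: "degree_part N i (sum f I) = (\<Sum>j\<in>I. degree_part N i (f j))"
  by (induction I rule: infinite_finite_induct) (auto simp: degree_part_add)

lemma degree_part_scal: "degree_part N i (scal c * a) = scal c * degree_part N i a"
  by (rule poly_mapping_eqI) (simp add: lookup_degree_part lookup_scal_mult)

lemma degree_part_word:
  "degree_part N i (word w) = (if word_degree w mod N = i mod N then word w else 0)"
  by (rule poly_mapping_eqI) (auto simp: lookup_degree_part word_def lookup_single when_def)

lemma degree_part_degree_part:
  "degree_part 0 i (degree_part 0 j a) = (if i = j then degree_part 0 j a else 0)"
  by (rule poly_mapping_eqI) (auto simp: lookup_degree_part)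

lemma keys_degree_part: "supp (degree_part N i a) \<subseteq> supp a"
  by (auto simp: in_keys_iff lookup_degree_part split: if_splits)

lemma sum_degree_parts:
  "a = (\<Sum>i\<in>(\<lambda>w. word_degree w mod N) ` supp a. degree_part N i a)"
proof (rule poly_mapping_eqI)
  fix w
  let ?S = "(\<lambda>w. word_degree w mod N) ` supp a"
  have "coef (\<Sum>i\<in>?S. degree_part N i a) w
      = (\<Sum>i\<in>?S. if word_degree w mod N = i then coef a w else 0)"
    unfolding lookup_sum by (rule sum.cong) (auto simp: lookup_degree_part)
  also have "\<dots> = coef a w"
    by (auto simp: in_keys_iff)
  finally show "coef a w = coef (\<Sum>i\<in>?S. degree_part N i a) w" by simp
qed

lemma degree_part_as_sum:
  "degree_part N i a = (\<Sum>j | j \<in> word_degree ` supp a \<and> j mod N = i mod N. degree_part 0 j a)"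
proof (rule poly_mapping_eqI)
  fix w
  let ?S = "{j. j \<in> word_degree ` supp a \<and> j mod N = i mod N}"
  have fin: "finite ?S" by simp
  have "coef (\<Sum>j\<in>?S. degree_part 0 j a) w
      = (\<Sum>j\<in>?S. if word_degree w = j then coef a w else 0)"
    unfolding lookup_sum by (rule sum.cong) (auto simp: lookup_degree_part)
  also have "\<dots> = (if word_degree w \<in> ?S then coef a w else 0)"
    using sum.delta[OF fin] by simp
  also have "\<dots> = coef (degree_part N i a) w"
    by (auto simp: in_keys_iff lookup_degree_part)
  finally show "coef (degree_part N i a) w = coef (\<Sum>j\<in>?S. degree_part 0 j a) w"
    by simp
qed

lemma degree_part_word_mult:
  "degree_part N i (word u * a) = word u * degree_part N (i - word_degree u) a"
proof -
  have "supp a \<subseteq> UNIV" by simp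
  then show ?thesis
  proof (induction rule: keys_subset_induct)
    case zero
    then show ?case by simp
  next
    case (add a b)
    then show ?case by (simp add: degree_part_add distrib_left)
  next
    case (monomial c w)
    have "(word_degree u + word_degree w) mod N = i mod N \<longleftrightarrow> word_degree w mod N = (i - word_degree u) mod N"
      using mod_eq_dvd_iff[of "word_degree u + word_degree w" N i]
        mod_eq_dvd_iff[of "word_degree w" N "i - word_degree u"]
      by (simp add: algebra_simps)
    then show ?case
      by (simp add: scal_left_commute degree_part_scal degree_part_word word_append[symmetric])
  qed
qed

lemma degree_part_mult_word:
  "degree_part N i (a * word u) = degree_part N (i - word_degree u) a * word u"
proof -
  have "supp a \<subseteq> UNIV" by simp
  then show ?thesis
  proof (induction rule: keys_subset_induct)
    case zero
    then show ?case by simp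
  next
    case (add a b)
    then show ?case by (simp add: degree_part_add distrib_right)
  next
    case (monomial c w)
    have "(word_degree w + word_degree u) mod N = i mod N \<longleftrightarrow> word_degree w mod N = (i - word_degree u) mod N"
      using mod_eq_dvd_iff[of "word_degree w + word_degree u" N i]
        mod_eq_dvd_iff[of "word_degree w" N "i - word_degree u"]
      by (simp add: algebra_simps)
    then show ?case
      by (simp add: mult.assoc degree_part_scal degree_part_word word_append[symmetric])
  qed
qed

definition homogeneous :: "int \<Rightarrow> (('v, 'e) lpa_gen list \<Rightarrow>\<^sub>0 'k::field) \<Rightarrow> bool" where
  "homogeneous d a \<longleftrightarrow> (\<forall>w\<in>supp a. word_degree w = d)"

lemma homogeneous_zero: "homogeneous d 0" by (simp add: homogeneous_def)

lemma homogeneous_add: "homogeneous d a \<Longrightarrow> homogeneous d b \<Longrightarrow> homogeneous d (a + b)"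
  using Poly_Mapping.keys_add[of a b] unfolding homogeneous_def by blast

lemma homogeneous_minus: "homogeneous d a \<Longrightarrow> homogeneous d b \<Longrightarrow> homogeneous d (a - b)"
  using keys_minus_subset[of a b] unfolding homogeneous_def by blast

lemma homogeneous_sum: "(\<And>i. i \<in> I \<Longrightarrow> homogeneous d (f i)) \<Longrightarrow> homogeneous d (sum f I)"
  by (induction I rule: infinite_finite_induct) (auto intro: homogeneous_zero homogeneous_add)

lemma homogeneous_word: "word_degree w = d \<Longrightarrow> homogeneous d (word w)"
  by (simp add: homogeneous_def word_def)

lemma homogeneous_scal: "homogeneous d a \<Longrightarrow> homogeneous d (scal c * a)"
  unfolding homogeneous_def by (auto simp: in_keys_iff lookup_scal_mult)

lemma homogeneous_mult: "homogeneous c a \<Longrightarrow> homogeneous d b \<Longrightarrow> homogeneous (c + d) (a * b)"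
  using keys_mult[of a b] unfolding homogeneous_def by (fastforce simp: plus_list_def)

lemma degree_part_homogeneous:
  "homogeneous d a \<Longrightarrow> degree_part N i a = (if d mod N = i mod N then a else 0)"
  by (rule poly_mapping_eqI) (auto simp: homogeneous_def lookup_degree_part in_keys_iff)

lemma homogeneous_degree_part: "homogeneous i (degree_part 0 i a)"
  by (auto simp: homogeneous_def in_keys_iff lookup_degree_part split: if_splits)

context leavitt
begin

definition graded :: "(('v, 'e) lpa_gen list \<Rightarrow>\<^sub>0 'k) set \<Rightarrow> bool" where
  "graded J \<longleftrightarrow> (\<forall>a\<in>J. \<forall>i. degree_part 0 i a \<in> J)"

text \<open>
  The largest ideal inside \<open>J\<close> that is graded modulo \<open>N\<close>.
\<close>

definition graded_core :: "int \<Rightarrow> (('v, 'e) lpa_gen list \<Rightarrow>\<^sub>0 'k) set \<Rightarrow> (('v, 'e) lpa_gen list \<Rightarrow>\<^sub>0 'k) set" where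
  "graded_core N J = {a \<in> Alg. \<forall>i. degree_part N i a \<in> J}"

lemma degree_part_Alg: "a \<in> Alg \<Longrightarrow> degree_part N i a \<in> Alg"
  using keys_degree_part[of N i a] unfolding Alg_def free_algebra_def by auto

lemma homogeneous_path: "homogeneous (int (length p)) (path u p)"
  unfolding path_def by (rule homogeneous_word) simp

lemma homogeneous_ghost: "homogeneous (- int (length p)) (ghost u p)"
  unfolding ghost_def by (rule homogeneous_word) simp

lemma lpa_rels_homogeneous: "a \<in> lpa_rels E \<Longrightarrow> \<exists>d. homogeneous d a"
  unfolding lpa_rels_def
  by (elim UnE CollectE exE conjE)
    (force intro!: homogeneous_minus homogeneous_sum homogeneous_word homogeneous_zero)+

lemma degree_part_lmult_mem:
  assumes "x \<in> Mul" "\<And>j. degree_part N j a \<in> J" and J: "lifted_ideal J"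
  shows "degree_part N i (x * a) \<in> J"
  using assms(1)
proof (induction arbitrary: i rule: Mul_induct)
  case zero
  then show ?case using lifted_idealD(4)[OF J] by simp
next
  case (add x y)
  then show ?case using lifted_idealD(3)[OF J] by (simp add: distrib_right degree_part_add)
next
  case (monomial c w)
  have "degree_part N i (scal c * word w * a) = scal c * word w * degree_part N (i - word_degree w) a"
    by (simp add: mult.assoc degree_part_scal degree_part_word_mult)
  then show ?case using lifted_idealD(5)[OF J assms(2)] monomial by (simp add: Mul_word)
qed

lemma degree_part_rmult_mem:
  assumes "x \<in> Mul" "\<And>j. degree_part N j a \<in> J" and J: "lifted_ideal J"
  shows "degree_part N i (a * x) \<in> J"
  using assms(1)
proof (induction arbitrary: i rule: Mul_induct)
  case zero
  then show ?case using lifted_idealD(4)[OF J] by simp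
next
  case (add x y)
  then show ?case using lifted_idealD(3)[OF J] by (simp add: distrib_left degree_part_add)
next
  case (monomial c w)
  have "degree_part N i (a * (scal c * word w)) = degree_part N (i - word_degree w) a * (scal c * word w)"
    by (simp add: scal_left_commute degree_part_scal degree_part_mult_word)
  then show ?case using lifted_idealD(6)[OF J assms(2)] monomial by (simp add: Mul_word)
qed

text \<open>
  The defining relations are homogeneous, so the degree of words induces a grading of the quotient.
\<close>

lemma lpa_ideal_degree_part: "a \<in> lpa_ideal E \<Longrightarrow> degree_part N i (a :: ('v, 'e) lpa_gen list \<Rightarrow>\<^sub>0 'k) \<in> lpa_ideal E"
  unfolding lpa_ideal_def
proof (induction arbitrary: i rule: algebra_ideal_generated.induct)
  case (base a)
  then obtain d where "homogeneous d a" using lpa_rels_homogeneous by blast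
  then show ?case
    using base by (auto simp: degree_part_homogeneous intro: algebra_ideal_generated.intros)
next
  case zero
  then show ?case by (auto intro: algebra_ideal_generated.zero)
next
  case (add a b)
  then show ?case by (auto simp: degree_part_add intro: algebra_ideal_generated.add)
next
  case (scale a c)
  then show ?case
    by (auto simp: scale_conv_scal[symmetric] degree_part_scal[folded scale_conv_scal] intro: algebra_ideal_generated.scale)
next
  case (lmult a x)
  then show ?case
    using degree_part_lmult_mem[OF _ _ lpa_ideal_lifted, of x N a] free_algebra_subset_multipliers[of x "lpa_gens E"]
    unfolding Mul_def lpa_ideal_def by blast
next
  case (rmult a x)
  then show ?case
    using degree_part_rmult_mem[OF _ _ lpa_ideal_lifted, of x N a] free_algebra_subset_multipliers[of x "lpa_gens E"]
    unfolding Mul_def lpa_ideal_def by blast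
qed

lemma lifted_graded_core:
  assumes J: "lifted_ideal J"
  shows "lifted_ideal (graded_core N J)"
  unfolding lifted_ideal_def
proof (intro conjI ballI)
  show "graded_core N J \<subseteq> Alg" by (auto simp: graded_core_def)
  show "lpa_ideal E \<subseteq> graded_core N J"
    using lpa_ideal_degree_part lifted_idealD(1)[OF J] lifted_idealD(2)[OF lpa_ideal_lifted]
    unfolding graded_core_def by blast
  fix a assume a: "a \<in> graded_core N J"
  show "a + b \<in> graded_core N J" if "b \<in> graded_core N J" for b
    using a that lifted_idealD(3)[OF J] by (auto simp: graded_core_def degree_part_add)
  fix x assume "x \<in> Mul"
  then show "x * a \<in> graded_core N J" "a * x \<in> graded_core N J"
    using a degree_part_lmult_mem[OF _ _ J] degree_part_rmult_mem[OF _ _ J]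
    by (auto simp: graded_core_def)
qed

lemma lifted_ideal_sum:
  "lifted_ideal J \<Longrightarrow> (\<And>i. i \<in> I \<Longrightarrow> f i \<in> J) \<Longrightarrow> sum f I \<in> J"
  by (induction I rule: infinite_finite_induct) (auto intro: lifted_idealD)

lemma graded_core_subset:
  assumes J: "lifted_ideal J"
  shows "graded_core N J \<subseteq> J"
proof
  fix a assume "a \<in> graded_core N J"
  then have "(\<Sum>i\<in>(\<lambda>w. word_degree w mod N) ` supp a. degree_part N i a) \<in> J"
    by (intro lifted_ideal_sum[OF J]) (auto simp: graded_core_def)
  then show "a \<in> J" by (simp only: sum_degree_parts[symmetric])
qed

lemma graded_graded_core: "lifted_ideal J \<Longrightarrow> graded (graded_core 0 J)"
  unfolding graded_def graded_core_def
  by (auto simp: degree_part_Alg degree_part_degree_part lifted_idealD)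

lemma homogeneous_graded_core:
  "lifted_ideal J \<Longrightarrow> homogeneous d a \<Longrightarrow> a \<in> J \<Longrightarrow> a \<in> graded_core N J"
  using lifted_idealD(2)[of J] lifted_idealD(4)[of J]
  by (auto simp: graded_core_def degree_part_homogeneous)

lemma graded_core_zero_subset:
  assumes J: "lifted_ideal J"
  shows "graded_core 0 J \<subseteq> graded_core N J"
proof
  fix a assume a: "a \<in> graded_core 0 J"
  then have "degree_part N i a \<in> J" for i
    unfolding degree_part_as_sum[of N]
    by (intro lifted_ideal_sum[OF J]) (auto simp: graded_core_def)
  then show "a \<in> graded_core N J" using a by (simp add: graded_core_def)
qed

text \<open>An element has only finitely many nonzero homogeneous components, so a large modulus
  separates all of them.\<close>

lemma graded_core_large_modulus:
  assumes J: "lifted_ideal J" and a: "a \<in> Alg"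
  shows "\<exists>M. \<forall>N\<ge>M. a \<in> graded_core N J \<longrightarrow> a \<in> graded_core 0 J"
proof -
  define B where "B = Max (insert 0 ((\<lambda>w. \<bar>word_degree w\<bar>) ` supp a))"
  have B: "\<bar>word_degree w\<bar> \<le> B" if "w \<in> supp a" for w
    unfolding B_def using that by (intro Max_ge) auto
  \<comment> \<open>Degrees between \<open>- B\<close> and \<open>B\<close> are pairwise incongruent modulo such \<open>N\<close>.\<close>
  have "degree_part 0 i a \<in> J" if N: "N \<ge> 2 * B + 1" and aN: "a \<in> graded_core N J" for N i
  proof (cases "\<bar>i\<bar> \<le> B")
    case True
    have eq: "degree_part 0 i a = degree_part N i a"
    proof (rule poly_mapping_eqI)
      fix w
      have "word_degree w mod N = i mod N \<longleftrightarrow> word_degree w = i" if w: "w \<in> supp a"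
      proof
        assume "word_degree w mod N = i mod N"
        then have "N dvd word_degree w - i" by (simp add: mod_eq_dvd_iff)
        moreover have "\<bar>word_degree w - i\<bar> < N" using B[OF w] True N by linarith
        ultimately show "word_degree w = i"
          using dvd_imp_le_int[of "word_degree w - i" N] by linarith
      qed simp
      then show "coef (degree_part 0 i a) w = coef (degree_part N i a) w"
        by (auto simp: lookup_degree_part in_keys_iff)
    qed
    then show ?thesis using aN by (simp add: graded_core_def)
  next
    case False
    then have "degree_part 0 i a = 0"
      using B by (intro poly_mapping_eqI) (auto simp: lookup_degree_part in_keys_iff)
    then show ?thesis using lifted_idealD(4)[OF J] by simp
  qed
  then show ?thesis using a by (auto simp: graded_core_def)
qed

end

section \<open>Local units and normal forms\<close>

context leavitt_ideal
begin

fun source :: "('v, 'e) lpa_gen \<Rightarrow> 'v" where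
  "source (Vertex v) = v" | "source (Edge e) = tail E e" | "source (Ghost e) = head E e"

fun target :: "('v, 'e) lpa_gen \<Rightarrow> 'v" where
  "target (Vertex v) = v" | "target (Edge e) = head E e" | "target (Ghost e) = tail E e"

lemma gen_V:
  assumes "g \<in> lpa_gens E" "v \<in> verts E"
  shows "word [g] * V v \<approx> (if v = target g then word [g] else 0)"
proof (cases g)
  case (Vertex u)
  then show ?thesis using V_V[of u v] assms by (cases "u = v") auto
next
  case (Edge e)
  then show ?thesis using Ed_V_if[of e v] assms by (auto split: if_splits)
next
  case (Ghost e)
  then show ?thesis using Gh_V_if[of e v] assms by (auto split: if_splits)
qed

lemma target_verts: "g \<in> lpa_gens E \<Longrightarrow> target g \<in> verts E"
  by (cases g) auto

text \<open>
  The algebra has no unit if the graph has infinitely many vertices, but a finite sum of vertices fixes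
  \<open>x\<close>.  Allowing all larger finite sets makes the statement stable under addition.
\<close>

lemma local_unit:
  assumes "x \<in> Alg"
  shows "\<exists>F. finite F \<and> F \<subseteq> verts E \<and> (\<forall>F'. finite F' \<longrightarrow> F \<subseteq> F' \<longrightarrow> F' \<subseteq> verts E \<longrightarrow> x \<approx> (\<Sum>v\<in>F'. x * V v))"
  using assms
proof (induction rule: Alg_induct)
  case zero
  then show ?case by (intro exI[of _ "{}"]) auto
next
  case (add a b)
  then obtain F G where F: "finite F" "F \<subseteq> verts E" "\<And>F'. finite F' \<Longrightarrow> F \<subseteq> F' \<Longrightarrow> F' \<subseteq> verts E \<Longrightarrow> a \<approx> (\<Sum>v\<in>F'. a * V v)"
    and G: "finite G" "G \<subseteq> verts E" "\<And>F'. finite F' \<Longrightarrow> G \<subseteq> F' \<Longrightarrow> F' \<subseteq> verts E \<Longrightarrow> b \<approx> (\<Sum>v\<in>F'. b * V v)"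
    by blast
  show ?case
    by (intro exI[of _ "F \<union> G"]) (use F G in \<open>auto simp: distrib_right sum.distrib intro!: cong_add\<close>)
next
  case (monomial c w)
  obtain u g where w: "w = u @ [g]" using monomial(2) by (cases w rule: rev_cases) auto
  have u: "u \<in> lists (lpa_gens E)" and g: "g \<in> lpa_gens E" using monomial(1) w by auto
  have *: "scal c * word w * V v \<approx> (if v = target g then scal c * word w else 0)" if "v \<in> verts E" for v
  proof -
    have uM: "scal c * word u \<in> Mul" using u by (intro Mul_intros) (simp add: Mul_word)
    have "scal c * word w * V v = (scal c * word u) * (word [g] * V v)"
      by (simp only: w word_append mult.assoc)
    also have "\<dots> \<approx> (scal c * word u) * (if v = target g then word [g] else 0)"
      by (rule cong_lmult[OF gen_V[OF g that] uM])
    also have "\<dots> = (if v = target g then scal c * word w else 0)"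
      by (simp add: w word_append mult.assoc)
    finally show ?thesis .
  qed
  show ?case
  proof (intro exI[of _ "{target g}"] conjI allI impI)
    fix F' assume F': "finite F'" "{target g} \<subseteq> F'" "F' \<subseteq> verts E"
    have "(\<Sum>v\<in>F'. scal c * word w * V v) \<approx> (\<Sum>v\<in>F'. if v = target g then scal c * word w else 0)"
      using F' by (intro cong_sum *) auto
    also have "\<dots> = scal c * word w" using F' by simp
    finally show "scal c * word w \<approx> (\<Sum>v\<in>F'. scal c * word w * V v)" by (rule cong_sym)
  qed (use target_verts[OF g] in auto)
qed

lemma exists_V_notin:
  assumes "x \<in> Alg" "x \<notin> J"
  shows "\<exists>v\<in>verts E. x * V v \<notin> J"
proof (rule ccontr)
  assume a: "\<not> (\<exists>v\<in>verts E. x * V v \<notin> J)"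
  obtain F where F: "F \<subseteq> verts E" "x \<approx> (\<Sum>v\<in>F. x * V v)" using local_unit[OF assms(1)] by blast
  have "(\<Sum>v\<in>F. x * V v) \<in> J" by (rule J_sum) (use a F(1) in blast)
  then show False using cong_mem[OF F(2)] assms by simp
qed

text \<open>
  The elements \<open>p q\<^sup>*\<close> span the algebra; the degree is recorded because the homogeneous components are
  defined by means of these elements.
\<close>

definition normal_form :: "(('v, 'e) lpa_gen list \<Rightarrow>\<^sub>0 'k) \<Rightarrow> int \<Rightarrow> bool" where
  "normal_form a d \<longleftrightarrow> a \<approx> 0 \<or> (\<exists>u p v q x. awalk u p x \<and> awalk v q x \<and>
     int (length p) - int (length q) = d \<and> a \<approx> path u p * ghost v q)"

lemma normal_form_zero: "a \<approx> 0 \<Longrightarrow> normal_form a d"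
  by (simp add: normal_form_def)

lemma normal_formI: "awalk u p x \<Longrightarrow> awalk v q x \<Longrightarrow> int (length p) - int (length q) = d \<Longrightarrow>
    a \<approx> path u p * ghost v q \<Longrightarrow> normal_form a d"
  unfolding normal_form_def by blast

lemma normal_form_cong: "a \<approx> b \<Longrightarrow> normal_form b d \<Longrightarrow> normal_form a d"
  unfolding normal_form_def using cong_trans[of a b] by blast

lemma normal_form_gen:
  assumes "g \<in> lpa_gens E"
  shows "normal_form (word [g]) (gen_degree g)"
proof (cases g)
  case (Vertex v)
  then have v: "v \<in> verts E" using assms by simp
  then show ?thesis
    using cong_sym[OF V_V[OF v v]] Vertex
    by (intro normal_formI[of v "[]" v v "[]"]) (auto simp: awalk_Nil_iff path_Nil ghost_Nil)
next
  case (Edge e)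
  then have e: "e \<in> arcs E" using assms by simp
  then have w: "awalk (tail E e) [e] (head E e)" by (simp add: awalk_simps)
  have "path (tail E e) [e] * V (head E e) \<approx> path (tail E e) [e]"
    using path_V[OF w, of "head E e"] e by simp
  also have "\<dots> \<approx> Ed e * V (head E e)" using path_Cons[OF w] by (simp add: path_Nil)
  also have "\<dots> \<approx> Ed e" by (rule Ed_V[OF e])
  finally show ?thesis
    using w e Edge by (intro normal_formI[of "tail E e" "[e]" "head E e" "head E e" "[]"])
      (auto simp: awalk_Nil_iff ghost_Nil intro: cong_sym)
next
  case (Ghost e)
  then have e: "e \<in> arcs E" using assms by simp
  then have w: "awalk (tail E e) [e] (head E e)" by (simp add: awalk_simps)
  have "V (head E e) * ghost (tail E e) [e] \<approx> ghost (tail E e) [e]"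
    using V_ghost[OF w, of "head E e"] e by simp
  also have "\<dots> \<approx> V (head E e) * Gh e" using ghost_Cons[OF w] by (simp add: ghost_Nil)
  also have "\<dots> \<approx> Gh e" by (rule V_Gh[OF e])
  finally show ?thesis
    using w e Ghost by (intro normal_formI[of "head E e" "[]" "head E e" "tail E e" "[e]"])
      (auto simp: awalk_Nil_iff path_Nil intro: cong_sym)
qed

lemma normal_form_lmult:
  assumes g: "g \<in> lpa_gens E" and p: "awalk u p x" and q: "awalk v q x"
  shows "normal_form (word [g] * (path u p * ghost v q)) (gen_degree g + int (length p) - int (length q))"
proof (cases g)
  case (Vertex y)
  then have y: "y \<in> verts E" using g by simp
  have "V y * (path u p * ghost v q) = (V y * path u p) * ghost v q" by (simp add: mult.assoc)
  also have "\<dots> \<approx> (if y = u then path u p else 0) * ghost v q"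
    using V_path[OF p y] q by (intro cong_rmult) auto
  finally show ?thesis
    using p q Vertex by (cases "y = u") (auto intro: normal_formI normal_form_zero)
next
  case (Edge e)
  then have e: "e \<in> arcs E" using g by simp
  show ?thesis
  proof (cases "head E e = u")
    case True
    then have w: "awalk (tail E e) (e # p) x" using p e by (auto simp: awalk_Cons_iff)
    have "Ed e * (path u p * ghost v q) = (Ed e * path u p) * ghost v q" by (simp add: mult.assoc)
    also have "\<dots> \<approx> path (tail E e) (e # p) * ghost v q"
      using cong_sym[OF path_Cons[OF w]] True q by (intro cong_rmult) auto
    finally show ?thesis using w q Edge by (auto intro!: normal_formI[OF w q])
  next
    case False
    have "Ed e * (path u p * ghost v q) \<approx> (Ed e * V (head E e)) * (path u p * ghost v q)"
      using cong_sym[OF Ed_V[OF e]] p q by (intro cong_rmult) auto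
    also have "\<dots> = Ed e * (V (head E e) * path u p) * ghost v q" by (simp add: mult.assoc)
    also have "\<dots> \<approx> Ed e * 0 * ghost v q"
      using V_path[OF p, of "head E e"] False p q e by (intro cong_rmult cong_lmult) auto
    finally show ?thesis using Edge by (auto intro: normal_form_zero)
  qed
next
  case (Ghost e)
  then have e: "e \<in> arcs E" using g by simp
  have te: "tail E e \<in> verts E" using e by simp
  show ?thesis
  proof (cases p)
    case Nil
    then have ux: "u = x" "u \<in> verts E" using p by (auto simp: awalk_Nil_iff)
    have "Gh e * (path u p * ghost v q) = (Gh e * V u) * ghost v q"
      by (simp add: Nil path_Nil mult.assoc)
    also have "\<dots> \<approx> (if u = tail E e then Gh e else 0) * ghost v q"
      using Gh_V_if[OF e ux(2)] q by (intro cong_rmult) auto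
    finally have 1: "Gh e * (path u p * ghost v q) \<approx> (if u = tail E e then Gh e * ghost v q else 0)"
      by (auto split: if_splits)
    show ?thesis
    proof (cases "u = tail E e")
      case True
      have w: "awalk v (q @ [e]) (head E e)"
        using q e True ux by (auto intro!: awalk_appendI[OF q] simp: awalk_simps)
      have snoc: "Gh e * ghost v q = ghost v (q @ [e])"
        by (simp add: ghost_def word_Cons[of "Ghost e" "_ @ _"])
      have "ghost v (q @ [e]) \<approx> path (head E e) [] * ghost v (q @ [e])"
        using cong_sym[OF V_ghost[OF w, of "head E e"]] e by (simp add: path_Nil)
      then have "Gh e * ghost v q \<approx> path (head E e) [] * ghost v (q @ [e])"
        by (simp only: snoc)
      then show ?thesis
        using cong_trans[OF 1] True Ghost Nil w e
        by (auto intro!: normal_formI[OF _ w, of "head E e" "[]"] simp: awalk_Nil_iff)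
    next
      case False
      then show ?thesis using 1 Ghost by (auto intro: normal_form_zero)
    qed
  next
    case (Cons f p')
    have f: "f \<in> arcs E" "tail E f = u" and p': "awalk (head E f) p' x"
      using awalk_ConsD[of u f p' x] p Cons by auto
    have "Gh e * (path u p * ghost v q) = (Gh e * path u p) * ghost v q" by (simp add: mult.assoc)
    also have "\<dots> \<approx> (Gh e * (Ed f * path (head E f) p')) * ghost v q"
      using path_Cons[of u f p' x] p Cons q e by (intro cong_rmult cong_lmult) auto
    also have "\<dots> = (Gh e * Ed f) * path (head E f) p' * ghost v q" by (simp add: mult.assoc)
    also have "\<dots> \<approx> (if e = f then V (head E e) else 0) * path (head E f) p' * ghost v q"
      using Gh_Ed[OF e f(1)] p' q by (intro cong_rmult) auto
    also have "\<dots> \<approx> (if e = f then path (head E f) p' * ghost v q else 0)"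
      using V_path[OF p', of "head E e"] e q by (auto intro!: cong_rmult)
    finally show ?thesis
      using p' q Ghost Cons by (cases "e = f") (auto intro: normal_form_zero normal_formI[OF p' q])
  qed
qed

lemma word_normal_form:
  assumes "w \<in> lists (lpa_gens E)" "w \<noteq> []"
  shows "normal_form (word w) (word_degree w)"
  using assms(2,1)
proof (induction w rule: list_nonempty_induct)
  case (single g)
  then show ?case using normal_form_gen[of g] by simp
next
  case (cons g w)
  have g: "g \<in> lpa_gens E" using cons by auto
  have e: "word (g # w) = word [g] * word w" by (rule word_Cons)
  have gM: "word [g] \<in> Mul" using g by (simp add: Mul_word)
  from cons have "normal_form (word w) (word_degree w)" by auto
  then consider "word w \<approx> 0" | u p v q x where "awalk u p x" "awalk v q x"
     "int (length p) - int (length q) = word_degree w" "word w \<approx> path u p * ghost v q"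
    unfolding normal_form_def by blast
  then show ?case
  proof cases
    case 1
    then show ?thesis unfolding e by (intro normal_form_zero zero_lmult gM)
  next
    case 2
    have "word (g # w) \<approx> word [g] * (path u p * ghost v q)"
      unfolding e by (intro cong_lmult 2 gM)
    moreover have "gen_degree g + int (length p) - int (length q) = word_degree (g # w)"
      using 2(3) by simp
    ultimately show ?thesis
      using normal_form_cong normal_form_lmult[OF g 2(1,2)] by metis
  qed
qed

end

section \<open>Reduction of elements to vertices\<close>

context leavitt
begin

definition path_words :: "'v \<Rightarrow> ('v, 'e) lpa_gen list set" where
  "path_words v = {Vertex u # map Edge p | u p. awalk u p v}"

text \<open>
  Only closed paths of positive length occur here, hence all these words have positive degree.
\<close>

definition cycle_words :: "'v \<Rightarrow> ('v, 'e) lpa_gen list set" where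
  "cycle_words v = {Vertex v # map Edge p | p. closed_path E v p}"

definition vertices_in :: "(('v, 'e) lpa_gen list \<Rightarrow>\<^sub>0 'k) set \<Rightarrow> 'v set" where
  "vertices_in J = {v \<in> verts E. V v \<in> J}"

text \<open>
  The element usually written \<open>v\<^sup>H\<close>.  The sum is finite if \<open>v\<close> is a breaking vertex of \<open>H\<close>.
\<close>

definition breaking_element :: "'v set \<Rightarrow> 'v \<Rightarrow> ('v, 'e) lpa_gen list \<Rightarrow>\<^sub>0 'k" where
  "breaking_element H v = V v - (\<Sum>e | e \<in> out_arcs E v \<and> head E e \<notin> H. Ed e * Gh e)"

lemma cycle_words_subset: "cycle_words v \<subseteq> path_words v"
  unfolding cycle_words_def path_words_def closed_path_def by auto

lemma path_words_lists: "path_words v \<subseteq> lists (lpa_gens E)"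
  unfolding path_words_def by (auto simp: awalk_def subset_iff)

lemma Mul_path_words: "supp y \<subseteq> path_words v \<Longrightarrow> y \<in> Mul"
  using path_words_lists unfolding Mul_def multipliers_def by blast

lemma Mul_cycle_words: "supp z \<subseteq> cycle_words v \<Longrightarrow> z \<in> Mul"
  using Mul_path_words cycle_words_subset by blast

lemma breaking_element_Alg:
  assumes "v \<in> verts E"
  shows "breaking_element H v \<in> Alg"
proof -
  have "finite S \<Longrightarrow> S \<subseteq> arcs E \<Longrightarrow> (\<Sum>e\<in>S. Ed e * Gh e) \<in> Alg" for S
    by (induction S rule: finite_induct) auto
  then have "(\<Sum>e | e \<in> out_arcs E v \<and> head E e \<notin> H. Ed e * Gh e) \<in> Alg"
    by (cases "finite {e. e \<in> out_arcs E v \<and> head E e \<notin> H}") auto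
  then show ?thesis using assms by (simp add: breaking_element_def)
qed

lemma breaking_element_Mul: "v \<in> verts E \<Longrightarrow> breaking_element H v \<in> Mul"
  using breaking_element_Alg Alg_Mul by blast

end

context leavitt_ideal
begin

lemma path_words_V:
  assumes "supp y \<subseteq> path_words v"
  shows "y * V v \<approx> y"
  using assms
proof (induction rule: keys_subset_induct)
  case zero
  then show ?case by simp
next
  case (add a b)
  then show ?case by (simp add: distrib_right cong_add)
next
  case (monomial c w)
  then obtain u p where w: "w = Vertex u # map Edge p" "awalk u p v" unfolding path_words_def by auto
  then have "path u p * V v \<approx> path u p" using path_V[of u p v v] by auto
  then show ?case using cong_scal[of _ _ c] w by (simp add: path_def mult.assoc)
qed

lemma breaking_element_Ed:
  assumes "finite {e. e \<in> out_arcs E v \<and> head E e \<notin> H}" "e \<in> out_arcs E v"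
  shows "breaking_element H v * Ed e \<approx> (if head E e \<in> H then Ed e else 0)"
proof -
  let ?D = "{e. e \<in> out_arcs E v \<and> head E e \<notin> H}"
  have e: "e \<in> arcs E" "tail E e = v" using assms by auto
  have 1: "(\<Sum>f\<in>?D. Ed f * Gh f * Ed e) \<approx> (\<Sum>f\<in>?D. if f = e then Ed e else 0)"
  proof (rule cong_sum)
    fix f assume f: "f \<in> ?D"
    have "Ed f * Gh f * Ed e = Ed f * (Gh f * Ed e)" by (simp add: mult.assoc)
    also have "\<dots> \<approx> Ed f * (if f = e then V (head E f) else 0)"
      using f e by (intro cong_lmult Gh_Ed) auto
    also have "\<dots> \<approx> (if f = e then Ed e else 0)"
      using Ed_V[OF e(1)] by simp
    finally show "Ed f * Gh f * Ed e \<approx> (if f = e then Ed e else 0)" .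
  qed
  have 2: "(\<Sum>f\<in>?D. if f = e then Ed e else 0) = (if head E e \<in> H then 0 else Ed e)"
    using assms by (simp add: sum.delta)
  have "V v * Ed e \<approx> Ed e" using V_Ed[OF e(1)] e by simp
  from cong_diff[OF this 1] show ?thesis
    unfolding 2 by (auto simp: breaking_element_def left_diff_distrib sum_distrib_right split: if_splits)
qed

lemma Gh_breaking_element:
  assumes "finite {e. e \<in> out_arcs E v \<and> head E e \<notin> H}" "e \<in> out_arcs E v"
  shows "Gh e * breaking_element H v \<approx> (if head E e \<in> H then Gh e else 0)"
proof -
  let ?D = "{e. e \<in> out_arcs E v \<and> head E e \<notin> H}"
  have e: "e \<in> arcs E" "tail E e = v" using assms by auto
  have 1: "(\<Sum>f\<in>?D. Gh e * (Ed f * Gh f)) \<approx> (\<Sum>f\<in>?D. if f = e then Gh e else 0)"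
  proof (rule cong_sum)
    fix f assume f: "f \<in> ?D"
    have "Gh e * (Ed f * Gh f) = (Gh e * Ed f) * Gh f" by (simp add: mult.assoc)
    also have "\<dots> \<approx> (if e = f then V (head E e) else 0) * Gh f"
      using f e by (intro cong_rmult Gh_Ed) auto
    also have "\<dots> \<approx> (if f = e then Gh e else 0)"
      using V_Gh[OF e(1)] by simp
    finally show "Gh e * (Ed f * Gh f) \<approx> (if f = e then Gh e else 0)" .
  qed
  have 2: "(\<Sum>f\<in>?D. if f = e then Gh e else 0) = (if head E e \<in> H then 0 else Gh e)"
    using assms by (simp add: sum.delta)
  have "Gh e * V v \<approx> Gh e" using Gh_V[OF e(1)] e by simp
  from cong_diff[OF this 1] show ?thesis
    unfolding 2 by (auto simp: breaking_element_def right_diff_distrib sum_distrib_left split: if_splits)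
qed

lemma V_breaking_element:
  assumes "v \<in> verts E"
  shows "V v * breaking_element H v \<approx> breaking_element H v"
proof -
  have "(\<Sum>e | e \<in> out_arcs E v \<and> head E e \<notin> H. V v * (Ed e * Gh e))
      \<approx> (\<Sum>e | e \<in> out_arcs E v \<and> head E e \<notin> H. Ed e * Gh e)"
  proof (rule cong_sum)
    fix e assume "e \<in> {e. e \<in> out_arcs E v \<and> head E e \<notin> H}"
    then show "V v * (Ed e * Gh e) \<approx> Ed e * Gh e"
      using cong_rmult[OF V_Ed[of e], of "Gh e"] by (auto simp: mult.assoc)
  qed
  moreover have "V v * V v \<approx> V v" using V_V[OF assms assms] by simp
  ultimately show ?thesis
    by (simp add: breaking_element_def right_diff_distrib sum_distrib_left cong_diff)
qed

lemma breaking_element_V: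
  assumes "v \<in> verts E"
  shows "breaking_element H v * V v \<approx> breaking_element H v"
proof -
  have "(\<Sum>e | e \<in> out_arcs E v \<and> head E e \<notin> H. Ed e * Gh e * V v)
      \<approx> (\<Sum>e | e \<in> out_arcs E v \<and> head E e \<notin> H. Ed e * Gh e)"
  proof (rule cong_sum)
    fix e assume "e \<in> {e. e \<in> out_arcs E v \<and> head E e \<notin> H}"
    then show "Ed e * Gh e * V v \<approx> Ed e * Gh e"
      using cong_lmult[OF Gh_V[of e], of "Ed e"] by (auto simp: mult.assoc)
  qed
  moreover have "V v * V v \<approx> V v" using V_V[OF assms assms] by simp
  ultimately show ?thesis
    by (simp add: breaking_element_def left_diff_distrib sum_distrib_right cong_diff)
qed

lemma breaking_element_idem:
  assumes fin: "finite {e. e \<in> out_arcs E v \<and> head E e \<notin> H}" and v: "v \<in> verts E"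
  shows "breaking_element H v * breaking_element H v \<approx> breaking_element H v"
proof -
  let ?D = "{e. e \<in> out_arcs E v \<and> head E e \<notin> H}" and ?b = "breaking_element H v"
  have "(\<Sum>e\<in>?D. ?b * (Ed e * Gh e)) \<approx> (\<Sum>e\<in>?D. 0)"
  proof (rule cong_sum)
    fix e assume e: "e \<in> ?D"
    have "?b * (Ed e * Gh e) = (?b * Ed e) * Gh e" by (simp add: mult.assoc)
    also have "\<dots> \<approx> 0"
      by (rule zero_rmult) (use breaking_element_Ed[OF fin, of e] e in auto)
    finally show "?b * (Ed e * Gh e) \<approx> 0" .
  qed
  from cong_diff[OF breaking_element_V[OF v, of H] this]
  have "?b * V v - (\<Sum>e\<in>?D. ?b * (Ed e * Gh e)) \<approx> ?b" by simp
  moreover have "?b * ?b = ?b * V v - (\<Sum>e\<in>?D. ?b * (Ed e * Gh e))"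
    by (subst (2) breaking_element_def) (simp add: right_diff_distrib sum_distrib_left)
  ultimately show ?thesis by simp
qed

text \<open>
  A ghost path \<open>q\<^sup>*\<close> followed by a path at least as long as \<open>q\<close> is \<open>0\<close> or a path, so multiplication by a
  long path cancels all ghost edges of \<open>x\<close>.
\<close>

lemma eventually_real:
  assumes "x \<in> Alg"
  shows "\<exists>n. \<forall>u q v. awalk u q v \<longrightarrow> n \<le> length q \<longrightarrow>
    (\<exists>y. supp y \<subseteq> path_words v \<and> x * path u q \<approx> y)"
  using assms
proof (induction rule: Alg_induct)
  case zero
  have "supp 0 \<subseteq> path_words v \<and> 0 * path u q \<approx> 0" for u q v by simp
  then show ?case by blast
next
  case (add a b)
  then obtain n m where n: "\<And>u q v. awalk u q v \<Longrightarrow> n \<le> length q \<Longrightarrow> \<exists>y. supp y \<subseteq> path_words v \<and> a * path u q \<approx> y"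
    and m: "\<And>u q v. awalk u q v \<Longrightarrow> m \<le> length q \<Longrightarrow> \<exists>y. supp y \<subseteq> path_words v \<and> b * path u q \<approx> y"
    by blast
  show ?case
  proof (intro exI[of _ "max n m"] allI impI)
    fix u q v assume w: "awalk u q v" "max n m \<le> length q"
    obtain y y' where y: "supp y \<subseteq> path_words v" "a * path u q \<approx> y"
      and y': "supp y' \<subseteq> path_words v" "b * path u q \<approx> y'"
      using n[OF w(1)] m[OF w(1)] w(2) by auto
    have "supp (y + y') \<subseteq> path_words v"
      using Poly_Mapping.keys_add[of y y'] y y' by blast
    then show "\<exists>y. supp y \<subseteq> path_words v \<and> (a + b) * path u q \<approx> y"
      using cong_add[OF y(2) y'(2)] by (auto simp: distrib_right)
  qed
next
  case (monomial c w)
  have wM: "word w \<in> Mul" using monomial by (simp add: Mul_word)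
  have 0: "\<exists>y. supp y \<subseteq> path_words v \<and> scal c * word w * path u q \<approx> y"
    if "word w * path u q \<approx> 0" for u q v
    using cong_scal[OF that, of c] by (intro exI[of _ 0]) (simp add: mult.assoc)
  from word_normal_form[OF monomial] consider "word w \<approx> 0"
    | u p v q x where "awalk u p x" "awalk v q x" "word w \<approx> path u p * ghost v q"
    unfolding normal_form_def by blast
  then show ?case
  proof cases
    case 1
    then show ?thesis using 0 zero_rmult[OF 1 Mul_path] by blast
  next
    case (2 u0 p0 v0 q0 x0)
    show ?thesis
    proof (intro exI[of _ "length q0"] allI impI)
      fix u q v assume q: "awalk u q v" and le: "length q0 \<le> length q"
      have "word w * path u q \<approx> (path u0 p0 * ghost v0 q0) * path u q"
        using q by (intro cong_rmult 2) auto
      then have e: "word w * path u q \<approx> path u0 p0 * (ghost v0 q0 * path u q)" by (simp add: mult.assoc)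
      have zz: "word w * path u q \<approx> 0" if "ghost v0 q0 * path u q \<approx> 0"
        by (rule cong_trans[OF e zero_lmult[OF that]]) (use 2 in auto)
      consider "u \<noteq> v0" | r where "u = v0" "q = q0 @ r" | "u = v0" "\<And>r. q \<noteq> q0 @ r" by blast
      then show "\<exists>y. supp y \<subseteq> path_words v \<and> scal c * word w * path u q \<approx> y"
      proof cases
        case 1
        then show ?thesis using 0 zz ghost_path_zero[OF 2(2) q] by blast
      next
        case 3
        have "q0 \<noteq> q @ r" for r using 3(2)[of "[]"] le by auto
        then show ?thesis using 0 zz ghost_path_diverge[OF 2(2), of q v] 3 q by blast
      next
        case r: 2
        have r': "awalk x0 r v" using q 2(2) r by (auto dest: awalk_ends)
        have pr: "awalk u0 (p0 @ r) v" by (rule awalk_appendI[OF 2(1) r'])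
        have "path u0 p0 * (ghost v0 q0 * path u q) \<approx> path u0 p0 * path x0 r"
          using ghost_path_prefix[OF 2(2) r'] r 2 by (intro cong_lmult) auto
        also have "\<dots> \<approx> path u0 (p0 @ r)" by (rule path_path[OF 2(1) r'])
        finally have "word w * path u q \<approx> path u0 (p0 @ r)" using cong_trans[OF e] by blast
        then have "scal c * word w * path u q \<approx> scal c * path u0 (p0 @ r)"
          using cong_scal by (simp add: mult.assoc)
        moreover have "Vertex u0 # map Edge (p0 @ r) \<in> path_words v"
          using pr unfolding path_words_def by blast
        then have "supp (scal c * path u0 (p0 @ r)) \<subseteq> path_words v"
          by (auto simp: path_def scal_mult_word)
        ultimately show ?thesis by blast
      qed
    qed
  qed
qed

text \<open>
  A term of \<open>x v\<close> is a real path or ends in a ghost edge \<open>f\<^sup>*\<close>.  In the second case it is fixed by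
  \<open>\<Sum> e e\<^sup>*\<close> as soon as the sum includes \<open>f\<close>.  The real terms form \<open>y\<close>, and \<open>D\<close> collects the edges \<open>f\<close>.
  Quantifying over all larger sets makes the statement additive in \<open>x\<close> and leaves the final choice of
  the set to the application.
\<close>

lemma split_at_vertex:
  assumes "x \<in> Alg" and v: "v \<in> verts E"
  shows "\<exists>y D. supp y \<subseteq> path_words v \<and> finite D \<and> D \<subseteq> out_arcs E v \<and>
    (\<forall>D'. finite D' \<longrightarrow> D \<subseteq> D' \<longrightarrow> D' \<subseteq> out_arcs E v \<longrightarrow>
       x * V v - y \<approx> (\<Sum>e\<in>D'. (x - y) * (Ed e * Gh e)))"
  using assms(1)
proof (induction rule: Alg_induct)
  case zero
  show ?case by (intro exI[of _ 0] exI[of _ "{}"]) auto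
next
  case (add a b)
  from add.IH(1) obtain y D where y: "supp y \<subseteq> path_words v" "finite D" "D \<subseteq> out_arcs E v"
      "\<And>D'. finite D' \<Longrightarrow> D \<subseteq> D' \<Longrightarrow> D' \<subseteq> out_arcs E v \<Longrightarrow>
       a * V v - y \<approx> (\<Sum>e\<in>D'. (a - y) * (Ed e * Gh e))"
    by (elim exE conjE) (rule that, assumption+, blast)
  from add.IH(2) obtain y' D'' where y': "supp y' \<subseteq> path_words v" "finite D''" "D'' \<subseteq> out_arcs E v"
      "\<And>D'. finite D' \<Longrightarrow> D'' \<subseteq> D' \<Longrightarrow> D' \<subseteq> out_arcs E v \<Longrightarrow>
       b * V v - y' \<approx> (\<Sum>e\<in>D'. (b - y') * (Ed e * Gh e))"
    by (elim exE conjE) (rule that, assumption+, blast)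
  show ?case
  proof (intro exI[of _ "y + y'"] exI[of _ "D \<union> D''"] conjI allI impI)
    show "supp (y + y') \<subseteq> path_words v"
      using Poly_Mapping.keys_add[of y y'] y y' by blast
    fix D' assume D': "finite D'" "D \<union> D'' \<subseteq> D'" "D' \<subseteq> out_arcs E v"
    have "(a * V v - y) + (b * V v - y') \<approx>
        (\<Sum>e\<in>D'. (a - y) * (Ed e * Gh e)) + (\<Sum>e\<in>D'. (b - y') * (Ed e * Gh e))"
      using D' by (intro cong_add y(4) y'(4)) auto
    moreover have "(\<Sum>e\<in>D'. (a - y) * (Ed e * Gh e)) + (\<Sum>e\<in>D'. (b - y') * (Ed e * Gh e))
        = (\<Sum>e\<in>D'. (a + b - (y + y')) * (Ed e * Gh e))"
      unfolding sum.distrib[symmetric] by (rule sum.cong) (auto simp: algebra_simps)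
    ultimately show "(a + b) * V v - (y + y') \<approx> (\<Sum>e\<in>D'. (a + b - (y + y')) * (Ed e * Gh e))"
      by (simp add: distrib_right add_diff_add)
  qed (use y y' in auto)
next
  case (monomial c w)
  let ?x = "scal c * word w"
  have xM: "?x \<in> Mul" using monomial by (simp add: Mul_word)
  have EG: "Ed e * Gh e \<in> Mul" if "e \<in> out_arcs E v" for e using that by auto
  have triv: ?case if yk: "supp y \<subseteq> path_words v" and 1: "?x * V v \<approx> y" and
    2: "\<And>e. e \<in> out_arcs E v \<Longrightarrow> (?x - y) * (Ed e * Gh e) \<approx> 0" for y
  proof (intro exI[of _ y] exI[of _ "{}"] conjI allI impI)
    fix D' assume D': "finite D'" "D' \<subseteq> out_arcs E v"
    have "?x * V v - y \<approx> 0" using cong_diff[OF 1 cong_refl[of y]] by simp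
    also have "0 \<approx> (\<Sum>e\<in>D'. (?x - y) * (Ed e * Gh e))"
    proof (rule cong_sym)
      have "(\<Sum>e\<in>D'. (?x - y) * (Ed e * Gh e)) \<approx> (\<Sum>e\<in>D'. 0)"
        by (rule cong_sum, rule 2) (use D' in blast)
      then show "(\<Sum>e\<in>D'. (?x - y) * (Ed e * Gh e)) \<approx> 0" by simp
    qed
    finally show "?x * V v - y \<approx> (\<Sum>e\<in>D'. (?x - y) * (Ed e * Gh e))" .
  qed (use yk in auto)
  from word_normal_form[OF monomial] consider "word w \<approx> 0"
    | u p v0 q x where "awalk u p x" "awalk v0 q x" "word w \<approx> path u p * ghost v0 q"
    unfolding normal_form_def by blast
  then show ?case
  proof cases
    case 1
    then have "?x \<approx> 0" by (simp add: zero_lmult)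
    then show ?thesis using v by (intro triv[of 0]) (auto intro: zero_rmult)
  next
    case (2 u p v0 q x)
    have pM: "path u p \<in> Mul" and gM: "ghost v0 q \<in> Mul" using 2 by auto
    have xe: "?x \<approx> scal c * path u p * ghost v0 q"
      using cong_scal[OF 2(3), of c] by (simp add: mult.assoc)
    have xm: "?x * a \<approx> scal c * path u p * (ghost v0 q * a)" if "a \<in> Mul" for a
      using cong_rmult[OF xe that] by (simp add: mult.assoc)
    have xz: "?x * a \<approx> 0" if "a \<in> Mul" "ghost v0 q * a \<approx> 0" for a
      by (rule cong_trans[OF xm[OF that(1)] zero_lmult[OF that(2)]]) (use pM in auto)
    consider "v0 \<noteq> v" | "v0 = v" "q = []" | f q' where "v0 = v" "q = f # q'" by (cases q) auto
    then show ?thesis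
    proof cases
      case 1
      have 3: "ghost v0 q * V v \<approx> 0" using ghost_V[OF 2(2) v] 1 by simp
      have "ghost v0 q * (Ed e * Gh e) \<approx> 0" if e: "e \<in> out_arcs E v" for e
      proof -
        have "ghost v0 q * (Ed e * Gh e) = ghost v0 q * Ed e * Gh e" by (simp add: mult.assoc)
        also have "\<dots> \<approx> ghost v0 q * (V (tail E e) * Ed e) * Gh e"
          using e gM by (intro cong_rmult[OF cong_lmult[OF cong_sym[OF V_Ed]]]) auto
        also have "\<dots> = (ghost v0 q * V v) * (Ed e * Gh e)" using e by (auto simp: mult.assoc)
        also have "\<dots> \<approx> 0" by (rule zero_rmult[OF 3 EG[OF e]])
        finally show ?thesis .
      qed
      then show ?thesis using 3 v by (intro triv[of 0]) (auto intro: xz)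
    next
      case 3: 2
      have xv: "x = v" using 2(2) 3 by (auto simp: awalk_Nil_iff)
      have "ghost v0 q * V v \<approx> V v" using V_V[OF v v] 3 by (simp add: ghost_Nil)
      from cong_lmult[OF this, of "scal c * path u p"]
      have "?x * V v \<approx> scal c * path u p * V v" using xm[of "V v"] v pM by (auto intro: cong_trans)
      also have "scal c * path u p * V v \<approx> scal c * path u p"
        using cong_scal[OF path_V[OF 2(1) v], of c] xv by (simp add: mult.assoc)
      finally have 4: "?x * V v \<approx> scal c * path u p" .
      have "?x \<approx> scal c * path u p * V v" using xe 3 by (simp add: ghost_Nil)
      also have "\<dots> \<approx> scal c * path u p"
        using cong_scal[OF path_V[OF 2(1) v], of c] xv by (simp add: mult.assoc)
      finally have 5: "?x - scal c * path u p \<approx> 0"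
        using cong_diff[OF _ cong_refl[of "scal c * path u p"], of ?x "scal c * path u p"] by simp
      show ?thesis
      proof (rule triv[OF _ 4])
        show "supp (scal c * path u p) \<subseteq> path_words v"
          using 2(1) xv by (auto simp: path_def scal_mult_word path_words_def)
      qed (use zero_rmult[OF 5 EG] in auto)
    next
      case 3: (3 f q')
      have f: "f \<in> arcs E" "tail E f = v" and q': "awalk (head E f) q' x"
        using awalk_ConsD[of v f q' x] 2(2) 3 by auto
      have gf: "ghost v0 q \<approx> ghost (head E f) q' * Gh f"
        using ghost_Cons[of v f q' x] 2(2) 3 by simp
      have gM': "ghost (head E f) q' \<in> Mul" using q' by auto
      have 4: "?x * (Ed e * Gh e) \<approx> (if e = f then ?x else 0)" if e: "e \<in> out_arcs E v" for e
      proof -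
        have "ghost v0 q * (Ed e * Gh e) \<approx> (ghost (head E f) q' * Gh f) * (Ed e * Gh e)"
          by (rule cong_rmult[OF gf EG[OF e]])
        also have "\<dots> = ghost (head E f) q' * (Gh f * Ed e) * Gh e" by (simp add: mult.assoc)
        also have "\<dots> \<approx> ghost (head E f) q' * (if f = e then V (head E f) else 0) * Gh e"
          using Gh_Ed[OF f(1), of e] e gM' by (intro cong_rmult[OF cong_lmult]) auto
        also have "\<dots> \<approx> (if e = f then ghost v0 q else 0)"
          using cong_sym[OF gf] cong_lmult[OF V_Gh[OF f(1)] gM']
          by (auto simp: mult.assoc intro: cong_trans)
        finally have "scal c * path u p * (ghost v0 q * (Ed e * Gh e)) \<approx>
            scal c * path u p * (if e = f then ghost v0 q else 0)"
          using pM by (intro cong_lmult) auto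
        also have "\<dots> \<approx> (if e = f then ?x else 0)" using cong_sym[OF xe] by (simp add: mult.assoc)
        finally show ?thesis using cong_trans[OF xm[OF EG[OF e]]] by blast
      qed
      have 5: "?x * V v \<approx> ?x"
      proof -
        have "ghost v0 q * V v \<approx> ghost v0 q" using ghost_V[OF 2(2) v] 3 by simp
        from cong_lmult[OF this, of "scal c * path u p"]
        have "?x * V v \<approx> scal c * path u p * ghost v0 q"
          using xm[of "V v"] v pM by (auto intro: cong_trans)
        then show ?thesis using cong_sym[OF xe] cong_trans by blast
      qed
      show ?thesis
      proof (intro exI[of _ 0] exI[of _ "{f}"] conjI allI impI)
        fix D' assume D': "finite D'" "{f} \<subseteq> D'" "D' \<subseteq> out_arcs E v"
        have "(\<Sum>e\<in>D'. ?x * (Ed e * Gh e)) \<approx> (\<Sum>e\<in>D'. if e = f then ?x else 0)"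
          using D' by (intro cong_sum 4) auto
        also have "\<dots> = ?x" using D' by simp
        finally show "?x * V v - 0 \<approx> (\<Sum>e\<in>D'. (?x - 0) * (Ed e * Gh e))"
          using cong_trans[OF 5 cong_sym] by simp
      qed (use f in auto)
    qed
  qed
qed

end

context leavitt_ideal
begin

text \<open>
  The adjoint of \<open>p\<^sub>0\<close> turns \<open>p\<^sub>0\<close> into its range \<open>v\<close>, the longer paths that begin with \<open>p\<^sub>0\<close> and end in
  \<open>v\<close> into closed paths at \<open>v\<close>, and all others that are not shorter into \<open>0\<close>.
\<close>

lemma cancel_path_word:
  assumes p0: "awalk u0 p0 v" and w: "w \<in> path_words v" "length p0 < length w"
  shows "\<exists>z. supp z \<subseteq> cycle_words v \<and>
    ghost u0 p0 * word w \<approx> (if w = Vertex u0 # map Edge p0 then V v else 0) + z"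
proof -
  obtain u p where wp: "w = Vertex u # map Edge p" and p: "awalk u p v"
    using w(1) unfolding path_words_def by auto
  have inj: "w = Vertex u0 # map Edge p0 \<longleftrightarrow> u = u0 \<and> p = p0"
    unfolding wp by (auto simp: inj_map_eq_map inj_def)
  have ww: "word w = path u p" by (simp add: path_def wp)
  have le: "length p0 \<le> length p" using w wp by simp
  consider "u \<noteq> u0" | "u = u0" "p = p0" | r where "u = u0" "p = p0 @ r" "r \<noteq> []" | "u = u0" "\<And>r. p \<noteq> p0 @ r"
    by (metis append_Nil2)
  then show ?thesis
  proof cases
    case 1
    then show ?thesis
      using ghost_path_zero[OF p0 p] inj ww by (intro exI[of _ 0]) auto
  next
    case 2
    then show ?thesis
      using ghost_path_same[OF p0] inj ww by (intro exI[of _ 0]) auto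
  next
    case (3 r)
    have r: "awalk v r v" using p p0 3 by (auto dest: awalk_ends)
    have "supp (path v r) \<subseteq> cycle_words v"
      using r 3 unfolding path_def word_def cycle_words_def closed_path_def by auto
    then show ?thesis
      using ghost_path_prefix[OF p0 r] inj ww 3 by (intro exI[of _ "path v r"]) auto
  next
    case 4
    have "p0 \<noteq> p @ r" for r using 4(2)[of "[]"] le by auto
    then have "ghost u0 p0 * path u p \<approx> 0" using ghost_path_diverge[OF p0, of p v] p 4 by blast
    then show ?thesis using 4(2)[of "[]"] inj ww by (intro exI[of _ 0]) auto
  qed
qed

lemma cancel_shortest_path:
  assumes p0: "awalk u0 p0 v"
    and y: "supp y \<subseteq> {w \<in> path_words v. length p0 < length w}"
  shows "\<exists>z. supp z \<subseteq> cycle_words v \<and>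
    ghost u0 p0 * y \<approx> scal (coef y (Vertex u0 # map Edge p0)) * V v + z"
  using y
proof (induction rule: keys_subset_induct)
  case zero
  then show ?case by (intro exI[of _ 0]) auto
next
  case (add a b)
  let ?w0 = "Vertex u0 # map Edge p0"
  obtain z where z: "supp z \<subseteq> cycle_words v"
     "ghost u0 p0 * a \<approx> scal (coef a ?w0) * V v + z" using add by blast
  obtain z' where z': "supp z' \<subseteq> cycle_words v"
     "ghost u0 p0 * b \<approx> scal (coef b ?w0) * V v + z'" using add by blast
  have "supp (z + z') \<subseteq> cycle_words v"
    using Poly_Mapping.keys_add[of z z'] z z' by blast
  moreover have "ghost u0 p0 * (a + b) \<approx> scal (coef (a + b) ?w0) * V v + (z + z')"
    using cong_add[OF z(2) z'(2)] by (simp add: lookup_add single_add algebra_simps)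
  ultimately show ?case by blast
next
  case (monomial c w)
  let ?w0 = "Vertex u0 # map Edge p0"
  obtain z where z: "supp z \<subseteq> cycle_words v"
    "ghost u0 p0 * word w \<approx> (if w = ?w0 then V v else 0) + z"
    using cancel_path_word[OF p0, of w] monomial by blast
  have l: "coef (scal c * word w) ?w0 = (if w = ?w0 then c else 0)"
    by (auto simp: scal_mult_word lookup_single when_def)
  have "supp (scal c * z) \<subseteq> cycle_words v"
    using z(1) by (auto simp: in_keys_iff lookup_scal_mult)
  moreover have "ghost u0 p0 * (scal c * word w) \<approx> scal c * ((if w = ?w0 then V v else 0) + z)"
    using cong_scal[OF z(2), of c] by (simp add: scal_left_commute)
  moreover have "scal c * ((if w = ?w0 then V v else 0) + z) = scal (if w = ?w0 then c else 0) * V v + scal c * z"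
    by (auto simp: distrib_left)
  ultimately show ?case unfolding l by (intro exI[of _ "scal c * z"]) (simp only: simp_thms)
qed

lemma cancel_to_vertex:
  assumes "supp y \<subseteq> path_words v" "y \<noteq> 0"
  shows "\<exists>a\<in>Mul. \<exists>z. supp z \<subseteq> cycle_words v \<and> a * y \<approx> V v + z"
proof -
  obtain w0 where w0: "w0 \<in> supp y" "\<And>w. w \<in> supp y \<Longrightarrow> length w0 \<le> length w"
    using ex_has_least_nat[of "\<lambda>w. w \<in> supp y" _ length] assms(2)
    by (metis keys_eq_empty ex_in_conv)
  obtain u0 p0 where p0: "w0 = Vertex u0 # map Edge p0" "awalk u0 p0 v"
    using w0(1) assms(1) unfolding path_words_def by blast
  define k where "k = coef y w0"
  have k: "k \<noteq> 0" using w0(1) by (simp add: k_def in_keys_iff)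
  have "length p0 < length w" if "w \<in> supp y" for w
    using w0(2)[OF that] p0(1) by simp
  then have "supp y \<subseteq> {w \<in> path_words v. length p0 < length w}"
    using assms(1) by blast
  from cancel_shortest_path[OF p0(2) this] obtain z where z: "supp z \<subseteq> cycle_words v"
    "ghost u0 p0 * y \<approx> scal k * V v + z" unfolding k_def p0(1) by blast
  have "scal (inverse k) * ghost u0 p0 * y \<approx> scal (inverse k) * (scal k * V v + z)"
    using cong_scal[OF z(2)] by (simp add: mult.assoc)
  also have "scal (inverse k) * (scal k * V v + z) = V v + scal (inverse k) * z"
    using k by (simp add: distrib_left mult.assoc[symmetric] scal_mult scal_one)
  finally have "scal (inverse k) * ghost u0 p0 * y \<approx> V v + scal (inverse k) * z" .
  moreover have "supp (scal (inverse k) * z) \<subseteq> cycle_words v"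
    using z(1) by (auto simp: in_keys_iff lookup_scal_mult)
  moreover have "scal (inverse k) * ghost u0 p0 \<in> Mul" using p0 by auto
  ultimately show ?thesis by blast
qed

lemma degree_part_cycle_words:
  assumes "supp z \<subseteq> cycle_words v" "i \<le> 0"
  shows "degree_part 0 i z = 0"
proof (rule poly_mapping_eqI)
  fix w
  have "w \<in> supp z \<Longrightarrow> word_degree w > 0"
    using assms(1) unfolding cycle_words_def closed_path_def by auto
  then show "coef (degree_part 0 i z) w = coef 0 w"
    using assms(2) by (cases "w \<in> supp z") (auto simp: lookup_degree_part in_keys_iff)
qed

lemma head_in_J:
  assumes "e \<in> arcs E" "V (head E e) \<in> J"
  shows "Ed e \<in> J" "Gh e \<in> J"
  using cong_mem[OF Ed_V[OF assms(1)]] cong_mem[OF V_Gh[OF assms(1)]] J_lmult[OF assms(2)] J_rmult[OF assms(2)] assms(1)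
  by auto

lemma Ed_in_J: "e \<in> arcs E \<Longrightarrow> Ed e \<in> J \<longleftrightarrow> V (head E e) \<in> J"
  using cong_mem[OF Gh_Ed[of e e]] J_lmult[of "Ed e" "Gh e"] head_in_J[of e] by auto

text \<open>
  The two kinds of idempotents to which elements outside \<open>J\<close> are reduced.
\<close>

definition corner_idempotent :: "'v \<Rightarrow> (('v, 'e) lpa_gen list \<Rightarrow>\<^sub>0 'k) \<Rightarrow> bool" where
  "corner_idempotent v h \<longleftrightarrow> v \<in> verts E \<and> h \<notin> J \<and>
     (h = V v \<or> v \<in> breaking_vertices E (vertices_in J) \<and> h = breaking_element (vertices_in J) v)"

lemma corner_idempotent_Mul: "corner_idempotent v h \<Longrightarrow> h \<in> Mul"
  unfolding corner_idempotent_def using breaking_element_Mul by auto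

text \<open>
  Splitting \<open>x\<close> at \<open>v\<close> gives \<open>x v = y (v - \<Sum> e e\<^sup>*)\<close> modulo \<open>J\<close>, where \<open>y\<close> is a combination of real
  paths and the sum is over any sufficiently large finite set of edges.  Let \<open>D\<^sub>0\<close> be the set of edges
  from \<open>v\<close> to vertices outside \<open>J\<close>.  If \<open>D\<^sub>0\<close> were infinite, some \<open>f \<in> D\<^sub>0\<close> would be missing in the sum,
  hence \<open>y f \<in> J\<close>; but a multiple of \<open>y f\<close> has the component \<open>f \<notin> J\<close> in degree \<open>1\<close>.  So \<open>D\<^sub>0\<close> is
  finite and the sum may be taken over \<open>D\<^sub>0\<close>, since the other edges lie in \<open>J\<close>.  The vertex \<open>v\<close> is not
  regular, as otherwise \<open>x v = \<Sum> x e e\<^sup>* \<in> J\<close>.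
\<close>

lemma reduce_at_vertex_killing_edges:
  assumes G: "graded J" and x: "x \<in> Alg" and v: "v \<in> verts E" and xv: "x * V v \<notin> J"
    and xe: "\<And>e. e \<in> out_arcs E v \<Longrightarrow> x * Ed e \<in> J"
  shows "\<exists>h y. corner_idempotent v h \<and> supp y \<subseteq> path_words v \<and> y \<noteq> 0 \<and> x * V v \<approx> y * h"
proof -
  let ?H = "vertices_in J"
  have xM: "x \<in> Mul" using Alg_Mul[OF x] .
  have Vv: "V v \<notin> J" using J_lmult[OF _ xM] xv by blast
  obtain y D where y: "supp y \<subseteq> path_words v" and D: "finite D" "D \<subseteq> out_arcs E v"
    and split: "\<And>D'. finite D' \<Longrightarrow> D \<subseteq> D' \<Longrightarrow> D' \<subseteq> out_arcs E v \<Longrightarrow>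
      x * V v - y \<approx> (\<Sum>e\<in>D'. (x - y) * (Ed e * Gh e))"
    using split_at_vertex[OF x v] by (elim exE conjE) (rule that, assumption+, blast)
  have yM: "y \<in> Mul" using Mul_path_words[OF y] .
  have xeg: "x * (Ed e * Gh e) \<in> J" if "e \<in> out_arcs E v" for e
    using J_rmult[OF xe[OF that], of "Gh e"] that by (auto simp: mult.assoc)
  have key: "x * V v \<approx> y * (V v - (\<Sum>e\<in>D'. Ed e * Gh e))"
    if D': "finite D'" "D \<subseteq> D'" "D' \<subseteq> out_arcs E v" for D'
  proof -
    have "(\<Sum>e\<in>D'. (x - y) * (Ed e * Gh e)) \<approx> (\<Sum>e\<in>D'. 0 - y * (Ed e * Gh e))"
    proof (rule cong_sum)
      fix e assume "e \<in> D'"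
      then have "x * (Ed e * Gh e) \<approx> 0" using xeg D' by (auto simp: cong_zero_iff)
      from cong_diff[OF this cong_refl] show "(x - y) * (Ed e * Gh e) \<approx> 0 - y * (Ed e * Gh e)"
        by (simp add: left_diff_distrib)
    qed
    from cong_trans[OF split[OF D'] this]
    have "x * V v - y \<approx> - (\<Sum>e\<in>D'. y * (Ed e * Gh e))" by (simp add: sum_negf)
    from cong_add[OF this cong_sym[OF path_words_V[OF y]]]
    show ?thesis by (simp add: right_diff_distrib sum_distrib_left)
  qed
  have y0: "y \<noteq> 0" using key[OF D(1) _ D(2)] xv by (auto simp: cong_zero_iff)
  define D0 where "D0 = {e \<in> out_arcs E v. head E e \<notin> ?H}"
  have "finite D0"
  proof (rule ccontr)
    assume "infinite D0"
    then obtain f where f: "f \<in> D0" "f \<notin> D" using D(1) by (meson finite_subset subsetI)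
    then have fo: "f \<in> out_arcs E v" and fa: "f \<in> arcs E" "tail E f = v" and fh: "V (head E f) \<notin> J"
      by (auto simp: D0_def vertices_in_def)
    have "y * (V v - (\<Sum>e\<in>D. Ed e * Gh e)) * Ed f = y * (V v * Ed f - (\<Sum>e\<in>D. Ed e * Gh e * Ed f))"
      by (simp add: left_diff_distrib sum_distrib_right mult.assoc)
    also have "\<dots> \<approx> y * (Ed f - (\<Sum>e\<in>D. 0))"
    proof (intro cong_lmult cong_diff cong_sum yM)
      show "V v * Ed f \<approx> Ed f" using V_Ed[OF fa(1)] fa by simp
      fix e assume e: "e \<in> D"
      have ea: "e \<in> arcs E" "e \<noteq> f" using e D(2) f by auto
      have "Ed e * Gh e * Ed f = Ed e * (Gh e * Ed f)" by (simp add: mult.assoc)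
      also have "\<dots> \<approx> 0"
        by (rule zero_lmult) (use Gh_Ed[OF ea(1) fa(1)] ea in auto)
      finally show "Ed e * Gh e * Ed f \<approx> 0" .
    qed
    finally have 1: "y * (V v - (\<Sum>e\<in>D. Ed e * Gh e)) * Ed f \<approx> y * Ed f" by simp
    have 2: "x * V v * Ed f \<approx> x * Ed f"
      using cong_lmult[OF V_Ed[OF fa(1)] xM] fa by (simp add: mult.assoc)
    have 3: "x * V v * Ed f \<approx> y * (V v - (\<Sum>e\<in>D. Ed e * Gh e)) * Ed f"
      using key[OF D(1) _ D(2)] fa by (intro cong_rmult) auto
    have "y * Ed f \<in> J"
      using cong_mem[OF 1] cong_mem[OF 2] cong_mem[OF 3] xe[OF fo] by simp
    moreover obtain a z where a: "a \<in> Mul" and z: "supp z \<subseteq> cycle_words v" "a * y \<approx> V v + z"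
      using cancel_to_vertex[OF y y0] by blast
    ultimately have "a * y * Ed f \<in> J" using J_lmult by (simp add: mult.assoc)
    moreover have "a * y * Ed f \<approx> (V v + z) * Ed f" using z(2) fa by (intro cong_rmult) auto
    ultimately have "(V v + z) * Ed f \<in> J" using cong_mem by blast
    then have "degree_part 0 1 ((V v + z) * Ed f) \<in> J" using G unfolding graded_def by blast
    \<comment> \<open>\<open>z\<close> has no component in degrees up to \<open>0\<close>.\<close>
    moreover have "degree_part 0 1 (z * Ed f) = 0"
      using degree_part_mult_word[of 0 1 z "[Edge f]"] degree_part_cycle_words[OF z(1), of 0] by simp
    moreover have "degree_part 0 1 (V v * Ed f) = V v * Ed f"
      using degree_part_mult_word[of 0 1 "V v" "[Edge f]"] by (simp add: degree_part_word)
    ultimately have "V v * Ed f \<in> J" by (simp add: distrib_right degree_part_add)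
    then have "Ed f \<in> J" using cong_mem[OF V_Ed[OF fa(1)]] fa by simp
    then show False using Ed_in_J[OF fa(1)] fh by simp
  qed
  have fin0: "finite (D \<union> D0)" "D \<union> D0 \<subseteq> out_arcs E v" using \<open>finite D0\<close> D by (auto simp: D0_def)
  have eg0: "Ed e * Gh e \<in> J" if "e \<in> D \<union> D0 - D0" for e
  proof -
    have e: "e \<in> arcs E" "V (head E e) \<in> J"
      using that fin0 by (auto simp: D0_def vertices_in_def)
    show ?thesis using J_rmult[OF head_in_J(1)[OF e]] e by auto
  qed
  have "(\<Sum>e\<in>D \<union> D0. Ed e * Gh e) \<approx> (\<Sum>e\<in>D0. Ed e * Gh e)"
  proof -
    have "(\<Sum>e\<in>D \<union> D0. Ed e * Gh e) = (\<Sum>e\<in>D0. Ed e * Gh e) + (\<Sum>e\<in>D \<union> D0 - D0. Ed e * Gh e)"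
      using sum.subset_diff[OF Un_upper2[of D0 D] fin0(1), of "\<lambda>e. Ed e * Gh e"] by (simp only: add.commute)
    moreover have "(\<Sum>e\<in>D \<union> D0 - D0. Ed e * Gh e) \<in> J" by (rule J_sum) (rule eg0)
    ultimately show ?thesis by (simp add: cong_def)
  qed
  then have "y * (V v - (\<Sum>e\<in>D \<union> D0. Ed e * Gh e)) \<approx> y * breaking_element ?H v"
    unfolding breaking_element_def D0_def by (intro cong_lmult cong_diff yM) auto
  from cong_trans[OF key[OF fin0(1) _ fin0(2)] this]
  have brk: "x * V v \<approx> y * breaking_element ?H v" by simp
  show ?thesis
  proof (cases "D0 = {}")
    case True
    have "breaking_element ?H v = V v"
      unfolding breaking_element_def D0_def[symmetric] True by simp
    then show ?thesis using brk y y0 v Vv unfolding corner_idempotent_def by auto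
  next
    case False
    have "infinite (out_arcs E v)"
    proof
      assume fin: "finite (out_arcs E v)"
      then have "regular_vertex E v" using False v by (auto simp: regular_vertex_def D0_def)
      from cong_lmult[OF cuntz_krieger[OF this] xM]
      have "x * V v \<approx> (\<Sum>e\<in>out_arcs E v. x * (Ed e * Gh e))" by (simp add: sum_distrib_left)
      moreover have "(\<Sum>e\<in>out_arcs E v. x * (Ed e * Gh e)) \<in> J" by (rule J_sum) (rule xeg)
      ultimately show False using cong_mem xv by blast
    qed
    moreover have S: "{e \<in> out_arcs E v. head E e \<in> verts E - ?H} = D0"
      unfolding D0_def by auto
    ultimately have "v \<in> breaking_vertices E ?H"
      unfolding breaking_vertices_def infinite_emitter_def mem_Collect_eq S
      using v Vv False \<open>finite D0\<close> by (simp add: vertices_in_def)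
    moreover have "breaking_element ?H v \<notin> J" using cong_mem[OF brk] J_lmult[OF _ yM] xv by blast
    ultimately show ?thesis using brk y y0 v unfolding corner_idempotent_def by blast
  qed
qed

text \<open>
  By induction on the length of paths needed to make \<open>x\<close> real: passing from \<open>x\<close> to \<open>x e\<close> for an edge
  \<open>e\<close> lowers it by one, and when no edge keeps \<open>x\<close> outside \<open>J\<close> the preceding lemma applies.
\<close>

lemma reduce_to_paths:
  assumes G: "graded J" and x: "x \<in> Alg" "x \<notin> J"
  shows "\<exists>b\<in>Mul. \<exists>v h y. corner_idempotent v h \<and> supp y \<subseteq> path_words v \<and> y \<noteq> 0 \<and> x * b \<approx> y * h"
proof -
  obtain n where "\<And>u q v. awalk u q v \<Longrightarrow> n \<le> length q \<Longrightarrow>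
    \<exists>y. supp y \<subseteq> path_words v \<and> x * path u q \<approx> y"
    using eventually_real[OF x(1)] by blast
  then show ?thesis using x
  proof (induction n arbitrary: x)
    case 0
    obtain v where v: "v \<in> verts E" "x * V v \<notin> J" using exists_V_notin 0 by blast
    have "awalk v [] v" using v by (simp add: awalk_Nil_iff)
    from 0(1)[OF this] obtain y where y: "supp y \<subseteq> path_words v" "x * V v \<approx> y"
      by (auto simp: path_Nil)
    have "V v \<notin> J" using J_lmult[of "V v" x] Alg_Mul[OF 0(2)] v by blast
    moreover have "y \<noteq> 0" using y(2) v by (auto simp: cong_zero_iff)
    moreover have "x * V v \<approx> y * V v" by (rule cong_trans[OF y(2) cong_sym[OF path_words_V[OF y(1)]]])
    ultimately show ?case using y v unfolding corner_idempotent_def by (intro bexI[of _ "V v"]) auto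
  next
    case (Suc n)
    obtain v where v: "v \<in> verts E" "x * V v \<notin> J" using exists_V_notin Suc by blast
    show ?case
    proof (cases "\<exists>e\<in>out_arcs E v. x * Ed e \<notin> J")
      case True
      then obtain e where e: "e \<in> arcs E" "tail E e = v" "x * Ed e \<notin> J" by auto
      have xM: "x \<in> Mul" using Alg_Mul Suc by blast
      have "\<exists>b\<in>Mul. \<exists>v h y. corner_idempotent v h \<and> supp y \<subseteq> path_words v \<and> y \<noteq> 0 \<and> x * Ed e * b \<approx> y * h"
      proof (rule Suc.IH)
        fix u q v' assume q: "awalk u q v'" "n \<le> length q"
        show "\<exists>y. supp y \<subseteq> path_words v' \<and> x * Ed e * path u q \<approx> y"
        proof (cases "u = head E e")
          case True
          then have w: "awalk v (e # q) v'" using q e by (auto simp: awalk_Cons_iff)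
          obtain y where y: "supp y \<subseteq> path_words v'" "x * path v (e # q) \<approx> y"
            using Suc.prems(1)[OF w] q by auto
          have "x * (Ed e * path u q) \<approx> x * path v (e # q)"
            using cong_sym[OF path_Cons[OF w]] True by (intro cong_lmult xM) auto
          then show ?thesis using y cong_trans by (auto simp: mult.assoc)
        next
          case False
          have "x * Ed e * path u q \<approx> x * (Ed e * V (head E e)) * path u q"
            using q xM by (intro cong_rmult[OF cong_lmult[OF cong_sym[OF Ed_V[OF e(1)]]]]) auto
          also have "\<dots> = (x * Ed e) * (V (head E e) * path u q)" by (simp add: mult.assoc)
          also have "\<dots> \<approx> 0"
            by (rule zero_lmult) (use V_path[OF q(1), of "head E e"] False e xM in auto)
          finally show ?thesis by (intro exI[of _ 0]) auto
        qed
      qed (use e Suc.prems in auto)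
      then obtain b v h y where "b \<in> Mul" "corner_idempotent v h" "supp y \<subseteq> path_words v" "y \<noteq> 0"
        "x * Ed e * b \<approx> y * h" by blast
      then show ?thesis using e by (intro bexI[of _ "Ed e * b"]) (auto simp: mult.assoc)
    next
      case False
      then show ?thesis
        using reduce_at_vertex_killing_edges[OF G Suc.prems(2) v] v by (intro bexI[of _ "V v"]) auto
    qed
  qed
qed

text \<open>
  After the reduction to real paths, the adjoint of a shortest path produces a vertex plus closed
  paths.  In the case of a breaking element \<open>h\<close> the closed paths disappear, because \<open>h e \<in> J\<close> for the
  first edge \<open>e\<close> of a closed path.
\<close>

theorem reduction:
  assumes G: "graded J" and x: "x \<in> Alg" "x \<notin> J"
  shows "\<exists>a\<in>Mul. \<exists>b\<in>Mul. \<exists>v h z. corner_idempotent v h \<and> a * x * b \<approx> h + z \<and>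
    supp z \<subseteq> cycle_words v \<and> (h = V v \<or> z = 0)"
proof -
  let ?H = "vertices_in J"
  obtain b v h y where b: "b \<in> Mul" and h: "corner_idempotent v h" and y: "supp y \<subseteq> path_words v" "y \<noteq> 0"
    and xb: "x * b \<approx> y * h" using reduce_to_paths[OF assms] by blast
  obtain a z where a: "a \<in> Mul" and z: "supp z \<subseteq> cycle_words v" and ay: "a * y \<approx> V v + z"
    using cancel_to_vertex[OF y] by blast
  have hM: "h \<in> Mul" using corner_idempotent_Mul[OF h] .
  have v: "v \<in> verts E" using h by (simp add: corner_idempotent_def)
  have axb: "a * x * b \<approx> (V v + z) * h"
  proof -
    have "a * x * b = a * (x * b)" by (simp add: mult.assoc)
    also have "\<dots> \<approx> a * (y * h)" by (rule cong_lmult[OF xb a])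
    also have "\<dots> = (a * y) * h" by (simp add: mult.assoc)
    also have "\<dots> \<approx> (V v + z) * h" by (rule cong_rmult[OF ay hM])
    finally show ?thesis .
  qed
  show ?thesis
  proof (cases "h = V v")
    case True
    have "(V v + z) * V v \<approx> V v + z"
      using cong_add[OF V_V[OF v v] path_words_V[of z v]] z cycle_words_subset by (auto simp: distrib_right)
    then show ?thesis using a b h z axb True cong_trans by blast
  next
    case False
    then have vb: "v \<in> breaking_vertices E ?H" and hb: "h = breaking_element ?H v"
      using h unfolding corner_idempotent_def by auto
    have "{e. e \<in> out_arcs E v \<and> head E e \<notin> ?H} = {e \<in> out_arcs E v. head E e \<in> verts E - ?H}" by auto
    then have fin: "finite {e. e \<in> out_arcs E v \<and> head E e \<notin> ?H}"
      using vb by (simp add: breaking_vertices_def)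
    have "h * z \<approx> 0" using z
    proof (induction rule: keys_subset_induct)
      case (monomial c w)
      then obtain p where p: "w = Vertex v # map Edge p" "closed_path E v p"
        unfolding cycle_words_def by auto
      then obtain e q where q: "p = e # q" and aw: "awalk v (e # q) v" unfolding closed_path_def by (cases p) auto
      have e: "e \<in> arcs E" "e \<in> out_arcs E v" and q': "awalk (head E e) q v"
        using awalk_ConsD[OF aw] by auto
      have "h * Ed e \<approx> 0"
      proof (cases "head E e \<in> ?H")
        case True
        then have "Ed e \<in> J" using head_in_J(1)[OF e(1)] by (simp add: vertices_in_def)
        then show ?thesis using J_lmult[OF _ hM] by (simp add: cong_zero_iff)
      next
        case False
        then show ?thesis using breaking_element_Ed[OF fin e(2)] hb by simp
      qed
      have "h * path v p \<approx> h * (Ed e * path (head E e) q)"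
        unfolding q by (rule cong_lmult[OF path_Cons[OF aw] hM])
      also have "\<dots> = h * Ed e * path (head E e) q" by (simp add: mult.assoc)
      also have "\<dots> \<approx> 0" by (rule zero_rmult[OF \<open>h * Ed e \<approx> 0\<close>]) (use q' in auto)
      finally show ?case using cong_scal[of _ 0 c] p by (simp add: scal_left_commute path_def)
    qed (use cong_add[of _ 0 _ 0] in \<open>auto simp: distrib_left\<close>)
    have zM: "z \<in> Mul" using Mul_cycle_words[OF z] .
    have "(h * a) * x * b = h * (a * x * b)" by (simp add: mult.assoc)
    also have "\<dots> \<approx> h * ((V v + z) * h)" by (rule cong_lmult[OF axb hM])
    also have "\<dots> = (h * V v) * h + (h * z) * h" by (simp add: distrib_left distrib_right mult.assoc)
    also have "\<dots> \<approx> h * h + 0"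
      using breaking_element_V[OF v, of ?H] hb hM
      by (intro cong_add cong_rmult zero_rmult[OF \<open>h * z \<approx> 0\<close>]) auto
    also have "\<dots> \<approx> h + 0" using breaking_element_idem[OF fin v] hb by simp
    finally show ?thesis using a b h hM by (intro bexI[of _ "h * a"] bexI[of _ b] exI[of _ v] exI[of _ h] exI[of _ 0]) auto
  qed
qed

end

section \<open>Ideals are determined by their idempotents\<close>

lemma length_concat_replicate_ge: "xs \<noteq> [] \<Longrightarrow> n \<le> length (concat (replicate n xs))"
proof (induction n)
  case (Suc n)
  then show ?case by (cases xs) auto
qed simp

text \<open>
  If \<open>d = q\<^sup>m\<close> is a prefix of \<open>b d\<close>, it is a prefix of \<open>b\<^sup>k d\<close> for all \<open>k\<close>, hence of a power of \<open>b\<close>.  For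
  \<open>m = \<bar>b\<bar>\<close> the word \<open>d\<close> is at least as long as \<open>b\<close>, so \<open>b\<close> is in turn a prefix of \<open>d\<close>.
\<close>

lemma prefix_of_shift_set_eq:
  fixes b q :: "'a list"
  assumes ne: "b \<noteq> []" "q \<noteq> []" and eq: "b @ concat (replicate (length b) q) = concat (replicate (length b) q) @ r"
  shows "set q = set b"
proof -
  define d where "d = concat (replicate (length b) q)"
  have len: "n \<le> length (concat (replicate n q))" and lb: "n \<le> length (concat (replicate n b))" for n
    using length_concat_replicate_ge ne by blast+
  have it: "\<exists>s. concat (replicate k b) @ d = d @ s" for k
  proof (induction k)
    case (Suc k)
    then obtain s where s: "concat (replicate k b) @ d = d @ s" by blast
    have "replicate (Suc k) b = replicate k b @ [b]" by (simp add: replicate_append_same)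
    then have "concat (replicate (Suc k) b) = concat (replicate k b) @ b" by (simp only: concat_append) simp
    then have "concat (replicate (Suc k) b) @ d = concat (replicate k b) @ (b @ d)" by simp
    also have "b @ d = d @ r" using eq by (simp only: d_def)
    also have "concat (replicate k b) @ (d @ r) = d @ (s @ r)" using s by (metis append_assoc)
    finally show ?case by blast
  qed simp
  obtain s where s: "concat (replicate (length d) b) @ d = d @ s" using it by blast
  have "d = take (length d) (concat (replicate (length d) b) @ d)" by (simp add: s)
  also have "\<dots> = take (length d) (concat (replicate (length d) b))" using lb by simp
  finally have "set d \<subseteq> set (concat (replicate (length d) b))" by (metis set_take_subset)
  then have 1: "set d \<subseteq> set b" by auto
  have "b = take (length b) (d @ r)" by (simp only: d_def eq[symmetric]) simp
  also have "\<dots> = take (length b) d" using len[of "length b"] by (simp add: d_def)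
  finally have 2: "set b \<subseteq> set d" by (metis set_take_subset)
  have "set d = set q" using ne(1) by (auto simp: d_def)
  then show ?thesis using 1 2 by simp
qed

context leavitt_ideal
begin

lemma awalk_concat_replicate: "awalk v q v \<Longrightarrow> awalk v (concat (replicate n q)) v"
proof (induction n)
  case 0
  then show ?case by (auto simp: awalk_Nil_iff)
next
  case (Suc n)
  then show ?case using awalk_appendI[of v q v] by simp
qed

text \<open>
  Conjugation with a closed path \<open>d\<close> at \<open>v\<close> sends a closed path \<open>b\<close> at \<open>v\<close> to \<open>r\<close> if \<open>b d = d r\<close>, and to
  \<open>0\<close> if \<open>d\<close> is not a prefix of \<open>b d\<close>.
\<close>

lemma conjugate_cycle_words:
  assumes d: "awalk v d v" and "finite S" "S \<subseteq> cycle_words v"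
  shows "\<exists>z. supp z \<subseteq> cycle_words v \<and>
     card (supp z) \<le> card {w \<in> S. \<exists>r. w @ map Edge d = Vertex v # map Edge (d @ r)} \<and>
     ghost v d * (\<Sum>w\<in>S. Poly_Mapping.single w (c w)) * path v d \<approx> z"
  using assms(2,3)
proof (induction S)
  case empty
  then show ?case by (intro exI[of _ 0]) auto
next
  case (insert w S)
  let ?P = "\<lambda>w. \<exists>r. w @ map Edge d = Vertex v # map Edge (d @ r)"
  obtain z where z: "supp z \<subseteq> cycle_words v" "card (supp z) \<le> card {w \<in> S. ?P w}"
     "ghost v d * (\<Sum>w\<in>S. Poly_Mapping.single w (c w)) * path v d \<approx> z" using insert by auto
  obtain b where b: "w = Vertex v # map Edge b" "closed_path E v b"
    using insert.prems unfolding cycle_words_def by auto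
  have bv: "awalk v b v" "b \<noteq> []" using b unfolding closed_path_def by auto
  have bd: "awalk v (b @ d) v" by (rule awalk_appendI[OF bv(1) d])
  have Pw: "?P w \<longleftrightarrow> (\<exists>r. b @ d = d @ r)"
    unfolding b(1) by (simp flip: map_append add: inj_map_eq_map inj_def)
  have "ghost v d * word w * path v d = ghost v d * (path v b * path v d)"
    unfolding b(1) by (simp add: path_def mult.assoc)
  also have "\<dots> \<approx> ghost v d * path v (b @ d)" using path_path[OF bv(1) d] d by (intro cong_lmult) auto
  finally have e: "ghost v d * word w * path v d \<approx> ghost v d * path v (b @ d)" .
  have s: "ghost v d * (\<Sum>w\<in>insert w S. Poly_Mapping.single w (c w)) * path v d =
      scal (c w) * (ghost v d * word w * path v d) + ghost v d * (\<Sum>w\<in>S. Poly_Mapping.single w (c w)) * path v d"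
  proof -
    have "(\<Sum>w\<in>insert w S. Poly_Mapping.single w (c w)) = scal (c w) * word w + (\<Sum>w\<in>S. Poly_Mapping.single w (c w))"
      using insert.hyps by (simp add: scal_mult_word)
    then show ?thesis by (simp only: distrib_left distrib_right scal_left_commute mult.assoc)
  qed
  show ?case
  proof (cases "?P w")
    case True
    then obtain r where r: "b @ d = d @ r" using Pw by blast
    have rv: "awalk v r v" using bd d unfolding r by (auto dest: awalk_ends)
    have "r \<noteq> []" using r bv by auto
    then have rc: "Vertex v # map Edge r \<in> cycle_words v" using rv unfolding cycle_words_def closed_path_def by auto
    let ?z = "Poly_Mapping.single (Vertex v # map Edge r) (c w) + z"
    have k: "supp ?z \<subseteq> {Vertex v # map Edge r} \<union> supp z"
      using Poly_Mapping.keys_add[of "Poly_Mapping.single (Vertex v # map Edge r) (c w)" z]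
      by (auto split: if_splits)
    have "card (supp ?z) \<le> Suc (card (supp z))"
      using card_mono[OF _ k] card_insert_le_m1[of "Suc (card (supp z))" "supp z" "Vertex v # map Edge r"]
      by simp
    also have "\<dots> \<le> Suc (card {w \<in> S. ?P w})" using z(2) by simp
    also have "\<dots> = card (insert w {w \<in> S. ?P w})" using insert.hyps by simp
    also have "insert w {w \<in> S. ?P w} = {w' \<in> insert w S. ?P w'}" using True by auto
    finally have c: "card (supp ?z) \<le> card {w' \<in> insert w S. ?P w'}" .
    have "ghost v d * word w * path v d \<approx> path v r"
      using cong_trans[OF e] ghost_path_prefix[OF d rv] r by simp
    from cong_add[OF cong_scal[OF this, of "c w"] z(3)]
    have "ghost v d * (\<Sum>w\<in>insert w S. Poly_Mapping.single w (c w)) * path v d \<approx> ?z"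
      unfolding s by (simp add: path_def scal_mult_word)
    then show ?thesis using c k z(1) rc by (intro exI[of _ ?z]) auto
  next
    case False
    then have nr: "\<And>r. b @ d \<noteq> d @ r" using Pw by blast
    have "d \<noteq> (b @ d) @ r" for r
    proof
      assume "d = (b @ d) @ r"
      from arg_cong[OF this, of length] show False using bv(2) by simp
    qed
    then have "ghost v d * path v (b @ d) \<approx> 0" using ghost_path_diverge[OF d bd] nr by blast
    then have "ghost v d * word w * path v d \<approx> 0" using cong_trans[OF e] by blast
    from cong_add[OF cong_scal[OF this, of "c w"] z(3)]
    have "ghost v d * (\<Sum>w\<in>insert w S. Poly_Mapping.single w (c w)) * path v d \<approx> z"
      unfolding s by simp
    moreover have "{w' \<in> insert w S. ?P w'} = {w \<in> S. ?P w}" using False by auto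
    ultimately show ?thesis using z by (intro exI[of _ z]) auto
  qed
qed

text \<open>
  Conjugation fixes \<open>v\<close> and never increases the number of terms of \<open>z\<close>.  For a term \<open>b\<close> of \<open>z\<close>,
  condition (K) supplies a closed path \<open>q\<close> at \<open>v\<close> with other edges, and conjugation with a high power of
  \<open>q\<close> kills \<open>b\<close>.
\<close>

lemma condition_K_vertex:
  assumes K: "condition_K E" and v: "v \<in> verts E"
    and z: "supp z \<subseteq> cycle_words v" and mem: "V v + z \<in> J"
  shows "V v \<in> J"
  using z mem
proof (induction "card (supp z)" arbitrary: z rule: less_induct)
  case less
  show ?case
  proof (cases "z = 0")
    case True
    then show ?thesis using less.prems by simp
  next
    case False
    then obtain w where w: "w \<in> supp z" by (metis keys_eq_empty ex_in_conv)
    then obtain b where b: "w = Vertex v # map Edge b" "closed_path E v b"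
      using less.prems(1) unfolding cycle_words_def by auto
    have "v \<in> set (awalk_verts v b)" by (cases b) (use b in \<open>auto simp: closed_path_def awalk_Cons_iff\<close>)
    then obtain q where q: "closed_path E v q" "set q \<noteq> set b"
      using K b(2) unfolding condition_K_def by blast
    have qv: "awalk v q v" "q \<noteq> []" "b \<noteq> []" using q b unfolding closed_path_def by auto
    \<comment> \<open>The exponent makes \<open>d\<close> at least as long as \<open>b\<close>, so that \<open>d\<close> is not a prefix of \<open>b d\<close>.\<close>
    define d where "d = concat (replicate (length b) q)"
    have d: "awalk v d v" unfolding d_def by (rule awalk_concat_replicate[OF qv(1)])
    let ?P = "\<lambda>w. \<exists>r. w @ map Edge d = Vertex v # map Edge (d @ r)"
    have "\<not> ?P w"
    proof
      assume "?P w"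
      then obtain r where "map Edge (b @ d) = (map Edge (d @ r) :: ('v, 'e) lpa_gen list)" unfolding b(1) by auto
      then have "b @ d = d @ r" by (subst (asm) inj_map_eq_map) (auto simp: inj_def)
      then show False using prefix_of_shift_set_eq[of b q r] q(2) qv unfolding d_def by blast
    qed
    obtain z' where z': "supp z' \<subseteq> cycle_words v"
      "card (supp z') \<le> card {w \<in> supp z. ?P w}"
      "ghost v d * (\<Sum>w\<in>supp z. Poly_Mapping.single w (coef z w)) * path v d \<approx> z'"
      using conjugate_cycle_words[OF d _ less.prems(1), of "coef z"] by auto
    have "card {w \<in> supp z. ?P w} < card (supp z)"
      using w \<open>\<not> ?P w\<close> by (intro psubset_card_mono) auto
    then have less': "card (supp z') < card (supp z)" using z'(2) by simp
    have zz: "ghost v d * z * path v d \<approx> z'" using z'(3) by (simp only: sum_monomials[symmetric])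
    have "ghost v d * V v * path v d \<approx> ghost v d * path v d"
      using cong_lmult[OF V_path[OF d v], of "ghost v d"] d by (simp add: mult.assoc Mul_ghost[OF d])
    also have "\<dots> \<approx> V v" by (rule ghost_path_same[OF d])
    finally have "ghost v d * (V v + z) * path v d \<approx> V v + z'"
      using cong_add zz by (simp add: distrib_left distrib_right)
    moreover have "ghost v d * (V v + z) * path v d \<in> J"
      using less.prems(2) d by (intro J_rmult J_lmult) auto
    ultimately have "V v + z' \<in> J" using cong_mem by blast
    then show ?thesis using less.hyps[OF less' z'(1)] by blast
  qed
qed

lemma hereditary_vertices_in: "hereditary E (vertices_in J)"
  unfolding hereditary_def connects_def
proof (intro conjI allI impI)
  show "vertices_in J \<subseteq> verts E" by (auto simp: vertices_in_def)
  fix u v assume u: "u \<in> vertices_in J" and "\<exists>p. awalk u p v"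
  then obtain p where p: "awalk u p v" by blast
  have "V u * path u p \<in> J" using J_rmult u p by (auto simp: vertices_in_def)
  then have "path u p \<in> J" using cong_mem[OF V_path[OF p, of u]] p by auto
  then have "ghost u p * path u p \<in> J" using J_lmult p by blast
  then have "V v \<in> J" using cong_mem[OF ghost_path_same[OF p]] by blast
  then show "v \<in> vertices_in J" using p by (auto simp: vertices_in_def)
qed

lemma saturated_vertices_in: "saturated E (vertices_in J)"
  unfolding saturated_def
proof (intro conjI allI impI)
  show "vertices_in J \<subseteq> verts E" by (auto simp: vertices_in_def)
  fix v assume v: "regular_vertex E v" "head E ` out_arcs E v \<subseteq> vertices_in J"
  have "(\<Sum>e\<in>out_arcs E v. Ed e * Gh e) \<in> J"
  proof (rule J_sum)
    fix e assume e: "e \<in> out_arcs E v"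
    then have "head E e \<in> vertices_in J" using v(2) by blast
    then have "e \<in> arcs E" "V (head E e) \<in> J" using e by (auto simp: vertices_in_def)
    then show "Ed e * Gh e \<in> J" using head_in_J(1) J_rmult by blast
  qed
  then have "V v \<in> J" using cong_mem[OF cuntz_krieger[OF v(1)]] by blast
  then show "v \<in> vertices_in J"
    using v(1) by (simp add: vertices_in_def regular_vertex_def)
qed

end

context leavitt
begin

text \<open>
  An element of \<open>I\<close> outside \<open>P\<close> reduces to \<open>h + z \<in> I\<close>, and \<open>h \<in> I\<close> by the grading or by condition (K).
\<close>

theorem vertices_determine_ideal:
  assumes P: "lifted_ideal P" "graded P" and I: "lifted_ideal I" "P \<subseteq> I"
    and vert: "\<And>v. v \<in> verts E \<Longrightarrow> V v \<in> I \<Longrightarrow> V v \<in> P"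
    and brk: "\<And>v. v \<in> breaking_vertices E (vertices_in P) \<Longrightarrow>
       breaking_element (vertices_in P) v \<in> I \<Longrightarrow> breaking_element (vertices_in P) v \<in> P"
    and "graded I \<or> condition_K E"
  shows "I = P"
proof (rule ccontr)
  assume "I \<noteq> P"
  then obtain x where x: "x \<in> I" "x \<notin> P" using I(2) by blast
  interpret P: leavitt_ideal E K P using P(1) by unfold_locales
  interpret I: leavitt_ideal E K I using I(1) by unfold_locales
  obtain a b v h z where ab: "a \<in> Mul" "b \<in> Mul" and h: "P.corner_idempotent v h" and e: "P.cong (a * x * b) (h + z)"
    and z: "supp z \<subseteq> cycle_words v" "h = V v \<or> z = 0"
    using P.reduction[OF P(2) I.J_Alg[OF x(1)] x(2)] by blast
  have v: "v \<in> verts E" "h \<notin> P" using h by (auto simp: P.corner_idempotent_def)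
  have "I.cong (a * x * b) (h + z)" using e I(2) by (auto simp: P.cong_def I.cong_def)
  moreover have "a * x * b \<in> I" using x(1) ab by (intro I.J_rmult I.J_lmult) auto
  ultimately have hz: "h + z \<in> I" using I.cong_mem by blast
  have "h \<in> I"
  proof (cases "z = 0")
    case False
    then have hv: "h = V v" using z by blast
    show ?thesis
    proof (cases "graded I")
      case True
      then have "degree_part 0 0 (h + z) \<in> I" using hz unfolding graded_def by blast
      then show ?thesis
        using I.degree_part_cycle_words[OF z(1), of 0] hv by (simp add: degree_part_add degree_part_word)
    next
      case False
      then show ?thesis using I.condition_K_vertex[OF _ v(1) z(1)] hz hv assms(7) by simp
    qed
  qed (use hz in simp)
  then show False using h vert brk v unfolding P.corner_idempotent_def by blast
qed

section \<open>Prime ideals\<close>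

definition prime_lifted :: "(('v, 'e) lpa_gen list \<Rightarrow>\<^sub>0 'k) set \<Rightarrow> bool" where
  "prime_lifted P \<longleftrightarrow> lifted_ideal P \<and> P \<noteq> Alg \<and>
     (\<forall>A B. lifted_ideal A \<longrightarrow> lifted_ideal B \<longrightarrow> (\<forall>a\<in>A. \<forall>b\<in>B. a * b \<in> P) \<longrightarrow> A \<subseteq> P \<or> B \<subseteq> P)"

definition positive :: "(('v, 'e) lpa_gen list \<Rightarrow>\<^sub>0 'k) \<Rightarrow> bool" where
  "positive z \<longleftrightarrow> (\<forall>w\<in>supp z. word_degree w > 0)"

lemma positive_degree_part:
  assumes "positive z"
  shows "degree_part 0 0 z = 0"
proof (rule poly_mapping_eqI)
  fix w show "coef (degree_part 0 0 z) w = coef 0 w"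
  proof (cases "w \<in> supp z")
    case True
    then have "0 < word_degree w" using assms unfolding positive_def by blast
    then show ?thesis by (simp add: lookup_degree_part)
  next
    case False
    then show ?thesis by (simp add: lookup_degree_part in_keys_iff)
  qed
qed

lemma positive_add: "positive y \<Longrightarrow> positive z \<Longrightarrow> positive (y + z)"
  using Poly_Mapping.keys_add[of y z] unfolding positive_def by blast

lemma positive_mult: "positive y \<Longrightarrow> positive z \<Longrightarrow> positive (y * z)"
  using keys_mult[of y z] unfolding positive_def by (fastforce simp: plus_list_def)

lemma positive_cycle_words: "supp z \<subseteq> cycle_words v \<Longrightarrow> positive z"
  unfolding positive_def cycle_words_def closed_path_def by auto

lemma positive_word_mult:
  assumes "positive z" "0 \<le> word_degree u + word_degree w"
  shows "positive (word u * z * word w)"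
  unfolding positive_def
proof
  fix t assume t: "t \<in> supp (word u * z * word w)"
  obtain s where s: "t = s @ w" "s \<in> supp (word u * z)"
    using subsetD[OF keys_mult t] by (auto simp: plus_list_def word_def)
  obtain r where "s = u @ r" "r \<in> supp z"
    using subsetD[OF keys_mult s(2)] by (auto simp: plus_list_def word_def)
  then show "0 < word_degree t" using assms s by (auto simp: positive_def)
qed

text \<open>
  Two elements outside \<open>P\<close> reduce to \<open>u + z\<close> and \<open>u' + z'\<close>, and conjugation with paths from \<open>u\<close> and \<open>u'\<close>
  moves both to a common vertex \<open>w \<notin> P\<close>.  The product of the results has \<open>w\<close> as its component of
  degree \<open>0\<close>, so it is not in \<open>P\<close>.
\<close>

lemma prime_criterion:
  assumes P: "lifted_ideal P" "graded P"
    and brk: "\<And>v. v \<in> breaking_vertices E (vertices_in P) \<Longrightarrow> breaking_element (vertices_in P) v \<in> P"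
    and dir: "downward_directed E (verts E - vertices_in P)"
  shows "prime_lifted P"
  unfolding prime_lifted_def
proof (intro conjI allI impI)
  interpret P: leavitt_ideal E K P using P(1) by unfold_locales
  show "lifted_ideal P" by fact
  show "P \<noteq> Alg" using dir by (auto simp: downward_directed_def vertices_in_def)
  fix A B assume A: "lifted_ideal A" and B: "lifted_ideal B" and AB: "\<forall>a\<in>A. \<forall>b\<in>B. a * b \<in> P"
  show "A \<subseteq> P \<or> B \<subseteq> P"
  proof (rule ccontr)
    assume "\<not> (A \<subseteq> P \<or> B \<subseteq> P)"
    then obtain x y where x: "x \<in> A" "x \<notin> P" and y: "y \<in> B" "y \<notin> P" by blast
    have red: "\<exists>a\<in>Mul. \<exists>b\<in>Mul. \<exists>u z. u \<in> verts E - vertices_in P \<and> P.cong (a * x * b) (V u + z) \<and> positive z \<and> z \<in> Mul"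
      if xP: "x \<in> Alg" "x \<notin> P" for x
    proof -
      obtain a b v h z where "a \<in> Mul" "b \<in> Mul" and h: "P.corner_idempotent v h" and "P.cong (a * x * b) (h + z)"
        and z: "supp z \<subseteq> cycle_words v" "h = V v \<or> z = 0"
        using P.reduction[OF P(2) xP] by blast
      moreover have hv: "h = V v" using h brk unfolding P.corner_idempotent_def by blast
      moreover have "v \<in> verts E - vertices_in P"
        using h unfolding hv P.corner_idempotent_def vertices_in_def by blast
      ultimately show ?thesis using positive_cycle_words[OF z(1)] Mul_cycle_words[OF z(1)] by blast
    qed
    obtain a b u z where a: "a \<in> Mul" "b \<in> Mul" and u: "u \<in> verts E - vertices_in P"
      and xz: "P.cong (a * x * b) (V u + z)" "positive z" "z \<in> Mul"
      using red[of x] x lifted_idealD(2)[OF A] by blast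
    obtain a' b' u' z' where a': "a' \<in> Mul" "b' \<in> Mul" and u': "u' \<in> verts E - vertices_in P"
      and yz: "P.cong (a' * y * b') (V u' + z')" "positive z'" "z' \<in> Mul"
      using red[of y] y lifted_idealD(2)[OF B] by blast
    obtain w p q where w: "w \<in> verts E - vertices_in P" and p: "awalk u p w" and q: "awalk u' q w"
      using dir u u' unfolding downward_directed_def connects_def by blast
    have conj: "P.cong (ghost u p * x * path u p) (V w + ghost u p * z * path u p)"
      if p: "awalk u p w" and xz: "P.cong x (V u + z)" for u p x z
    proof -
      have uv: "u \<in> verts E" using p by auto
      have "P.cong (ghost u p * V u * path u p) (ghost u p * path u p)"
        using P.cong_rmult[OF P.ghost_V[OF p uv], of "path u p"] p by auto
      also have "P.cong \<dots> (V w)" by (rule P.ghost_path_same[OF p])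
      finally have "P.cong (ghost u p * (V u + z) * path u p) (V w + ghost u p * z * path u p)"
        using P.cong_add P.cong_refl by (simp add: distrib_left distrib_right)
      moreover have "P.cong (ghost u p * x * path u p) (ghost u p * (V u + z) * path u p)"
        using p xz by (intro P.cong_rmult P.cong_lmult) auto
      ultimately show ?thesis using P.cong_trans by blast
    qed
    have posc: "positive (ghost u p * z * path u p)" if "positive z" for u p z
      unfolding ghost_def path_def by (rule positive_word_mult[OF that]) simp
    let ?X = "ghost u p * (a * x * b) * path u p" and ?Y = "ghost u' q * (a' * y * b') * path u' q"
    let ?z = "ghost u p * z * path u p" and ?z' = "ghost u' q * z' * path u' q"
    have XM: "?X \<in> Mul" "?z' \<in> Mul"
      using p q a a' x xz yz Alg_Mul lifted_idealD(2)[OF A] by auto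
    have w': "V w \<in> Mul" "w \<in> verts E" "V w \<notin> P" using w by (auto simp: vertices_in_def)
    have XY': "P.cong (?X * ?Y) ((V w + ?z) * (V w + ?z'))"
      by (rule P.cong_mult[OF conj[OF p xz(1)] conj[OF q yz(1)] XM(1)]) (use XM w' in auto)
    have xm: "x * m \<in> A" if "m \<in> Mul" for m using lifted_idealD(6)[OF A x(1) that] .
    have "x * (b * path u p * ghost u' q * a') * y \<in> P"
      using AB xm[of "b * path u p * ghost u' q * a'"] y(1) a a' p q by auto
    then have "(ghost u p * a) * (x * (b * path u p * ghost u' q * a') * y) * (b' * path u' q) \<in> P"
      by (rule P.J_rmult[OF P.J_lmult]) (use a a' p q in auto)
    then have XY: "?X * ?Y \<in> P" by (simp only: mult.assoc)
    have split: "(V w + ?z) * (V w + ?z') = V w * V w + (V w * ?z' + ?z * V w + ?z * ?z')"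
      by (simp add: distrib_left distrib_right algebra_simps)
    have "positive (V w * ?z')" "positive (?z * V w)"
      using positive_word_mult[OF posc[OF yz(2)], of "[Vertex w]" "[]"]
        positive_word_mult[OF posc[OF xz(2)], of "[]" "[Vertex w]"]
      by (simp_all add: word_Nil)
    then have "positive (V w * ?z' + ?z * V w + ?z * ?z')"
      by (intro positive_add positive_mult[OF posc[OF xz(2)] posc[OF yz(2)]])
    from positive_degree_part[OF this]
    have "degree_part 0 0 ((V w + ?z) * (V w + ?z')) = degree_part 0 0 (V w * V w)"
      unfolding split degree_part_add[of 0 0 "V w * V w"] by simp
    also have "\<dots> = V w * V w"
      using degree_part_word_mult[of 0 0 "[Vertex w]" "V w"] by (simp add: degree_part_word)
    finally have "degree_part 0 0 ((V w + ?z) * (V w + ?z')) = V w * V w" .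
    moreover have "(V w + ?z) * (V w + ?z') \<in> P" using XY P.cong_mem[OF XY'] by blast
    then have "degree_part 0 0 ((V w + ?z) * (V w + ?z')) \<in> P"
      using P(2) unfolding graded_def by blast
    ultimately have "V w * V w \<in> P" by simp
    then show False using P.cong_mem[OF P.V_V[OF w'(2) w'(2)]] w' by simp
  qed
qed

end

context wf_digraph
begin

lemma connects_trans: "connects G u v \<Longrightarrow> connects G v w \<Longrightarrow> connects G u w"
  unfolding connects_def using awalk_appendI by blast

lemma connects_refl: "u \<in> verts G \<Longrightarrow> connects G u u"
  unfolding connects_def by (auto simp: awalk_Nil_iff intro!: exI[of _ "[]"])

lemma connects_arc: "e \<in> out_arcs G u \<Longrightarrow> connects G u (head G e)"
  unfolding connects_def by (rule exI[of _ "[e]"]) (auto simp: awalk_simps)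

end

context leavitt_ideal
begin

lemma annihilator_lifted:
  assumes "lifted_ideal A"
  shows "lifted_ideal {b \<in> Alg. \<forall>a\<in>A. \<forall>x\<in>Mul. a * x * b \<in> J}"
  unfolding lifted_ideal_def
proof (intro conjI ballI)
  show "lpa_ideal E \<subseteq> {b \<in> Alg. \<forall>a\<in>A. \<forall>x\<in>Mul. a * x * b \<in> J}"
  proof
    fix b :: "('v, 'e) lpa_gen list \<Rightarrow>\<^sub>0 'k" assume b: "b \<in> lpa_ideal E"
    then have "b \<in> J" using lifted_idealD(1)[OF J] by blast
    then show "b \<in> {b \<in> Alg. \<forall>a\<in>A. \<forall>x\<in>Mul. a * x * b \<in> J}"
      using J_Alg J_lmult lifted_idealD(2)[OF assms] Alg_Mul by auto
  qed
next
  fix a b assume "a \<in> {b \<in> Alg. \<forall>a\<in>A. \<forall>x\<in>Mul. a * x * b \<in> J}" "b \<in> {b \<in> Alg. \<forall>a\<in>A. \<forall>x\<in>Mul. a * x * b \<in> J}"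
  then show "a + b \<in> {b \<in> Alg. \<forall>a\<in>A. \<forall>x\<in>Mul. a * x * b \<in> J}"
    using J_add by (auto simp: distrib_left)
next
  fix b y assume b: "b \<in> {b \<in> Alg. \<forall>a\<in>A. \<forall>x\<in>Mul. a * x * b \<in> J}" and y: "y \<in> Mul"
  have "a * x * (y * b) \<in> J" if "a \<in> A" "x \<in> Mul" for a x
  proof -
    have "a * (x * y) * b \<in> J" using b y that by auto
    then show ?thesis by (simp add: mult.assoc)
  qed
  moreover have "a * x * (b * y) \<in> J" if "a \<in> A" "x \<in> Mul" for a x
  proof -
    have "a * x * b * y \<in> J" using b y that J_rmult by auto
    then show ?thesis by (simp add: mult.assoc)
  qed
  ultimately show "y * b \<in> {b \<in> Alg. \<forall>a\<in>A. \<forall>x\<in>Mul. a * x * b \<in> J}"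
    "b * y \<in> {b \<in> Alg. \<forall>a\<in>A. \<forall>x\<in>Mul. a * x * b \<in> J}"
    using b y by auto
qed auto

lemma left_annihilator_lifted:
  assumes "z \<in> Alg"
  shows "lifted_ideal {a \<in> Alg. \<forall>x\<in>Mul. a * x * z \<in> J}"
  unfolding lifted_ideal_def
proof (intro conjI ballI)
  show "lpa_ideal E \<subseteq> {a \<in> Alg. \<forall>x\<in>Mul. a * x * z \<in> J}"
  proof
    fix b :: "('v, 'e) lpa_gen list \<Rightarrow>\<^sub>0 'k" assume b: "b \<in> lpa_ideal E"
    then have "b \<in> J" using lifted_idealD(1)[OF J] by blast
    then show "b \<in> {a \<in> Alg. \<forall>x\<in>Mul. a * x * z \<in> J}"
      using J_Alg J_rmult Alg_Mul[OF assms] by auto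
  qed
next
  fix a b assume "a \<in> {a \<in> Alg. \<forall>x\<in>Mul. a * x * z \<in> J}" "b \<in> {a \<in> Alg. \<forall>x\<in>Mul. a * x * z \<in> J}"
  then show "a + b \<in> {a \<in> Alg. \<forall>x\<in>Mul. a * x * z \<in> J}"
    using J_add by (auto simp: distrib_right)
next
  fix a y assume a: "a \<in> {a \<in> Alg. \<forall>x\<in>Mul. a * x * z \<in> J}" and y: "y \<in> Mul"
  have "y * a * x * z \<in> J" if "x \<in> Mul" for x
  proof -
    have "y * (a * x * z) \<in> J" using a y that J_lmult by auto
    then show ?thesis by (simp add: mult.assoc)
  qed
  moreover have "a * y * x * z \<in> J" if "x \<in> Mul" for x
  proof -
    have "a * (y * x) * z \<in> J" using a y that by auto
    then show ?thesis by (simp add: mult.assoc)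
  qed
  ultimately show "y * a \<in> {a \<in> Alg. \<forall>x\<in>Mul. a * x * z \<in> J}"
    "a * y \<in> {a \<in> Alg. \<forall>x\<in>Mul. a * x * z \<in> J}"
    using a y by auto
qed auto

text \<open>
  Primeness is applied to the ideal of all \<open>a\<close> with \<open>a L z \<subseteq> P\<close> and to its annihilator modulo \<open>P\<close>.
\<close>

lemma prime_elementwise:
  assumes "prime_lifted J" and y: "y \<in> Alg" "y \<notin> J" and z: "z \<in> Alg" "z \<notin> J"
  shows "\<exists>t\<in>lists (lpa_gens E). y * word t * z \<notin> J"
proof (rule ccontr)
  assume a: "\<not> (\<exists>t\<in>lists (lpa_gens E). y * word t * z \<notin> J)"
  have yxz: "y * x * z \<in> J" if "x \<in> Mul" for x
    using that
  proof (induction rule: Mul_induct)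
    case (add a b)
    then show ?case using J_add by (simp add: distrib_left distrib_right)
  next
    case (monomial c w)
    then have "y * word w * z \<in> J" using a by blast
    then have "scal c * (y * word w * z) \<in> J" by (rule J_lmult) simp
    then show ?case by (simp add: mult.assoc scal_left_commute)
  qed simp
  \<comment> \<open>\<open>y\<close> lies in \<open>A\<close> and \<open>z\<close> lies in \<open>B\<close>, while \<open>A B \<subseteq> J\<close>.\<close>
  define A where "A = {a \<in> Alg. \<forall>x\<in>Mul. a * x * z \<in> J}"
  define B where "B = {b \<in> Alg. \<forall>a\<in>A. \<forall>x\<in>Mul. a * x * b \<in> J}"
  have "lifted_ideal A" unfolding A_def by (rule left_annihilator_lifted[OF z(1)])
  moreover from this have "lifted_ideal B" unfolding B_def by (rule annihilator_lifted)
  moreover have "a * b \<in> J" if "a \<in> A" "b \<in> B" for a b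
  proof -
    have "a * 1 * b \<in> J" using that Mul_intros(1) unfolding B_def by blast
    then show ?thesis by simp
  qed
  ultimately have "A \<subseteq> J \<or> B \<subseteq> J" using assms(1) unfolding prime_lifted_def by blast
  moreover have "y \<in> A" using y yxz by (auto simp: A_def)
  moreover have "z \<in> B" using z by (auto simp: B_def A_def)
  ultimately show False using y z by blast
qed

text \<open>
  If \<open>u t v \<notin> P\<close> for a word \<open>t\<close>, the normal form \<open>p q\<^sup>*\<close> of \<open>t\<close> gives paths from \<open>u\<close> and \<open>v\<close> to the common
  range of \<open>p\<close> and \<open>q\<close>.
\<close>

lemma prime_downward_directed:
  assumes "prime_lifted J"
  shows "downward_directed E (verts E - vertices_in J)"
  unfolding downward_directed_def
proof (intro conjI ballI)
  obtain x where x: "x \<in> Alg" "x \<notin> J" using assms J_Alg unfolding prime_lifted_def by blast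
  obtain v where v: "v \<in> verts E" "x * V v \<notin> J" using exists_V_notin[OF x] by blast
  then have "V v \<notin> J" using J_lmult Alg_Mul[OF x(1)] by blast
  then show "verts E - vertices_in J \<noteq> {}" using v by (auto simp: vertices_in_def)
  fix u v assume u: "u \<in> verts E - vertices_in J" and v: "v \<in> verts E - vertices_in J"
  then have uv: "u \<in> verts E" "V u \<notin> J" "v \<in> verts E" "V v \<notin> J" by (auto simp: vertices_in_def)
  obtain t where t: "t \<in> lists (lpa_gens E)" "V u * word t * V v \<notin> J"
    using prime_elementwise[OF assms, of "V u" "V v"] uv by auto
  show "\<exists>w\<in>verts E - vertices_in J. connects E u w \<and> connects E v w"
  proof (cases "t = []")
    case True
    then have "V u * V v \<notin> J" using t by (simp add: word_Nil)
    then have "u = v" using cong_mem[OF V_V[OF uv(1,3)]] by (auto split: if_splits)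
    then show ?thesis using u uv connects_refl by blast
  next
    case False
    from word_normal_form[OF t(1) False] consider "word t \<approx> 0"
      | a p c q x where "awalk a p x" "awalk c q x" "word t \<approx> path a p * ghost c q"
      unfolding normal_form_def by blast
    then show ?thesis
    proof cases
      case 1
      have "V u * word t * V v \<approx> 0" using zero_rmult[OF zero_lmult[OF 1, of "V u"], of "V v"] uv by auto
      then show ?thesis using t by (simp add: cong_zero_iff)
    next
      case (2 a p c q x)
      have "V u * word t * V v \<approx> V u * (path a p * ghost c q) * V v"
        using 2 uv by (intro cong_rmult cong_lmult) auto
      then have n: "V u * (path a p * ghost c q) * V v \<notin> J" using t cong_mem by blast
      have pM: "path a p \<in> Mul" "ghost c q \<in> Mul" using 2 by auto
      have au: "a = u"
      proof (rule ccontr)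
        assume "a \<noteq> u"
        then have "V u * path a p \<in> J" using cong_mem[OF V_path[OF 2(1) uv(1)]] by simp
        then have "V u * path a p * (ghost c q * V v) \<in> J" by (rule J_rmult) (use pM uv in auto)
        then show False using n by (simp add: mult.assoc)
      qed
      have cv: "c = v"
      proof (rule ccontr)
        assume "c \<noteq> v"
        then have "ghost c q * V v \<in> J" using cong_mem[OF ghost_V[OF 2(2) uv(3)]] by simp
        then have "V u * path a p * (ghost c q * V v) \<in> J" by (rule J_lmult) (use pM uv in auto)
        then show False using n by (simp add: mult.assoc)
      qed
      have x: "x \<in> verts E" using 2 by auto
      have "V x \<notin> J"
      proof
        assume "V x \<in> J"
        then have "path a p * V x \<in> J" using J_lmult pM by blast
        then have "path a p \<in> J" using cong_mem[OF path_V[OF 2(1) x]] by simp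
        then have "path a p * ghost c q \<in> J" by (rule J_rmult[OF _ pM(2)])
        then have "V u * (path a p * ghost c q) \<in> J" by (rule J_lmult) (use uv in auto)
        then have "V u * (path a p * ghost c q) * V v \<in> J" by (rule J_rmult) (use uv in auto)
        then show False using n by simp
      qed
      then show ?thesis using 2 au cv x by (auto simp: connects_def vertices_in_def)
    qed
  qed
qed

end

section \<open>Quotient graphs\<close>

context wf_digraph
begin

lemma verts_quotient [simp]: "verts (quotient_graph G H) = verts G - H"
  by (simp add: quotient_graph_def)

lemma quotient_awalk_iff:
  assumes "hereditary G H"
  shows "pre_digraph.awalk (quotient_graph G H) u p v \<longleftrightarrow> awalk u p v \<and> v \<notin> H"
proof -
  let ?F = "quotient_graph G H"
  have cas: "pre_digraph.cas ?F u p v \<longleftrightarrow> cas u p v" for u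
    by (induction p arbitrary: u) (simp_all add: pre_digraph.cas.simps quotient_graph_def)
  have "awalk u p v \<and> v \<notin> H \<longleftrightarrow> awalk u p v \<and> v \<notin> H \<and> u \<notin> H \<and> (\<forall>e\<in>set p. head G e \<notin> H)" for u
  proof (induction p arbitrary: u)
    case Nil
    then show ?case by (auto simp: awalk_Nil_iff)
  next
    case (Cons e p)
    have "u \<in> H \<Longrightarrow> awalk u (e # p) v \<Longrightarrow> v \<in> H"
      using assms unfolding hereditary_def connects_def by blast
    then show ?case using Cons.IH[of "head G e"] by (auto simp: awalk_Cons_iff)
  qed
  moreover have "(\<forall>e\<in>set p. head G e \<notin> H) \<Longrightarrow> u \<notin> H \<Longrightarrow> awalk u p v \<Longrightarrow> v \<notin> H" for u
    by (induction p arbitrary: u) (auto simp: awalk_Nil_iff awalk_Cons_iff)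
  ultimately show ?thesis
    unfolding pre_digraph.awalk_def[of ?F] awalk_def cas
    by (auto simp: quotient_graph_def)
qed

lemma quotient_connects_iff:
  "hereditary G H \<Longrightarrow> connects (quotient_graph G H) u v \<longleftrightarrow> connects G u v \<and> v \<notin> H"
  unfolding connects_def by (auto simp: quotient_awalk_iff)

lemma out_arcs_quotient: "out_arcs (quotient_graph G H) v = {e \<in> out_arcs G v. head G e \<notin> H}"
  by (auto simp: quotient_graph_def out_arcs_def)

lemma breaking_vertices_iff:
  "v \<in> breaking_vertices G H \<longleftrightarrow> v \<in> verts G - H \<and> infinite (out_arcs G v) \<and>
     finite {e \<in> out_arcs G v. head G e \<notin> H} \<and> {e \<in> out_arcs G v. head G e \<notin> H} \<noteq> {}"
proof -
  have S: "{e \<in> out_arcs G v. head G e \<in> verts G - H} = {e \<in> out_arcs G v. head G e \<notin> H}"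
    by auto
  show ?thesis
    unfolding breaking_vertices_def infinite_emitter_def mem_Collect_eq S by blast
qed

lemma union_hereditary_saturated:
  assumes H: "hereditary G H" "saturated G H"
    and Y: "hereditary (quotient_graph G H) Y" "saturated (quotient_graph G H) Y"
  shows "hereditary G (H \<union> Y)" "saturated G (H \<union> Y)"
proof -
  have YV: "Y \<subseteq> verts G - H" using Y(1) by (simp add: hereditary_def)
  show "hereditary G (H \<union> Y)"
    using H(1) Y(1) YV unfolding hereditary_def quotient_connects_iff[OF H(1)] by blast
  show "saturated G (H \<union> Y)"
    unfolding saturated_def
  proof (intro conjI allI impI)
    show "H \<union> Y \<subseteq> verts G" using H(1) YV by (auto simp: hereditary_def)
    fix v assume v: "regular_vertex G v" "head G ` out_arcs G v \<subseteq> H \<union> Y"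
    show "v \<in> H \<union> Y"
    proof (cases "v \<in> H \<or> head G ` out_arcs G v \<subseteq> H")
      case True
      then show ?thesis using H(2) v(1) unfolding saturated_def by blast
    next
      case False
      have "finite {e \<in> out_arcs G v. head G e \<notin> H}"
        by (rule finite_subset[of _ "out_arcs G v"]) (use v(1) in \<open>auto simp: regular_vertex_def\<close>)
      moreover have "{e \<in> out_arcs G v. head G e \<notin> H} \<noteq> {}" "v \<in> verts G - H"
        using False v(1) unfolding regular_vertex_def by blast+
      ultimately have "regular_vertex (quotient_graph G H) v"
        unfolding regular_vertex_def out_arcs_quotient verts_quotient by blast
      moreover have "head (quotient_graph G H) ` out_arcs (quotient_graph G H) v \<subseteq> Y"
      proof
        fix x assume "x \<in> head (quotient_graph G H) ` out_arcs (quotient_graph G H) v"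
        then obtain e where "e \<in> out_arcs G v" "head G e \<notin> H" "x = head G e"
          unfolding out_arcs_quotient by (auto simp: quotient_graph_def)
        then show "x \<in> Y" using v(2) by blast
      qed
      ultimately show ?thesis using Y(2) unfolding saturated_def by blast
    qed
  qed
qed

end

context leavitt
begin

text \<open>
  A regular vertex of the quotient graph is regular in the original graph or breaking.  In the second
  case the breaking element in \<open>P\<close> replaces the Cuntz-Krieger relation.
\<close>

lemma vertices_in_quotient:
  assumes P: "lifted_ideal P" and A: "lifted_ideal A" "P \<subseteq> A"
    and brk: "\<And>v. v \<in> breaking_vertices E (vertices_in P) \<Longrightarrow> breaking_element (vertices_in P) v \<in> P"
  defines "H \<equiv> vertices_in P"
  shows "hereditary (quotient_graph E H) (vertices_in A - H)" "saturated (quotient_graph E H) (vertices_in A - H)"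
proof -
  interpret P: leavitt_ideal E K P using P by unfold_locales
  interpret A: leavitt_ideal E K A using A(1) by unfold_locales
  have hH: "hereditary E H" unfolding H_def by (rule P.hereditary_vertices_in)
  show "hereditary (quotient_graph E H) (vertices_in A - H)"
    unfolding hereditary_def
  proof (intro conjI allI impI)
    show "vertices_in A - H \<subseteq> verts (quotient_graph E H)" by (auto simp: vertices_in_def)
    fix u v assume "u \<in> vertices_in A - H" "connects (quotient_graph E H) u v"
    then have "u \<in> vertices_in A" "connects E u v" "v \<notin> H"
      using quotient_connects_iff[OF hH] by auto
    then show "v \<in> vertices_in A - H"
      using A.hereditary_vertices_in unfolding hereditary_def by blast
  qed
  show "saturated (quotient_graph E H) (vertices_in A - H)"
    unfolding saturated_def
  proof (intro conjI allI impI)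
    show "vertices_in A - H \<subseteq> verts (quotient_graph E H)" by (auto simp: vertices_in_def)
    fix v assume r: "regular_vertex (quotient_graph E H) v"
      and h: "head (quotient_graph E H) ` out_arcs (quotient_graph E H) v \<subseteq> vertices_in A - H"
    let ?D = "{e \<in> out_arcs E v. head E e \<notin> H}"
    have v: "v \<in> verts E" "v \<notin> H" and D: "finite ?D" "?D \<noteq> {}"
      using r unfolding regular_vertex_def out_arcs_quotient by auto
    have hA: "V (head E e) \<in> A" if "e \<in> ?D" for e
    proof -
      have "head E e \<in> vertices_in A"
        using h that unfolding out_arcs_quotient by (auto simp: quotient_graph_def)
      then show ?thesis by (simp add: vertices_in_def)
    qed
    have EG: "Ed e * Gh e \<in> A" if "e \<in> ?D" for e
      using A.J_rmult[OF A.head_in_J(1)[OF _ hA[OF that]]] that by auto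
    show "v \<in> vertices_in A - H"
    proof (cases "finite (out_arcs E v)")
      case True
      then have "regular_vertex E v" using v D by (auto simp: regular_vertex_def)
      moreover have "head E ` out_arcs E v \<subseteq> vertices_in A"
      proof
        fix x assume "x \<in> head E ` out_arcs E v"
        then obtain e where e: "e \<in> out_arcs E v" "x = head E e" by blast
        show "x \<in> vertices_in A"
        proof (cases "x \<in> H")
          case True
          then show ?thesis using A(2) by (auto simp: H_def vertices_in_def)
        next
          case False
          then show ?thesis using hA[of e] e by (auto simp: vertices_in_def)
        qed
      qed
      ultimately show ?thesis using A.saturated_vertices_in v unfolding saturated_def by blast
    next
      case False
      have "v \<in> breaking_vertices E H"
        unfolding breaking_vertices_iff using False v D by blast
      then have b: "breaking_element H v \<in> A" using brk A(2) unfolding H_def by blast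
      have s: "(\<Sum>e\<in>?D. Ed e * Gh e) \<in> A" by (rule A.J_sum) (rule EG)
      have eq: "breaking_element H v + (\<Sum>e\<in>?D. Ed e * Gh e) = V v"
        by (simp only: breaking_element_def diff_add_cancel)
      from A.J_add[OF b s] have "V v \<in> A" by (simp only: eq)
      then show ?thesis using v by (simp add: vertices_in_def)
    qed
  qed
qed

end

section \<open>The representation on infinite paths\<close>

context leavitt
begin

fun step_source :: "'e + 'v \<Rightarrow> 'v" where
  "step_source (Inl e) = tail E e" | "step_source (Inr v) = v"

fun step_target :: "'e + 'v \<Rightarrow> 'v" where
  "step_target (Inl e) = head E e" | "step_target (Inr v) = v"

text \<open>
  A step is an edge of the quotient graph or \<open>Inr v\<close> for a sink \<open>v\<close> of it, thought of as a loop at \<open>v\<close>.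
  With these loops every vertex outside \<open>H\<close> emits a step, so rays start everywhere and the shift of a
  ray is a ray.
\<close>

definition steps :: "'v set \<Rightarrow> ('e + 'v) set" where
  "steps H = Inl ` {e \<in> arcs E. head E e \<notin> H} \<union>
     Inr ` {v \<in> verts E - H. \<forall>e\<in>out_arcs E v. head E e \<in> H}"

definition rays :: "'v set \<Rightarrow> (nat \<Rightarrow> 'e + 'v) set" where
  "rays H = {f. \<forall>i. f i \<in> steps H \<and> step_target (f i) = step_source (f (Suc i))}"

text \<open>
  The edge \<open>e\<close> moves a function on the rays from \<open>r(e)\<close> to the rays that begin with \<open>e\<close>, the ghost edge
  moves it back, and vertices restrict functions.
\<close>

fun gen_op :: "'v set \<Rightarrow> ('v, 'e) lpa_gen \<Rightarrow> ((nat \<Rightarrow> 'e + 'v) \<Rightarrow> 'k) \<Rightarrow> (nat \<Rightarrow> 'e + 'v) \<Rightarrow> 'k" where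
  "gen_op H (Vertex v) h f = (if f \<in> rays H \<and> step_source (f 0) = v then h f else 0)"
| "gen_op H (Edge e) h f = (if f \<in> rays H \<and> f 0 = Inl e then h (\<lambda>i. f (Suc i)) else 0)"
| "gen_op H (Ghost e) h f =
     (if f \<in> rays H \<and> step_source (f 0) = head E e then h (case_nat (Inl e) f) else 0)"

definition act :: "'v set \<Rightarrow> (('v, 'e) lpa_gen list \<Rightarrow>\<^sub>0 'k) \<Rightarrow> ((nat \<Rightarrow> 'e + 'v) \<Rightarrow> 'k) \<Rightarrow> (nat \<Rightarrow> 'e + 'v) \<Rightarrow> 'k" where
  "act H a h f = (\<Sum>w\<in>supp a. coef a w * foldr (gen_op H) w h f)"

definition kernel :: "'v set \<Rightarrow> (('v, 'e) lpa_gen list \<Rightarrow>\<^sub>0 'k) set" where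
  "kernel H = {a \<in> Alg. \<forall>h f. act H a h f = 0}"

lemma act_superset:
  assumes "finite S" "supp a \<subseteq> S"
  shows "act H a h f = (\<Sum>w\<in>S. coef a w * foldr (gen_op H) w h f)"
  unfolding act_def by (rule sum.mono_neutral_left) (use assms in \<open>auto simp: in_keys_iff\<close>)

lemma act_add: "act H (a + b) h f = act H a h f + act H b h f"
proof -
  let ?S = "supp a \<union> supp b"
  have "act H (a + b) h f = (\<Sum>w\<in>?S. coef (a + b) w * foldr (gen_op H) w h f)"
    by (rule act_superset) (use Poly_Mapping.keys_add[of a b] in auto)
  also have "\<dots> = (\<Sum>w\<in>?S. coef a w * foldr (gen_op H) w h f)
      + (\<Sum>w\<in>?S. coef b w * foldr (gen_op H) w h f)"
    by (simp add: lookup_add distrib_right sum.distrib)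
  also have "\<dots> = act H a h f + act H b h f"
    by (simp add: act_superset[of ?S])
  finally show ?thesis .
qed

lemma act_zero [simp]: "act H 0 h f = 0"
  by (simp add: act_def)

lemma act_single: "act H (Poly_Mapping.single w c) h f = c * foldr (gen_op H) w h f"
  by (simp add: act_def)

lemma act_word: "act H (word w) h f = foldr (gen_op H) w h f"
  by (simp add: word_def act_single)

lemma act_minus: "act H (a - b) h f = act H a h f - act H b h f"
  using act_add[of H "a - b" b h f] by simp

lemma act_sum: "act H (sum g I) h f = (\<Sum>i\<in>I. act H (g i) h f)"
  by (induction I rule: infinite_finite_induct) (auto simp: act_add)

lemma gen_op_add: "gen_op H g (\<lambda>f. h f + h' f) = (\<lambda>f. gen_op H g h f + gen_op H g h' f)"
  by (cases g) (auto simp: fun_eq_iff)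

lemma gen_op_scale: "gen_op H g (\<lambda>f. c * h f) = (\<lambda>f. c * gen_op H g h f)"
  by (cases g) (auto simp: fun_eq_iff)

lemma gen_op_zero: "gen_op H g (\<lambda>f. 0) = (\<lambda>f. 0)"
  by (cases g) (auto simp: fun_eq_iff)

lemma foldr_op_add:
  "foldr (gen_op H) w (\<lambda>f. h f + h' f) = (\<lambda>f. foldr (gen_op H) w h f + foldr (gen_op H) w h' f)"
  by (induction w) (simp_all add: gen_op_add)

lemma foldr_op_scale: "foldr (gen_op H) w (\<lambda>f. c * h f) = (\<lambda>f. c * foldr (gen_op H) w h f)"
  by (induction w) (simp_all add: gen_op_scale)

lemma foldr_op_zero: "foldr (gen_op H) w (\<lambda>f. 0) = (\<lambda>f. 0)"
  by (induction w) (simp_all add: gen_op_zero)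

lemma act_scal: "act H (scal c * a) h f = c * act H a h f"
proof -
  have "act H (scal c * a) h f = (\<Sum>w\<in>supp a. coef (scal c * a) w * foldr (gen_op H) w h f)"
    by (rule act_superset) (auto simp: in_keys_iff lookup_scal_mult)
  also have "\<dots> = c * act H a h f"
    by (simp add: act_def lookup_scal_mult sum_distrib_left mult.assoc)
  finally show ?thesis .
qed

lemma act_word_mult: "act H (word u * a) h = foldr (gen_op H) u (act H a h)"
proof -
  have "supp a \<subseteq> UNIV" by simp
  then show ?thesis
  proof (induction rule: keys_subset_induct)
    case zero
    have "act H 0 h = (\<lambda>f. 0)" by (simp add: fun_eq_iff)
    then show ?case by (simp add: foldr_op_zero)
  next
    case (add a b)
    have "act H (a + b) h = (\<lambda>f. act H a h f + act H b h f)" by (simp add: fun_eq_iff act_add)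
    then show ?case using add by (simp add: fun_eq_iff foldr_op_add distrib_left act_add)
  next
    case (monomial c w)
    have "act H (scal c * word w) h = (\<lambda>f. c * foldr (gen_op H) w h f)"
      by (simp add: fun_eq_iff act_scal act_word)
    moreover have "act H (word u * (scal c * word w)) h = (\<lambda>f. c * foldr (gen_op H) (u @ w) h f)"
      by (simp add: fun_eq_iff scal_left_commute word_append[symmetric] act_scal act_word)
    ultimately show ?case by (simp add: foldr_op_scale)
  qed
qed

lemma act_mult_word: "act H (a * word u) h f = act H a (foldr (gen_op H) u h) f"
proof -
  have "supp a \<subseteq> UNIV" by simp
  then show ?thesis
  proof (induction rule: keys_subset_induct)
    case (monomial c w)
    show ?case by (simp add: mult.assoc word_append[symmetric] act_scal act_word)
  qed (simp_all add: distrib_right act_add)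
qed

lemma steps_source:
  assumes "hereditary E H" "s \<in> steps H"
  shows "step_source s \<in> verts E - H" "step_target s \<in> verts E - H"
proof -
  have "tail E e \<notin> H" if "e \<in> arcs E" "head E e \<notin> H" for e
    using assms(1) connects_arc[of e "tail E e"] that unfolding hereditary_def by auto
  then show "step_source s \<in> verts E - H" "step_target s \<in> verts E - H"
    using assms(2) unfolding steps_def by auto
qed

lemma rays_shift: "f \<in> rays H \<Longrightarrow> (\<lambda>i. f (Suc i)) \<in> rays H"
  unfolding rays_def by blast

lemma rays_source: "f \<in> rays H \<Longrightarrow> step_source (f (Suc i)) = step_target (f i)"
  unfolding rays_def by auto

lemma rays_steps: "f \<in> rays H \<Longrightarrow> f i \<in> steps H"
  unfolding rays_def by blast

lemma rays_cons:
  assumes f: "f \<in> rays H" and H: "hereditary E H" and e: "e \<in> arcs E" "step_source (f 0) = head E e"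
  shows "case_nat (Inl e) f \<in> rays H"
  unfolding rays_def
proof (intro CollectI allI conjI)
  fix i
  have "head E e \<notin> H" using steps_source(1)[OF H rays_steps[OF f, of 0]] e by simp
  then show "case_nat (Inl e) f i \<in> steps H"
    using e rays_steps[OF f] by (cases i) (auto simp: steps_def)
  show "step_target (case_nat (Inl e) f i) = step_source (case_nat (Inl e) f (Suc i))"
    using e rays_source[OF f] by (cases i) auto
qed

lemma ray_edge: "f \<in> rays H \<Longrightarrow> f 0 = Inl e \<Longrightarrow> e \<in> arcs E"
  using rays_steps[of f H 0] unfolding steps_def by auto

lemma case_nat_shift: "f 0 = x \<Longrightarrow> case_nat x (\<lambda>i. f (Suc i)) = f"
  by (auto simp: fun_eq_iff split: nat.split)

lemma Edge_Ghost_op: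
  "gen_op H (Edge e) (gen_op H (Ghost e) h) f = (if f \<in> rays H \<and> f 0 = Inl e then h f else 0)"
  using rays_shift[of f H] rays_source[of f H 0] by (auto simp: case_nat_shift)

lemma act_Edge_Ghost:
  "act H (Ed e * Gh e) h f = (if f \<in> rays H \<and> f 0 = Inl e then h f else 0)"
  using Edge_Ghost_op[of H e h f] by (simp add: act_word_mult act_word word_append[symmetric])

text \<open>
  Only the Cuntz-Krieger relation needs saturation: a regular vertex outside \<open>H\<close> is not a sink of the
  quotient graph, so every ray from it begins with an edge.
\<close>

lemma relations_act_zero:
  assumes H: "hereditary E H" "saturated E H" and a: "a \<in> lpa_rels E"
  shows "act H a h f = 0"
proof -
  consider (VV) v w where "a = word [Vertex v, Vertex w] - (if v = w then word [Vertex v] else 0)"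
    | (VE) e where "a = word [Vertex (tail E e), Edge e] - word [Edge e]"
    | (EV) e where "a = word [Edge e, Vertex (head E e)] - word [Edge e]"
    | (VG) e where "a = word [Vertex (head E e), Ghost e] - word [Ghost e]"
    | (GV) e where "a = word [Ghost e, Vertex (tail E e)] - word [Ghost e]" "e \<in> arcs E"
    | (GE) e g where "a = word [Ghost e, Edge g] - (if e = g then word [Vertex (head E e)] else 0)" "e \<in> arcs E"
    | (CK) v where "a = word [Vertex v] - (\<Sum>e\<in>out_arcs E v. word [Edge e, Ghost e])" "regular_vertex E v"
    using a unfolding lpa_rels_def by blast
  then show ?thesis
  proof cases
    case CK
    have "(\<Sum>e\<in>out_arcs E v. act H (word [Edge e, Ghost e]) h f) =
        (\<Sum>e\<in>out_arcs E v. if f \<in> rays H \<and> f 0 = Inl e then h f else 0)"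
      by (rule sum.cong) (use Edge_Ghost_op[of H _ h f] in \<open>simp_all add: act_word\<close>)
    also have "\<dots> = (if f \<in> rays H \<and> step_source (f 0) = v then h f else 0)"
    proof (cases "f \<in> rays H \<and> step_source (f 0) = v")
      case True
      have "\<exists>e\<in>out_arcs E v. f 0 = Inl e"
      proof (cases "f 0")
        case (Inl e)
        then show ?thesis using True ray_edge by auto
      next
        case (Inr u)
        then have "u = v" "Inr v \<in> steps H" using True rays_steps[of f H 0] by auto
        then have "v \<notin> H" "head E ` out_arcs E v \<subseteq> H" by (auto simp: steps_def)
        then show ?thesis using H(2) CK(2) unfolding saturated_def by blast
      qed
      then obtain e where e: "e \<in> out_arcs E v" "f 0 = Inl e" by blast
      have fin: "finite (out_arcs E v)" using CK(2) by (simp add: regular_vertex_def)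
      have "(\<Sum>d\<in>out_arcs E v. if f \<in> rays H \<and> f 0 = Inl d then h f else 0)
          = (\<Sum>d\<in>out_arcs E v. if d = e then h f else 0)"
        by (rule sum.cong) (use True e(2) in auto)
      also have "\<dots> = h f" using fin e(1) by (simp only: sum.delta if_True)
      finally show ?thesis using True by simp
    next
      case False
      then have "(\<Sum>d\<in>out_arcs E v. if f \<in> rays H \<and> f 0 = Inl d then h f else 0) = 0"
        by (intro sum.neutral) auto
      then show ?thesis unfolding if_not_P[OF False] .
    qed
    finally show ?thesis unfolding CK by (simp add: act_minus act_sum act_word)
  next
    case GV
    then show ?thesis using rays_cons[OF _ H(1), of f e] by (auto simp: act_minus act_word)
  next
    case GE
    then show ?thesis using rays_cons[OF _ H(1), of f e] by (auto simp: act_minus act_word)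
  next
    case EV
    then show ?thesis using rays_shift[of f H] rays_source[of f H 0] by (auto simp: act_minus act_word)
  qed (auto simp: act_minus act_word)
qed

lemma kernel_lifted:
  assumes H: "hereditary E H" "saturated E H"
  shows "lifted_ideal (kernel H)"
proof -
  have l: "act H (x * a) h f = 0" if x: "x \<in> Mul" and a: "\<And>h f. act H a h f = 0" for x a h f
    using x
  proof (induction arbitrary: h f rule: Mul_induct)
    case (monomial c w)
    have "act H a h = (\<lambda>f. 0)" for h using a by (simp add: fun_eq_iff)
    then show ?case by (simp add: mult.assoc act_scal act_word_mult foldr_op_zero)
  qed (simp_all add: distrib_right act_add)
  have r: "act H (a * x) h f = 0" if x: "x \<in> Mul" and a: "\<And>h f. act H a h f = 0" for x a h f
    using x
  proof (induction arbitrary: h f rule: Mul_induct)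
    case (monomial c w)
    then show ?case by (simp add: scal_left_commute act_scal act_mult_word a)
  qed (simp_all add: distrib_left act_add)
  have z: "act H a h f = 0" if "a \<in> lpa_ideal E" for a h f
    using that unfolding lpa_ideal_def
  proof (induction arbitrary: h f rule: algebra_ideal_generated.induct)
    case (base a)
    then show ?case by (rule relations_act_zero[OF H])
  next
    case (lmult a x)
    then show ?case using l[of x a] Alg_Mul[of x] unfolding Alg_def by blast
  next
    case (rmult a x)
    then show ?case using r[of x a] Alg_Mul[of x] unfolding Alg_def by blast
  qed (simp_all add: act_add scale_conv_scal act_scal)
  show ?thesis
    unfolding lifted_ideal_def
  proof (intro conjI ballI)
    show "lpa_ideal E \<subseteq> kernel H"
      using z lifted_idealD(2)[OF lpa_ideal_lifted] unfolding kernel_def by blast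
  next
    fix a x assume "a \<in> kernel H" "x \<in> Mul"
    then show "x * a \<in> kernel H" "a * x \<in> kernel H"
      using l[of x a] r[of x a] unfolding kernel_def by auto
  qed (auto simp: kernel_def act_add)
qed

lemma ray_exists:
  assumes H: "hereditary E H" and v: "v \<in> verts E - H"
  shows "\<exists>f\<in>rays H. step_source (f 0) = v"
proof -
  \<comment> \<open>A ray is obtained by following one chosen step out of each vertex.\<close>
  define next_step where "next_step u =
    (if \<exists>e\<in>out_arcs E u. head E e \<notin> H then Inl (SOME e. e \<in> out_arcs E u \<and> head E e \<notin> H) else Inr u)" for u
  have ns: "next_step u \<in> steps H" "step_source (next_step u) = u" if "u \<in> verts E - H" for u
  proof -
    have "next_step u \<in> steps H \<and> step_source (next_step u) = u"
    proof (cases "\<exists>e\<in>out_arcs E u. head E e \<notin> H")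
      case True
      then have "(SOME e. e \<in> out_arcs E u \<and> head E e \<notin> H) \<in> out_arcs E u \<and> head E (SOME e. e \<in> out_arcs E u \<and> head E e \<notin> H) \<notin> H"
        by (intro someI_ex[of "\<lambda>e. e \<in> out_arcs E u \<and> head E e \<notin> H"]) blast
      then show ?thesis using True by (auto simp: next_step_def steps_def)
    next
      case False
      then show ?thesis using that by (auto simp: next_step_def steps_def)
    qed
    then show "next_step u \<in> steps H" "step_source (next_step u) = u" by auto
  qed
  define pos where "pos i = ((\<lambda>u. step_target (next_step u)) ^^ i) v" for i
  have pos: "pos i \<in> verts E - H" for i
    by (induction i) (use v ns(1) steps_source(2)[OF H] in \<open>auto simp: pos_def\<close>)
  have pos_Suc: "pos (Suc i) = step_target (next_step (pos i))" for i by (simp add: pos_def)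
  have "(\<lambda>i. next_step (pos i)) \<in> rays H"
    unfolding rays_def using ns(1)[OF pos] ns(2)[OF pos, of "Suc _"] by (simp add: pos_Suc)
  moreover have "step_source (next_step (pos 0)) = v" using ns(2)[OF v] by (simp add: pos_def)
  ultimately show ?thesis by (intro bexI[of _ "\<lambda>i. next_step (pos i)"]) simp_all
qed

lemma vertices_in_kernel:
  assumes H: "hereditary E H" "saturated E H"
  shows "vertices_in (kernel H) = H"
proof (intro Set.set_eqI iffI)
  fix v assume "v \<in> vertices_in (kernel H)"
  then have v: "v \<in> verts E" "act H (V v) (\<lambda>_. 1) f = 0" for f
    unfolding vertices_in_def kernel_def by blast+
  show "v \<in> H"
  proof (rule ccontr)
    assume "v \<notin> H"
    then obtain f where "f \<in> rays H" "step_source (f 0) = v" using ray_exists[OF H(1)] v(1) by blast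
    then show False using v(2)[of f] by (simp add: act_word)
  qed
next
  fix v assume v: "v \<in> H"
  then have vE: "v \<in> verts E" using H(1) unfolding hereditary_def by blast
  have "act H (V v) h f = 0" for h f
    using steps_source(1)[OF H(1) rays_steps, of f 0] v by (auto simp: act_word)
  then show "v \<in> vertices_in (kernel H)"
    using vE unfolding vertices_in_def kernel_def by blast
qed

text \<open>
  The set \<open>H\<^sub>0\<close> may be smaller than \<open>H\<close>, for the comparison of the ideals of two sets of vertices.
\<close>

lemma breaking_element_kernel:
  assumes H: "hereditary E H" and v: "v \<in> verts E"
    and fin: "finite {e \<in> out_arcs E v. head E e \<notin> H0}" and sub: "H0 \<subseteq> H"
    and ex: "v \<in> H \<or> (\<exists>e\<in>out_arcs E v. head E e \<notin> H)"
  shows "breaking_element H0 v \<in> kernel H"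
proof -
  have "act H (breaking_element H0 v) h f = 0" for h f
  proof -
    let ?D = "{e \<in> out_arcs E v. head E e \<notin> H0}"
    have s: "act H (breaking_element H0 v) h f = (if f \<in> rays H \<and> step_source (f 0) = v then h f else 0)
        - (\<Sum>e\<in>?D. if f \<in> rays H \<and> f 0 = Inl e then h f else 0)"
      unfolding breaking_element_def act_minus act_sum act_Edge_Ghost by (simp add: act_word)
    show ?thesis
    proof (cases "f \<in> rays H \<and> step_source (f 0) = v")
      case True
      then have "v \<notin> H" using steps_source(1)[OF H rays_steps, of f 0] by auto
      then have "\<exists>e\<in>out_arcs E v. head E e \<notin> H" using ex by blast
      then obtain e where e: "f 0 = Inl e" "e \<in> ?D"
        using True rays_steps[of f H 0] sub by (cases "f 0") (auto simp: steps_def)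
      have "(\<Sum>d\<in>?D. if f \<in> rays H \<and> f 0 = Inl d then h f else 0) = (\<Sum>d\<in>?D. if d = e then h f else 0)"
        by (rule sum.cong) (use True e(1) in auto)
      also have "\<dots> = h f" using fin e(2) by (simp only: sum.delta if_True)
      finally show ?thesis using s True by simp
    next
      case False
      then have "(\<Sum>d\<in>?D. if f \<in> rays H \<and> f 0 = Inl d then h f else 0) = 0"
        by (intro sum.neutral) auto
      then show ?thesis unfolding s if_not_P[OF False] by simp
    qed
  qed
  then show ?thesis using breaking_element_Alg[OF v] by (simp add: kernel_def)
qed

lemma foldr_Edges:
  "foldr (gen_op H) (map Edge p) h f =
     (if (p \<noteq> [] \<longrightarrow> f \<in> rays H) \<and> (\<forall>i<length p. f i = Inl (p ! i)) then h (\<lambda>i. f (i + length p)) else 0)"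
proof (induction p arbitrary: f)
  case (Cons e p)
  have "(\<forall>i<Suc (length p). f i = Inl ((e # p) ! i)) \<longleftrightarrow> f 0 = Inl e \<and> (\<forall>i<length p. f (Suc i) = Inl (p ! i))"
    by (auto simp: less_Suc_eq_0_disj)
  then show ?case using Cons.IH[of "\<lambda>i. f (Suc i)"] rays_shift[of f H] by auto
qed simp

text \<open>
  The unique ray from \<open>v\<close> is \<open>ccc...\<close>, which is unchanged by prefixing \<open>c\<close>.
\<close>

lemma closed_path_kernel:
  assumes H: "hereditary E H" and c: "closed_path E v c" and vH: "v \<notin> H"
    and uniq: "\<And>f f'. f \<in> rays H \<Longrightarrow> f' \<in> rays H \<Longrightarrow> step_source (f 0) = v \<Longrightarrow> step_source (f' 0) = v \<Longrightarrow> f = f'"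
  shows "V v - path v c \<in> kernel H"
proof -
  have cv: "awalk v c v" "c \<noteq> []" using c by (auto simp: closed_path_def)
  let ?n = "length c"
  define g where "g i = (Inl (c ! (i mod ?n)) :: 'e + 'v)" for i
  have n: "?n > 0" using cv by simp
  have arcs: "c ! i \<in> arcs E \<and> head E (c ! i) \<notin> H \<and> awalk (tail E (c ! i)) (drop i c) v" if "i < ?n" for i
  proof -
    have "awalk v (take i c @ drop i c) v" using cv by simp
    then obtain x where "awalk v (take i c) x" and x: "awalk x (drop i c) v" by (auto simp del: append_take_drop_id)
    have d: "drop i c = c ! i # drop (Suc i) c" using that by (simp add: Cons_nth_drop_Suc)
    from x have "c ! i \<in> arcs E" "tail E (c ! i) = x" "awalk (head E (c ! i)) (drop (Suc i) c) v"
      unfolding d by (auto simp: awalk_Cons_iff)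
    moreover then have "head E (c ! i) \<notin> H"
      using H vH unfolding hereditary_def connects_def by blast
    ultimately show ?thesis using x by simp
  qed
  have link: "head E (c ! i) = (if Suc i < ?n then tail E (c ! Suc i) else v)" if "i < ?n" for i
  proof -
    have d: "drop i c = c ! i # drop (Suc i) c" using that by (simp add: Cons_nth_drop_Suc)
    have w: "awalk (head E (c ! i)) (drop (Suc i) c) v" using arcs[OF that] unfolding d by (auto simp: awalk_Cons_iff)
    show ?thesis
    proof (cases "Suc i < ?n")
      case True
      then have "drop (Suc i) c = c ! Suc i # drop (Suc (Suc i)) c" by (simp add: Cons_nth_drop_Suc)
      then show ?thesis using w True by (auto simp: awalk_Cons_iff)
    next
      case False
      then show ?thesis using w by (auto simp: awalk_Nil_iff)
    qed
  qed
  have t0: "tail E (c ! 0) = v" using cv by (cases c) (auto simp: awalk_Cons_iff)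
  have gr: "g \<in> rays H"
    unfolding rays_def
  proof (intro CollectI allI conjI)
    fix i
    have i: "i mod ?n < ?n" using n by simp
    show "g i \<in> steps H" using arcs[OF i] by (simp add: g_def steps_def)
    show "step_target (g i) = step_source (g (Suc i))"
      using link[OF i] t0 i by (auto simp: g_def mod_Suc)
  qed
  have g0: "step_source (g 0) = v" using t0 by (simp add: g_def)
  have "act H (V v - path v c) h f = 0" for h f
  proof (cases "f \<in> rays H \<and> step_source (f 0) = v")
    case True
    then have f: "f = g" using uniq gr g0 by blast
    have "(\<lambda>i. g (i + ?n)) = g" by (simp add: g_def fun_eq_iff)
    moreover have "\<forall>i<?n. g i = Inl (c ! i)" by (simp add: g_def)
    ultimately show ?thesis
      unfolding f path_def act_minus act_word using gr g0 by (simp add: foldr_Edges)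
  next
    case False
    then show ?thesis unfolding path_def act_minus act_word by auto
  qed
  moreover have "V v - path v c \<in> Alg" using cv by auto
  ultimately show ?thesis by (simp add: kernel_def)
qed

end

section \<open>Ideals of the Leavitt path algebra and their preimages\<close>

context leavitt
begin

abbreviation "L \<equiv> leavitt_path_algebra K E"

abbreviation cls :: "(('v, 'e) lpa_gen list \<Rightarrow>\<^sub>0 'k) \<Rightarrow> (('v, 'e) lpa_gen list \<Rightarrow>\<^sub>0 'k) set" where
  "cls \<equiv> lpa_class E"

interpretation N: leavitt_ideal E K "lpa_ideal E"
  by unfold_locales (rule lpa_ideal_lifted)

lemma cls_alt: "cls a = (\<lambda>h. h + a) ` lpa_ideal E"
  unfolding lpa_class_def a_r_coset_def r_coset_def free_algebra_def by auto

lemma mem_cls_iff: "b \<in> cls a \<longleftrightarrow> N.cong b a"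
proof
  assume "N.cong b a"
  then have "(b - a) + a \<in> cls a" unfolding cls_alt N.cong_def by blast
  then show "b \<in> cls a" by simp
qed (auto simp: cls_alt N.cong_def)

lemma cls_eq_iff: "cls a = cls b \<longleftrightarrow> N.cong a b"
proof
  assume "cls a = cls b"
  then show "N.cong a b" using mem_cls_iff[of a a] mem_cls_iff[of a b] by simp
next
  assume "N.cong a b"
  then show "cls a = cls b"
    using N.cong_trans N.cong_sym by (intro Set.set_eqI) (metis mem_cls_iff)
qed

lemma cls_eqI: "N.cong a b \<Longrightarrow> cls a = cls b" by (simp add: cls_eq_iff)

lemma L_sel:
  "carrier L = cls ` Alg" "zero L = cls 0" "add L = set_add (free_algebra (lpa_gens E))"
  "mult L = rcoset_mult (free_algebra (lpa_gens E)) (lpa_ideal E)"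
  "smult L = (\<lambda>c X. \<Union>a\<in>X. cls (scale c a))"
proof -
  show "carrier L = cls ` Alg"
    unfolding leavitt_path_algebra_def Let_def FactRing_def A_RCOSETS_def RCOSETS_def Alg_def
      lpa_class_def a_r_coset_def by auto
  show "zero L = cls 0"
    unfolding cls_alt by (simp add: leavitt_path_algebra_def Let_def FactRing_def)
qed (simp_all add: leavitt_path_algebra_def Let_def FactRing_def)

lemma cls_add: "cls a \<oplus>\<^bsub>L\<^esub> cls b = cls (a + b)"
proof (intro Set.set_eqI iffI)
  fix x assume "x \<in> cls a \<oplus>\<^bsub>L\<^esub> cls b"
  then obtain y z where "x = y + z" "y \<in> cls a" "z \<in> cls b"
    by (auto simp: L_sel set_add_def set_mult_def free_algebra_def)
  then show "x \<in> cls (a + b)" by (simp add: mem_cls_iff N.cong_add)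
next
  fix x assume "x \<in> cls (a + b)"
  then have "x - b \<in> cls a" by (simp add: mem_cls_iff N.cong_def algebra_simps)
  moreover have "b \<in> cls b" by (simp add: mem_cls_iff)
  moreover have "x = (x - b) + b" by simp
  ultimately have "\<exists>y\<in>cls a. \<exists>z\<in>cls b. x = y + z" by blast
  then show "x \<in> cls a \<oplus>\<^bsub>L\<^esub> cls b"
    unfolding L_sel set_add_def set_mult_def free_algebra_def by auto
qed

lemma cls_mult:
  assumes "a \<in> Alg" "b \<in> Alg"
  shows "cls a \<otimes>\<^bsub>L\<^esub> cls b = cls (a * b)"
proof -
  have "cls (x * y) = cls (a * b)" if "x \<in> cls a" "y \<in> cls b" for x y
  proof (rule cls_eqI)
    have xa: "N.cong x a" and yb: "N.cong y b" using that by (auto simp: mem_cls_iff)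
    have "(x - a) + a \<in> Alg" using xa assms(1) N.J_Alg by (intro Alg_intros) (auto simp: N.cong_def)
    then have "x \<in> Mul" using Alg_Mul by simp
    then show "N.cong (x * y) (a * b)" using xa yb assms Alg_Mul by (intro N.cong_mult) auto
  qed
  moreover have "a \<in> cls a" "b \<in> cls b" by (auto simp: mem_cls_iff)
  moreover have "cls a \<otimes>\<^bsub>L\<^esub> cls b = (\<Union>x\<in>cls a. \<Union>y\<in>cls b. cls (x * y))"
    unfolding L_sel rcoset_mult_def lpa_class_def by (simp add: free_algebra_def)
  ultimately show ?thesis by blast
qed

lemma cls_smult: "c \<odot>\<^bsub>L\<^esub> cls a = cls (scal c * a)"
proof -
  have "cls (scale c x) = cls (scal c * a)" if "x \<in> cls a" for x
    unfolding scale_conv_scal using that by (intro cls_eqI N.cong_scal) (simp add: mem_cls_iff)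
  moreover have "a \<in> cls a" by (simp add: mem_cls_iff)
  ultimately show ?thesis unfolding L_sel by auto
qed

lemma abelian_group_L: "abelian_group L"
proof (rule abelian_groupI)
  fix x assume "x \<in> carrier L"
  then obtain a where a: "x = cls a" "a \<in> Alg" by (auto simp: L_sel)
  have "cls (- a) \<oplus>\<^bsub>L\<^esub> x = \<zero>\<^bsub>L\<^esub>" unfolding a cls_add by (simp add: L_sel)
  then show "\<exists>y\<in>carrier L. y \<oplus>\<^bsub>L\<^esub> x = \<zero>\<^bsub>L\<^esub>" using a by (auto simp: L_sel)
qed (auto simp: L_sel(1,2) cls_add ac_simps)

interpretation L: abelian_group L by (rule abelian_group_L)

lemma L_minus: "a \<in> Alg \<Longrightarrow> \<ominus>\<^bsub>L\<^esub> cls a = cls (- a)"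
  by (rule L.minus_equality) (auto simp: L_sel(1,2) cls_add)

lemma finsum_cls:
  assumes "finite S" "\<And>i. i \<in> S \<Longrightarrow> f i = cls (b i)" "\<And>i. i \<in> S \<Longrightarrow> b i \<in> Alg"
  shows "finsum L f S = cls (\<Sum>i\<in>S. b i)"
  using assms
proof (induction S)
  case empty
  then show ?case by (simp add: L_sel)
next
  case (insert i S)
  have "finsum L f (insert i S) = f i \<oplus>\<^bsub>L\<^esub> finsum L f S"
    using insert by (intro L.finsum_insert) (auto simp: L_sel(1))
  then show ?case using insert by (simp add: cls_add)
qed

definition lift_ideal :: "(('v, 'e) lpa_gen list \<Rightarrow>\<^sub>0 'k) set set \<Rightarrow> (('v, 'e) lpa_gen list \<Rightarrow>\<^sub>0 'k) set" where
  "lift_ideal I = {a \<in> Alg. cls a \<in> I}"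

text \<open>
  Ideals of the quotient are not assumed to be subspaces.  If \<open>\<Sum> v\<close> is a local unit for \<open>a\<close>, then \<open>k a\<close> is
  congruent to the product of \<open>a\<close> with \<open>\<Sum> k v\<close>.
\<close>

lemma lift_ideal_props:
  assumes I: "two_sided_ideal L I"
  shows "lifted_ideal (lift_ideal I)" "cls ` lift_ideal I = I"
proof -
  have sub: "subgroup I (add_monoid L)" and lr: "\<And>a x. a \<in> I \<Longrightarrow> x \<in> carrier L \<Longrightarrow> x \<otimes>\<^bsub>L\<^esub> a \<in> I \<and> a \<otimes>\<^bsub>L\<^esub> x \<in> I"
    using I unfolding two_sided_ideal_def additive_subgroup_def by auto
  have IL: "I \<subseteq> carrier L" using subgroup.subset[OF sub] by simp
  have Iadd: "a \<in> I \<Longrightarrow> b \<in> I \<Longrightarrow> a \<oplus>\<^bsub>L\<^esub> b \<in> I" for a b using subgroup.m_closed[OF sub] by simp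
  have I0: "cls 0 \<in> I" using subgroup.one_closed[OF sub] by (simp add: L_sel)
  show "cls ` lift_ideal I = I" using IL unfolding lift_ideal_def L_sel by auto
  have congI: "a \<in> lift_ideal I" if "N.cong a b" "b \<in> lift_ideal I" for a b
  proof -
    have "(a - b) + b \<in> Alg" using that N.J_Alg by (intro Alg_intros) (auto simp: N.cong_def lift_ideal_def)
    then show ?thesis using that cls_eqI[OF that(1)] by (simp add: lift_ideal_def)
  qed
  have add: "a + b \<in> lift_ideal I" if "a \<in> lift_ideal I" "b \<in> lift_ideal I" for a b
    using that Iadd[of "cls a" "cls b"] by (auto simp: lift_ideal_def cls_add)
  have alg: "x * a \<in> lift_ideal I" "a * x \<in> lift_ideal I" if "a \<in> lift_ideal I" "x \<in> Alg" for a x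
    using that lr[of "cls a" "cls x"] Alg_Mul by (auto simp: lift_ideal_def cls_mult L_sel(1))
  have scal: "scal c * a \<in> lift_ideal I" if a: "a \<in> lift_ideal I" for a c
  proof -
    have "a \<in> Alg" using a by (simp add: lift_ideal_def)
    then obtain F where F: "finite F" "F \<subseteq> verts E" "N.cong a (\<Sum>v\<in>F. a * V v)"
      using N.local_unit by blast
    have "N.cong (scal c * a) (scal c * (\<Sum>v\<in>F. a * V v))" by (rule N.cong_scal[OF F(3)])
    moreover have "scal c * (\<Sum>v\<in>F. a * V v) = (\<Sum>v\<in>F. a * (scal c * V v))"
      by (simp add: sum_distrib_left scal_left_commute)
    moreover have "(\<Sum>v\<in>F. a * (scal c * V v)) \<in> lift_ideal I"
      using F(1,2)
    proof (induction F)
      case empty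
      then show ?case using I0 by (simp add: lift_ideal_def)
    next
      case (insert v F)
      then show ?case using add alg(2)[OF a, of "scal c * V v"] by auto
    qed
    ultimately show ?thesis using congI by metis
  qed
  have word: "word w * a \<in> lift_ideal I \<and> a * word w \<in> lift_ideal I"
    if "a \<in> lift_ideal I" "w \<in> lists (lpa_gens E)" for a w
    using that alg[of a "word w"] by (cases "w = []") (auto simp: word_Nil Alg_word)
  have mul: "x * a \<in> lift_ideal I \<and> a * x \<in> lift_ideal I" if a: "a \<in> lift_ideal I" and "x \<in> Mul" for a x
    using that(2)
  proof (induction rule: Mul_induct)
    case zero
    then show ?case using I0 by (simp add: lift_ideal_def)
  next
    case (add x y)
    then show ?case using \<open>\<And>b a. a \<in> lift_ideal I \<Longrightarrow> b \<in> lift_ideal I \<Longrightarrow> a + b \<in> lift_ideal I\<close>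
      by (simp add: distrib_left distrib_right)
  next
    case (monomial c w)
    then show ?case using word[OF a] scal by (simp add: mult.assoc scal_left_commute)
  qed
  have "lpa_ideal E \<subseteq> lift_ideal I"
  proof
    fix a :: "('v, 'e) lpa_gen list \<Rightarrow>\<^sub>0 'k" assume a: "a \<in> lpa_ideal E"
    have "0 \<in> lift_ideal I" using I0 by (simp add: lift_ideal_def)
    then show "a \<in> lift_ideal I" using congI[of a 0] a by (simp add: N.cong_def)
  qed
  then show "lifted_ideal (lift_ideal I)"
    unfolding lifted_ideal_def using add mul by (auto simp: lift_ideal_def)
qed

lemma cls_mem_image:
  assumes J: "lifted_ideal J"
  shows "cls a \<in> cls ` J \<longleftrightarrow> a \<in> J"
proof
  assume "cls a \<in> cls ` J"
  then obtain b where b: "b \<in> J" "N.cong a b" by (auto simp: cls_eq_iff)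
  then have "a - b \<in> J" using lifted_idealD(1)[OF J] unfolding N.cong_def by blast
  from lifted_idealD(3)[OF J this b(1)] show "a \<in> J" by simp
qed auto

lemma lift_ideal_image: "lifted_ideal J \<Longrightarrow> lift_ideal (cls ` J) = J"
  unfolding lift_ideal_def using cls_mem_image lifted_idealD(2) by blast

lemma image_ideal:
  assumes J: "lifted_ideal J"
  shows "two_sided_ideal L (cls ` J)"
  unfolding two_sided_ideal_def
proof (intro conjI ballI)
  interpret J: leavitt_ideal E K J using J by unfold_locales
  show "additive_subgroup (cls ` J) L"
  proof (intro additive_subgroup.intro subgroup.intro)
    show "cls ` J \<subseteq> carrier (add_monoid L)" using J.J_Alg by (auto simp: L_sel(1))
    show "\<one>\<^bsub>add_monoid L\<^esub> \<in> cls ` J" using J.J_zero by (auto simp: L_sel)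
    fix x y assume x: "x \<in> cls ` J" and y: "y \<in> cls ` J"
    show "x \<otimes>\<^bsub>add_monoid L\<^esub> y \<in> cls ` J" using x y J.J_add by (auto simp: cls_add)
    obtain a where a: "x = cls a" "a \<in> J" using x by auto
    have "inv\<^bsub>add_monoid L\<^esub> x = cls (- a)"
      using L_minus[OF J.J_Alg[OF a(2)]] unfolding a_inv_def a(1) .
    then show "inv\<^bsub>add_monoid L\<^esub> x \<in> cls ` J" using J.J_uminus[OF a(2)] by auto
  qed
  fix x y assume "x \<in> cls ` J" "y \<in> carrier L"
  then obtain a b where "x = cls a" "a \<in> J" "y = cls b" "b \<in> Alg" by (auto simp: L_sel(1))
  then show "y \<otimes>\<^bsub>L\<^esub> x \<in> cls ` J" "x \<otimes>\<^bsub>L\<^esub> y \<in> cls ` J"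
    using J.J_lmult[of a b] J.J_rmult[of a b] J.J_Alg Alg_Mul by (auto simp: cls_mult)
qed

lemma ideal_iff_image: "two_sided_ideal L I \<longleftrightarrow> (\<exists>J. lifted_ideal J \<and> I = cls ` J)"
  using image_ideal lift_ideal_props by metis

lemma cls_image_subset_iff:
  assumes "lifted_ideal A" "lifted_ideal B"
  shows "cls ` A \<subseteq> cls ` B \<longleftrightarrow> A \<subseteq> B"
  using cls_mem_image[OF assms(2)] by blast

lemma cls_image_psubset_iff:
  assumes "lifted_ideal A" "lifted_ideal B"
  shows "cls ` A \<subset> cls ` B \<longleftrightarrow> A \<subset> B"
  by (simp only: less_le_not_le cls_image_subset_iff[OF assms] cls_image_subset_iff[OF assms(2,1)])

lemma Alg_lifted: "lifted_ideal Alg"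
  unfolding lifted_ideal_def using lifted_idealD(2)[OF lpa_ideal_lifted] by auto

lemma image_carrier_iff:
  assumes "lifted_ideal A"
  shows "cls ` A = carrier L \<longleftrightarrow> A = Alg"
  by (simp only: L_sel(1) set_eq_subset cls_image_subset_iff[OF assms Alg_lifted]
      cls_image_subset_iff[OF Alg_lifted assms])

lemma prime_ideal_iff:
  assumes J: "lifted_ideal J"
  shows "prime_ideal L (cls ` J) \<longleftrightarrow> prime_lifted J"
proof -
  have prod: "ideal_prod L (cls ` A) (cls ` B) \<subseteq> cls ` J \<longleftrightarrow> (\<forall>a\<in>A. \<forall>b\<in>B. a * b \<in> J)"
    if A: "lifted_ideal A" and B: "lifted_ideal B" for A B
  proof -
    have m: "cls a \<otimes>\<^bsub>L\<^esub> cls b \<in> cls ` J \<longleftrightarrow> a * b \<in> J" if "a \<in> A" "b \<in> B" for a b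
    proof -
      have ab: "a \<in> Alg" "b \<in> Alg" using that lifted_idealD(2)[OF A] lifted_idealD(2)[OF B] by blast+
      show ?thesis by (simp only: cls_mult[OF ab] cls_mem_image[OF J])
    qed
    show ?thesis
    proof
      assume sub: "ideal_prod L (cls ` A) (cls ` B) \<subseteq> cls ` J"
      show "\<forall>a\<in>A. \<forall>b\<in>B. a * b \<in> J"
      proof (intro ballI)
        fix a b assume ab: "a \<in> A" "b \<in> B"
        then have "cls a \<otimes>\<^bsub>L\<^esub> cls b \<in> ideal_prod L (cls ` A) (cls ` B)" by (intro ideal_prod.prod imageI)
        then show "a * b \<in> J" using sub m[OF ab] by blast
      qed
    next
      assume AB: "\<forall>a\<in>A. \<forall>b\<in>B. a * b \<in> J"
      show "ideal_prod L (cls ` A) (cls ` B) \<subseteq> cls ` J"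
      proof
        fix x assume "x \<in> ideal_prod L (cls ` A) (cls ` B)"
        then show "x \<in> cls ` J"
        proof (induction rule: ideal_prod.induct)
          case (prod i j)
          then show ?case using m AB by auto
        next
          case (sum s1 s2)
          then show ?case using lifted_idealD(3)[OF J] by (auto simp: cls_add)
        qed
      qed
    qed
  qed
  have proper: "proper_ideal L (cls ` J) \<longleftrightarrow> J \<noteq> Alg"
    using image_ideal[OF J] image_carrier_iff[OF J] by (simp add: proper_ideal_def)
  show ?thesis
  proof
    assume p: "prime_ideal L (cls ` J)"
    have "A \<subseteq> J \<or> B \<subseteq> J" if A: "lifted_ideal A" and B: "lifted_ideal B" and "\<forall>a\<in>A. \<forall>b\<in>B. a * b \<in> J" for A B
    proof -
      have "ideal_prod L (cls ` A) (cls ` B) \<subseteq> cls ` J" using prod[OF A B] that(3) by blast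
      then have "cls ` A \<subseteq> cls ` J \<or> cls ` B \<subseteq> cls ` J"
        using p image_ideal[OF A] image_ideal[OF B] unfolding prime_ideal_def by blast
      then show ?thesis by (simp only: cls_image_subset_iff[OF A J] cls_image_subset_iff[OF B J])
    qed
    then show "prime_lifted J" using p J proper unfolding prime_ideal_def prime_lifted_def by blast
  next
    assume p: "prime_lifted J"
    have "A \<subseteq> cls ` J \<or> B \<subseteq> cls ` J"
      if t: "two_sided_ideal L A" "two_sided_ideal L B" and AB: "ideal_prod L A B \<subseteq> cls ` J" for A B
    proof -
      obtain A' where A: "lifted_ideal A'" "A = cls ` A'" using t(1) unfolding ideal_iff_image by blast
      obtain B' where B: "lifted_ideal B'" "B = cls ` B'" using t(2) unfolding ideal_iff_image by blast
      have "\<forall>a\<in>A'. \<forall>b\<in>B'. a * b \<in> J" using prod[OF A(1) B(1)] AB unfolding A(2) B(2) by blast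
      then have "A' \<subseteq> J \<or> B' \<subseteq> J" using p A(1) B(1) unfolding prime_lifted_def by blast
      then show ?thesis unfolding A(2) B(2) by blast
    qed
    then show "prime_ideal L (cls ` J)"
      using p proper unfolding prime_ideal_def prime_lifted_def by blast
  qed
qed

text \<open>
  The element \<open>x\<close> witnesses that the ideals properly above \<open>J\<close> do not intersect in \<open>J\<close>.
\<close>

definition completely_irreducible_lifted :: "(('v, 'e) lpa_gen list \<Rightarrow>\<^sub>0 'k) set \<Rightarrow> bool" where
  "completely_irreducible_lifted J \<longleftrightarrow> lifted_ideal J \<and>
     (\<exists>x\<in>Alg. x \<notin> J \<and> (\<forall>A. lifted_ideal A \<longrightarrow> J \<subset> A \<longrightarrow> x \<in> A))"

lemma completely_irreducible_iff:
  assumes J: "lifted_ideal J"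
  shows "completely_irreducible_ideal L (cls ` J) \<longleftrightarrow> completely_irreducible_lifted J"
proof
  assume c: "completely_irreducible_ideal L (cls ` J)"
  define \<A> where "\<A> = {A. two_sided_ideal L A \<and> cls ` J \<subset> A}"
  have "J \<subset> Alg" using c image_carrier_iff[OF J] lifted_idealD(2)[OF J]
    by (auto simp: completely_irreducible_ideal_def proper_ideal_def)
  then have "cls ` Alg \<in> \<A>"
    using image_ideal[OF Alg_lifted] cls_image_psubset_iff[OF J Alg_lifted] by (simp add: \<A>_def)
  have nonempty: "\<A> \<noteq> {}" using \<open>cls ` Alg \<in> \<A>\<close> by force
  have above: "\<forall>A\<in>\<A>. two_sided_ideal L A \<and> cls ` J \<subset> A" unfolding \<A>_def by (rule ballI, drule CollectD)
  have "cls ` J \<noteq> \<Inter>\<A>"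
  proof
    assume "cls ` J = \<Inter>\<A>"
    with nonempty above have "\<exists>\<A>. \<A> \<noteq> {} \<and> (\<forall>A\<in>\<A>. two_sided_ideal L A \<and> cls ` J \<subset> A) \<and> cls ` J = \<Inter>\<A>"
      by (intro exI[of _ \<A>] conjI)
    then show False using c unfolding completely_irreducible_ideal_def by (elim conjE notE)
  qed
  moreover have "cls ` J \<subseteq> \<Inter>\<A>"
    by (rule Inter_greatest) (rule psubset_imp_subset[OF conjunct2[OF bspec[OF above]]])
  ultimately have "cls ` J \<subset> \<Inter>\<A>" by (intro psubsetI)
  then obtain X where X: "X \<in> \<Inter>\<A>" "X \<notin> cls ` J" using psubset_imp_ex_mem by (auto simp only: Diff_iff)
  from X(1) \<open>cls ` Alg \<in> \<A>\<close> have "X \<in> cls ` Alg" by (rule InterD)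
  then obtain x where x: "X = cls x" "x \<in> Alg" by (elim imageE)
  have "x \<in> A" if "lifted_ideal A" "J \<subset> A" for A
  proof -
    have "cls ` A \<in> \<A>" using that image_ideal cls_image_psubset_iff[OF J] by (simp add: \<A>_def)
    from InterD[OF X(1) this] show ?thesis unfolding x(1) cls_mem_image[OF that(1)] .
  qed
  then show "completely_irreducible_lifted J"
    using J x X unfolding completely_irreducible_lifted_def by blast
next
  assume "completely_irreducible_lifted J"
  then obtain x where x: "x \<in> Alg" "x \<notin> J" "\<And>A. lifted_ideal A \<Longrightarrow> J \<subset> A \<Longrightarrow> x \<in> A"
    unfolding completely_irreducible_lifted_def by blast
  have xJ: "cls x \<notin> cls ` J" using x cls_mem_image[OF J] by blast
  have up: "cls x \<in> A" if A: "two_sided_ideal L A" "cls ` J \<subset> A" for A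
  proof -
    obtain B where B: "lifted_ideal B" "A = cls ` B" using A(1) unfolding ideal_iff_image by blast
    have "J \<subset> B" using A(2) unfolding B(2) cls_image_psubset_iff[OF J B(1)] .
    then show ?thesis unfolding B(2) using x(3)[OF B(1)] by (intro imageI)
  qed
  have "J \<noteq> Alg" using x by blast
  then have proper: "proper_ideal L (cls ` J)"
    using image_ideal[OF J] image_carrier_iff[OF J] by (simp add: proper_ideal_def)
  show "completely_irreducible_ideal L (cls ` J)"
    unfolding completely_irreducible_ideal_def
  proof (intro conjI notI proper)
    assume "\<exists>\<A>. \<A> \<noteq> {} \<and> (\<forall>A\<in>\<A>. two_sided_ideal L A \<and> cls ` J \<subset> A) \<and> cls ` J = \<Inter>\<A>"
    then obtain \<A> where A: "\<forall>A\<in>\<A>. two_sided_ideal L A \<and> cls ` J \<subset> A" and eq: "cls ` J = \<Inter>\<A>"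
      by (elim exE conjE) (rule that)
    have "cls x \<in> \<Inter>\<A>"
    proof (rule InterI)
      fix B assume "B \<in> \<A>"
      with A have "two_sided_ideal L B \<and> cls ` J \<subset> B" by (rule bspec)
      then show "cls x \<in> B" using up by simp
    qed
    then show False using xJ eq by simp
  qed
qed

definition irreducible_lifted :: "(('v, 'e) lpa_gen list \<Rightarrow>\<^sub>0 'k) set \<Rightarrow> bool" where
  "irreducible_lifted J \<longleftrightarrow> lifted_ideal J \<and> J \<noteq> Alg \<and>
     (\<forall>A B. lifted_ideal A \<longrightarrow> lifted_ideal B \<longrightarrow> J \<subset> A \<longrightarrow> J \<subset> B \<longrightarrow> J \<noteq> A \<inter> B)"

lemma irreducible_iff:
  assumes J: "lifted_ideal J"
  shows "irreducible_ideal L (cls ` J) \<longleftrightarrow> irreducible_lifted J"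
proof -
  have int: "cls ` J = cls ` A \<inter> cls ` B \<longleftrightarrow> J = A \<inter> B" if "lifted_ideal A" "lifted_ideal B" for A B
  proof -
    have "cls ` A \<inter> cls ` B = cls ` (A \<inter> B)"
      using cls_mem_image[OF that(1)] cls_mem_image[OF that(2)] by blast
    moreover have "lift_ideal (cls ` (A \<inter> B)) = A \<inter> B"
    proof -
      have "lifted_ideal (A \<inter> B)" using that unfolding lifted_ideal_def by blast
      then show ?thesis by (rule lift_ideal_image)
    qed
    ultimately show ?thesis using lift_ideal_image[OF J] by metis
  qed
  have proper: "proper_ideal L (cls ` J) \<longleftrightarrow> J \<noteq> Alg"
    using image_ideal[OF J] image_carrier_iff[OF J] by (simp add: proper_ideal_def)
  show ?thesis
  proof
    assume irr: "irreducible_ideal L (cls ` J)"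
    have "J \<noteq> A \<inter> B" if A: "lifted_ideal A" "J \<subset> A" and B: "lifted_ideal B" "J \<subset> B" for A B
    proof
      assume "J = A \<inter> B"
      then have eq: "cls ` J = cls ` A \<inter> cls ` B" using int[OF A(1) B(1)] by simp
      have "cls ` J \<subset> cls ` A" "cls ` J \<subset> cls ` B"
        unfolding cls_image_psubset_iff[OF J A(1)] cls_image_psubset_iff[OF J B(1)] by (fact A B)+
      with image_ideal[OF A(1)] image_ideal[OF B(1)] eq
      have "\<exists>A B. two_sided_ideal L A \<and> two_sided_ideal L B \<and> cls ` J \<subset> A \<and> cls ` J \<subset> B \<and> cls ` J = A \<inter> B"
        by (intro exI conjI)
      then show False using irr unfolding irreducible_ideal_def by (elim conjE notE)
    qed
    moreover have "J \<noteq> Alg" using irr proper unfolding irreducible_ideal_def by (elim conjE) simp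
    ultimately show "irreducible_lifted J" using J unfolding irreducible_lifted_def by simp
  next
    assume irr: "irreducible_lifted J"
    show "irreducible_ideal L (cls ` J)"
      unfolding irreducible_ideal_def
    proof (intro conjI notI)
      show "proper_ideal L (cls ` J)" using irr proper by (simp add: irreducible_lifted_def)
      assume "\<exists>A B. two_sided_ideal L A \<and> two_sided_ideal L B \<and> cls ` J \<subset> A \<and> cls ` J \<subset> B \<and> cls ` J = A \<inter> B"
      then obtain A B where t: "two_sided_ideal L A" "two_sided_ideal L B"
        and AB: "cls ` J \<subset> A" "cls ` J \<subset> B" "cls ` J = A \<inter> B" by (elim exE conjE) (rule that)
      obtain A' where A: "lifted_ideal A'" "A = cls ` A'" using t(1) unfolding ideal_iff_image by blast
      obtain B' where B: "lifted_ideal B'" "B = cls ` B'" using t(2) unfolding ideal_iff_image by blast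
      have "J \<subset> A'" "J \<subset> B'" "J = A' \<inter> B'"
        using AB unfolding A(2) B(2) cls_image_psubset_iff[OF J A(1)] cls_image_psubset_iff[OF J B(1)] int[OF A(1) B(1)]
        by - assumption+
      then show False using irr A(1) B(1) unfolding irreducible_lifted_def by blast
    qed
  qed
qed

lemma word_path_word: "awalk u p v \<Longrightarrow> N.cong (word (path_word u p)) (path u p)"
proof (cases p)
  case (Cons e q)
  assume "awalk u p v"
  then have e: "e \<in> arcs E" "tail E e = u" and q: "set q \<subseteq> arcs E" using Cons N.awalk_ConsD[of u e q v] by auto
  have "N.cong (V (tail E e) * Ed e * word (map Edge q)) (Ed e * word (map Edge q))"
    by (rule N.cong_rmult[OF N.V_Ed[OF e(1)] N.Edges_Mul(1)[OF q]])
  moreover have "path u p = V (tail E e) * Ed e * word (map Edge q)"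
    unfolding N.path_alt Cons N.word_map_Edge_Cons e(2) by (simp add: mult.assoc)
  moreover have "word (path_word u p) = Ed e * word (map Edge q)"
    unfolding Cons path_word.simps by (rule N.word_map_Edge_Cons)
  ultimately show ?thesis by (simp only: N.cong_sym)
qed (simp add: path_def)

lemma word_ghost_path_word: "awalk u p v \<Longrightarrow> N.cong (word (ghost_path_word u p)) (ghost u p)"
proof (cases p)
  case (Cons e q)
  assume "awalk u p v"
  then have e: "e \<in> arcs E" "tail E e = u" and q: "set (rev q) \<subseteq> arcs E" using Cons N.awalk_ConsD[of u e q v] by auto
  have "N.cong (word (map Ghost (rev q)) * (Gh e * V (tail E e))) (word (map Ghost (rev q)) * Gh e)"
    by (rule N.cong_lmult[OF N.Gh_V[OF e(1)] N.Edges_Mul(2)[OF q]])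
  moreover have "ghost u p = word (map Ghost (rev q)) * (Gh e * V (tail E e))"
    unfolding N.ghost_alt Cons e(2) by (simp add: word_append mult.assoc)
  moreover have "word (ghost_path_word u p) = word (map Ghost (rev q)) * Gh e"
    unfolding Cons by (simp add: word_append)
  ultimately show ?thesis by (simp only: N.cong_sym)
qed (simp add: ghost_def)

lemma lpa_component_subset: "lpa_component K E n \<subseteq> cls ` {a \<in> Alg. homogeneous n a}"
proof
  fix x assume "x \<in> lpa_component K E n"
  then show "x \<in> cls ` {a \<in> Alg. homogeneous n a}"
  proof (induction rule: lpa_component.induct)
    case zero
    then show ?case using homogeneous_zero by (auto simp: L_sel)
  next
    case (step x u p u' v q v' c)
    obtain a where a: "x = cls a" "a \<in> Alg" "homogeneous n a" using step by auto
    have Alg: "path u p \<in> Alg" "ghost v q \<in> Alg" using step by auto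
    have "cls (word (path_word u p)) = cls (path u p)" "cls (word (ghost_path_word v q)) = cls (ghost v q)"
      using step cls_eqI word_path_word word_ghost_path_word by blast+
    then have "c \<odot>\<^bsub>L\<^esub> (cls (word (path_word u p)) \<otimes>\<^bsub>L\<^esub> cls (word (ghost_path_word v q))) \<oplus>\<^bsub>L\<^esub> x
        = cls (scal c * (path u p * ghost v q) + a)"
      using Alg a by (simp add: cls_mult cls_smult cls_add)
    moreover have "homogeneous n (scal c * (path u p * ghost v q) + a)"
      using homogeneous_mult[OF homogeneous_path[of p u] homogeneous_ghost[of q v]] step a
      by (intro homogeneous_add homogeneous_scal) auto
    moreover have "scal c * (path u p * ghost v q) + a \<in> Alg" using Alg a Alg_Mul by auto
    ultimately show ?case by auto
  qed
qed

lemma lpa_component_add: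
  assumes "x \<in> lpa_component K E n" and y: "y \<in> lpa_component K E n"
  shows "x \<oplus>\<^bsub>L\<^esub> y \<in> lpa_component K E n"
proof -
  obtain b where b: "y = cls b" using lpa_component_subset y by blast
  show ?thesis
    using assms(1)
  proof (induction rule: lpa_component.induct)
    case zero
    then show ?case using y by (simp add: L_sel(2) b cls_add)
  next
    case (step x u p u' v q v' c)
    obtain a where a: "x = cls a" using lpa_component_subset step(1) by blast
    have "word (path_word u p) \<in> Alg" using step(2) by (cases p) (auto simp: Alg_word awalk_def subset_iff)
    moreover have "word (ghost_path_word v q) \<in> Alg"
      using step(3) by (cases q) (auto simp: Alg_word awalk_def subset_iff)
    ultimately obtain m where m: "c \<odot>\<^bsub>L\<^esub> (cls (word (path_word u p)) \<otimes>\<^bsub>L\<^esub> cls (word (ghost_path_word v q))) = cls m"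
      by (simp add: cls_mult cls_smult)
    have "cls m \<oplus>\<^bsub>L\<^esub> (x \<oplus>\<^bsub>L\<^esub> y) \<in> lpa_component K E n"
      using lpa_component.step[OF step.IH step(2-4), of c] unfolding m .
    then show ?case unfolding m a b cls_add by (simp only: add.assoc)
  qed
qed

lemma lpa_component_eq: "lpa_component K E n = cls ` {a \<in> Alg. homogeneous n a}"
proof (intro equalityI lpa_component_subset subsetI)
  fix x assume "x \<in> cls ` {a \<in> Alg. homogeneous n a}"
  then obtain a where a: "x = cls a" "a \<in> Alg" "homogeneous n a" by auto
  then have "supp a \<subseteq> {w \<in> lists (lpa_gens E). w \<noteq> [] \<and> word_degree w = n}"
    unfolding homogeneous_def Alg_def free_algebra_def by auto
  then have "cls a \<in> lpa_component K E n"
  proof (induction rule: keys_subset_induct)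
    case zero
    then show ?case using lpa_component.zero[of K E n] by (simp add: L_sel)
  next
    case (add a b)
    then show ?case using lpa_component_add by (simp add: cls_add[symmetric])
  next
    case (monomial c w)
    then have "N.normal_form (word w) n" using N.word_normal_form[of w] by auto
    then consider "N.cong (word w) 0" | u p v q x where "awalk u p x" "awalk v q x"
       "int (length p) - int (length q) = n" "N.cong (word w) (path u p * ghost v q)"
      unfolding N.normal_form_def by blast
    then show ?case
    proof cases
      case 1
      then have "N.cong (scal c * word w) 0" using N.cong_scal[of _ 0] by simp
      from cls_eqI[OF this] show ?thesis using lpa_component.zero[of K E n] by (simp add: L_sel)
    next
      case (2 u p v q x)
      have "cls (word (path_word u p)) = cls (path u p)" "cls (word (ghost_path_word v q)) = cls (ghost v q)"
        using 2 cls_eqI word_path_word word_ghost_path_word by blast+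
      moreover have "path u p \<in> Alg" "ghost v q \<in> Alg" using 2 by auto
      ultimately have "c \<odot>\<^bsub>L\<^esub> (cls (word (path_word u p)) \<otimes>\<^bsub>L\<^esub> cls (word (ghost_path_word v q))) \<oplus>\<^bsub>L\<^esub> \<zero>\<^bsub>L\<^esub>
          = cls (scal c * (path u p * ghost v q))"
        by (simp add: cls_mult cls_smult L_sel(2) cls_add)
      moreover have "cls (scal c * word w) = cls (scal c * (path u p * ghost v q))"
        by (intro cls_eqI N.cong_scal 2)
      ultimately show ?thesis
        using lpa_component.step[OF lpa_component.zero 2(1,2,3), of K c] by simp
    qed
  qed
  then show "x \<in> lpa_component K E n" using a by simp
qed

text \<open>
  A decomposition of the class of \<open>a\<close> into homogeneous summands can only consist of the classes of the
  components of \<open>a\<close>, because the relations are homogeneous.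
\<close>

lemma graded_ideal_iff:
  assumes J: "lifted_ideal J"
  shows "graded_ideal L (lpa_component K E) (cls ` J) \<longleftrightarrow> graded J"
proof -
  have decomp: "N.cong (degree_part 0 m a) (if f m = \<zero>\<^bsub>L\<^esub> then 0 else b m)"
    if fin: "finite {n. f n \<noteq> \<zero>\<^bsub>L\<^esub>}" and b: "\<And>n. f n = cls (b n)" "\<And>n. b n \<in> Alg" "\<And>n. homogeneous n (b n)"
      and s: "cls a = finsum L f {n. f n \<noteq> \<zero>\<^bsub>L\<^esub>}" for f b a m
  proof -
    let ?S = "{n. f n \<noteq> \<zero>\<^bsub>L\<^esub>}"
    have "cls a = cls (\<Sum>n\<in>?S. b n)" unfolding s by (rule finsum_cls[OF fin b(1,2)])
    then have "a - (\<Sum>n\<in>?S. b n) \<in> lpa_ideal E" by (simp add: cls_eq_iff N.cong_def)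
    from lpa_ideal_degree_part[OF this, of 0 m]
    have "N.cong (degree_part 0 m a) (degree_part 0 m (\<Sum>n\<in>?S. b n))"
      by (simp add: N.cong_def degree_part_minus)
    also have "degree_part 0 m (\<Sum>n\<in>?S. b n) = (\<Sum>n\<in>?S. if n = m then b m else 0)"
      unfolding degree_part_sum by (rule sum.cong) (auto simp: degree_part_homogeneous[OF b(3)])
    also have "\<dots> = (if f m = \<zero>\<^bsub>L\<^esub> then 0 else b m)" using fin by simp
    finally show ?thesis .
  qed
  have rep: "\<exists>b. \<forall>n. f n = cls (b n) \<and> b n \<in> Alg \<and> homogeneous n (b n)"
    if "\<forall>n. f n \<in> cls ` J \<inter> lpa_component K E n" for f
  proof (rule choice, rule allI)
    fix n
    have "f n \<in> lpa_component K E n" using that by blast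
    then show "\<exists>b. f n = cls b \<and> b \<in> Alg \<and> homogeneous n b" unfolding lpa_component_eq by blast
  qed
  have det: "cls (degree_part 0 m a) = f m"
    if f: "\<forall>n. f n \<in> cls ` J \<inter> lpa_component K E n" "finite {n. f n \<noteq> \<zero>\<^bsub>L\<^esub>}"
       "cls a = finsum L f {n. f n \<noteq> \<zero>\<^bsub>L\<^esub>}" for f a m
  proof -
    obtain b where b: "\<And>n. f n = cls (b n)" "\<And>n. b n \<in> Alg" "\<And>n. homogeneous n (b n)"
      using rep[OF f(1)] by blast
    have "cls (degree_part 0 m a) = cls (if f m = \<zero>\<^bsub>L\<^esub> then 0 else b m)"
      by (rule cls_eqI[OF decomp[OF f(2) b f(3)]])
    then show ?thesis using b(1)[of m] by (auto simp: L_sel(2) split: if_splits)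
  qed
  show ?thesis
  proof
    assume g: "graded_ideal L (lpa_component K E) (cls ` J)"
    show "graded J"
      unfolding graded_def
    proof (intro ballI allI)
      fix a m assume "a \<in> J"
      have "\<forall>x\<in>cls ` J. \<exists>!f. (\<forall>n. f n \<in> cls ` J \<inter> lpa_component K E n) \<and> finite {n. f n \<noteq> \<zero>\<^bsub>L\<^esub>} \<and>
          x = finsum L f {n. f n \<noteq> \<zero>\<^bsub>L\<^esub>}"
        using g unfolding graded_ideal_def by (rule conjunct2)
      then have "\<exists>!f. (\<forall>n. f n \<in> cls ` J \<inter> lpa_component K E n) \<and> finite {n. f n \<noteq> \<zero>\<^bsub>L\<^esub>} \<and>
          cls a = finsum L f {n. f n \<noteq> \<zero>\<^bsub>L\<^esub>}"
        by (rule bspec) (rule imageI[OF \<open>a \<in> J\<close>])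
      then obtain f where f: "\<forall>n. f n \<in> cls ` J \<inter> lpa_component K E n" "finite {n. f n \<noteq> \<zero>\<^bsub>L\<^esub>}"
         "cls a = finsum L f {n. f n \<noteq> \<zero>\<^bsub>L\<^esub>}"
        by (elim ex1E conjE) (rule that)
      have "cls (degree_part 0 m a) \<in> cls ` J" using det[OF f] f(1) by auto
      then show "degree_part 0 m a \<in> J" using cls_mem_image[OF J] by blast
    qed
  next
    assume g: "graded J"
    show "graded_ideal L (lpa_component K E) (cls ` J)"
      unfolding graded_ideal_def
    proof (intro conjI ballI)
      show "two_sided_ideal L (cls ` J)" by (rule image_ideal[OF J])
      fix x assume "x \<in> cls ` J"
      then obtain a where a: "x = cls a" "a \<in> J" by auto
      have aA: "a \<in> Alg" using a lifted_idealD(2)[OF J] by blast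
      let ?f = "\<lambda>n. cls (degree_part 0 n a)"
      let ?S = "{n. ?f n \<noteq> \<zero>\<^bsub>L\<^esub>}" and ?T = "word_degree ` supp a"
      have "degree_part 0 n a = 0" if "n \<notin> ?T" for n
        using that by (intro poly_mapping_eqI) (auto simp: lookup_degree_part in_keys_iff)
      then have ST: "?S \<subseteq> ?T" by (auto simp: L_sel(2))
      then have fin: "finite ?S" by (rule finite_subset) simp
      have "finsum L ?f ?S = cls (\<Sum>n\<in>?S. degree_part 0 n a)"
        by (rule finsum_cls[OF fin]) (auto simp: degree_part_Alg aA)
      also have "\<dots> = cls a"
      proof (rule cls_eqI)
        have "(\<Sum>n\<in>?T. degree_part 0 n a) = a" using sum_degree_parts[of a 0] by simp
        moreover have "(\<Sum>n\<in>?T. degree_part 0 n a) = (\<Sum>n\<in>?T - ?S. degree_part 0 n a) + (\<Sum>n\<in>?S. degree_part 0 n a)"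
          by (rule sum.subset_diff[OF ST]) simp
        moreover have "(\<Sum>n\<in>?T - ?S. degree_part 0 n a) \<in> lpa_ideal E"
          by (rule N.J_sum) (auto simp: L_sel(2) cls_eq_iff N.cong_def)
        ultimately show "N.cong (\<Sum>n\<in>?S. degree_part 0 n a) a"
          by (metis N.cong_def N.cong_sym add_diff_cancel_right')
      qed
      finally have sum: "x = finsum L ?f ?S" using a by simp
      have mem: "\<forall>n. ?f n \<in> cls ` J \<inter> lpa_component K E n"
        using g a aA degree_part_Alg homogeneous_degree_part unfolding graded_def lpa_component_eq by blast
      show "\<exists>!f. (\<forall>n. f n \<in> cls ` J \<inter> lpa_component K E n) \<and> finite {n. f n \<noteq> \<zero>\<^bsub>L\<^esub>} \<and>
          x = finsum L f {n. f n \<noteq> \<zero>\<^bsub>L\<^esub>}"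
      proof (rule ex1I[of _ ?f])
        show "(\<forall>n. ?f n \<in> cls ` J \<inter> lpa_component K E n) \<and> finite ?S \<and> x = finsum L ?f ?S"
          using mem fin sum by blast
        fix f assume f: "(\<forall>n. f n \<in> cls ` J \<inter> lpa_component K E n) \<and> finite {n. f n \<noteq> \<zero>\<^bsub>L\<^esub>} \<and>
          x = finsum L f {n. f n \<noteq> \<zero>\<^bsub>L\<^esub>}"
        show "f = ?f"
        proof
          fix m show "f m = ?f m" using det[of f a m] f a by simp
        qed
      qed
    qed
  qed
qed

end

section \<open>The strong countable separation property\<close>

context wf_digraph
begin

text \<open>
  The smallest hereditary saturated set that contains \<open>u\<close>: saturating the hereditary set of the
  descendants of \<open>u\<close> keeps it hereditary.
\<close>

inductive_set saturated_closure :: "'a \<Rightarrow> 'a set" for u where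
  reach: "connects G u x \<Longrightarrow> x \<in> saturated_closure u"
| regular: "regular_vertex G x \<Longrightarrow> (\<And>e. e \<in> out_arcs G x \<Longrightarrow> head G e \<in> saturated_closure u) \<Longrightarrow>
     x \<in> saturated_closure u"

lemma connects_verts: "connects G u v \<Longrightarrow> u \<in> verts G \<and> v \<in> verts G"
  unfolding connects_def by auto

lemma saturated_closure_props:
  shows "hereditary G (saturated_closure u)" "saturated G (saturated_closure u)"
proof -
  have sub: "saturated_closure u \<subseteq> verts G"
  proof
    fix x assume "x \<in> saturated_closure u"
    then show "x \<in> verts G" by cases (auto simp: regular_vertex_def dest: connects_verts)
  qed
  have arc: "head G e \<in> saturated_closure u" if "x \<in> saturated_closure u" "e \<in> out_arcs G x" for x e
    using that(1)
  proof cases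
    case reach
    then show ?thesis
      using connects_trans connects_arc[OF that(2)] saturated_closure.reach by blast
  next
    case regular
    then show ?thesis using that(2) by blast
  qed
  have "y \<in> saturated_closure u" if "awalk x p y" "x \<in> saturated_closure u" for x p y
    using that
  proof (induction p arbitrary: x)
    case Nil
    then show ?case by (simp add: awalk_Nil_iff)
  next
    case (Cons e p)
    then have "e \<in> out_arcs G x" "awalk (head G e) p y" by (auto simp: awalk_Cons_iff)
    then show ?case using Cons arc by blast
  qed
  then show "hereditary G (saturated_closure u)"
    using sub unfolding hereditary_def connects_def by blast
  show "saturated G (saturated_closure u)"
    unfolding saturated_def using sub saturated_closure.regular by blast
qed

text \<open>
  The descendants reached from \<open>w\<close> along paths all of whose sources are regular.  Regular vertices emit
  finitely many edges, so there are only countably many of them.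
\<close>

primrec regular_descendants :: "'a \<Rightarrow> nat \<Rightarrow> 'a set" where
  "regular_descendants w 0 = {w}"
| "regular_descendants w (Suc n) = (\<Union>x\<in>{x \<in> regular_descendants w n. regular_vertex G x}. head G ` out_arcs G x)"

lemma countable_regular_descendants: "countable (regular_descendants w n)"
proof (induction n)
  case (Suc n)
  then have "countable {x \<in> regular_descendants w n. regular_vertex G x}" by (rule countable_subset[rotated]) auto
  moreover have "countable (head G ` out_arcs G x)" if "x \<in> {x \<in> regular_descendants w n. regular_vertex G x}" for x
    using that by (intro countable_image countable_finite) (simp add: regular_vertex_def)
  ultimately show ?case unfolding regular_descendants.simps by (rule countable_UN)
qed simp

lemma regular_descendants_connects:
  "w \<in> verts G \<Longrightarrow> x \<in> regular_descendants w n \<Longrightarrow> connects G w x"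
proof (induction n arbitrary: x)
  case 0
  then show ?case using connects_refl by simp
next
  case (Suc n)
  then obtain y e where "y \<in> regular_descendants w n" "e \<in> out_arcs G y" "x = head G e" by auto
  then show ?case using Suc connects_trans connects_arc by blast
qed

text \<open>
  Let \<open>w\<close> be in every nonempty hereditary saturated set and \<open>T\<close> the set of its regular descendants.  The
  saturated closure of \<open>u\<close> contains \<open>w\<close>, so \<open>w\<close> lies below \<open>u\<close> or is regular with all of its edges
  leading into the closure.  Descending along such edges ends at an element of \<open>T\<close> below \<open>u\<close>.
\<close>

lemma strong_CSP_iff:
  assumes "verts G \<noteq> {}"
  shows "strong_CSP G (verts G) \<longleftrightarrow>
    (\<exists>w\<in>verts G. \<forall>Y. Y \<noteq> {} \<longrightarrow> hereditary G Y \<longrightarrow> saturated G Y \<longrightarrow> w \<in> Y)"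
proof
  assume "strong_CSP G (verts G)"
  then obtain T where T: "CSP G (verts G) T"
    and sub: "\<And>Y. Y \<noteq> {} \<Longrightarrow> Y \<subseteq> verts G \<Longrightarrow> hereditary G Y \<Longrightarrow> saturated G Y \<Longrightarrow> T \<subseteq> Y"
    unfolding strong_CSP_def by blast
  obtain w where "w \<in> T" "w \<in> verts G" using T assms unfolding CSP_def by blast
  then show "\<exists>w\<in>verts G. \<forall>Y. Y \<noteq> {} \<longrightarrow> hereditary G Y \<longrightarrow> saturated G Y \<longrightarrow> w \<in> Y"
    using sub unfolding hereditary_def by blast
next
  assume "\<exists>w\<in>verts G. \<forall>Y. Y \<noteq> {} \<longrightarrow> hereditary G Y \<longrightarrow> saturated G Y \<longrightarrow> w \<in> Y"
  then obtain w where w: "w \<in> verts G" "\<And>Y. Y \<noteq> {} \<Longrightarrow> hereditary G Y \<Longrightarrow> saturated G Y \<Longrightarrow> w \<in> Y"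
    by blast
  define T where "T = (\<Union>n. regular_descendants w n)"
  have Tc: "connects G w t" if "t \<in> T" for t
    using that regular_descendants_connects[OF w(1)] unfolding T_def by blast
  have "\<exists>t\<in>T. connects G u t" if u: "u \<in> verts G" for u
  proof -
    have step: "x \<in> T \<longrightarrow> (\<exists>t\<in>T. connects G u t)" if "x \<in> saturated_closure u" for x
      using that
    proof (induction rule: saturated_closure.induct)
      case (reach x)
      then show ?case by blast
    next
      case (regular x)
      show ?case
      proof
        assume x: "x \<in> T"
        obtain e where e: "e \<in> out_arcs G x" using regular(1) unfolding regular_vertex_def by blast
        obtain n where "x \<in> regular_descendants w n" using x by (auto simp: T_def)
        then have "head G e \<in> regular_descendants w (Suc n)" using regular(1) e by auto
        then have "head G e \<in> T" unfolding T_def by blast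
        then show "\<exists>t\<in>T. connects G u t" using regular e by blast
      qed
    qed
    have "u \<in> saturated_closure u" by (rule saturated_closure.reach[OF connects_refl[OF u]])
    then have "w \<in> saturated_closure u" using w(2)[OF _ saturated_closure_props] by blast
    moreover have "w \<in> T" unfolding T_def by (rule UN_I[of 0]) auto
    ultimately show ?thesis using step by blast
  qed
  moreover have "countable T" unfolding T_def by (intro countable_UN countable_regular_descendants) auto
  moreover have "T \<subseteq> verts G" using Tc connects_verts by blast
  ultimately have "CSP G (verts G) T" unfolding CSP_def by blast
  moreover have "T \<subseteq> Y" if "Y \<noteq> {}" "hereditary G Y" "saturated G Y" for Y
    using w(2)[OF that] that(2) Tc unfolding hereditary_def by blast
  ultimately show "strong_CSP G (verts G)" using assms unfolding strong_CSP_def by blast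
qed

lemma quotient_wf: "hereditary G H \<Longrightarrow> wf_digraph (quotient_graph G H)"
proof
  fix e assume H: "hereditary G H" and e: "e \<in> arcs (quotient_graph G H)"
  then have e': "e \<in> arcs G" "head G e \<notin> H" by (auto simp: quotient_graph_def)
  then have "tail G e \<notin> H" using H connects_arc[of e "tail G e"] unfolding hereditary_def by auto
  then show "tail (quotient_graph G H) e \<in> verts (quotient_graph G H)"
    "head (quotient_graph G H) e \<in> verts (quotient_graph G H)"
    using e' by (auto simp: quotient_graph_def)
qed

lemma strong_CSP_quotient_iff:
  assumes "hereditary G H" "verts G - H \<noteq> {}"
  shows "strong_CSP (quotient_graph G H) (verts (quotient_graph G H)) \<longleftrightarrow>
    (\<exists>w\<in>verts G - H. \<forall>Y. Y \<noteq> {} \<longrightarrow> hereditary (quotient_graph G H) Y \<longrightarrow> saturated (quotient_graph G H) Y \<longrightarrow> w \<in> Y)"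
  using wf_digraph.strong_CSP_iff[OF quotient_wf[OF assms(1)]] assms(2) by simp

end

section \<open>Failure of condition (K)\<close>

context wf_digraph
begin

text \<open>
  If two edges of a closed path had the same source, the segment between them could be cut out.
\<close>

lemma shortest_closed_path:
  assumes "\<exists>c. closed_path G v c"
  shows "\<exists>c. closed_path G v c \<and> inj_on (tail G) (set c)"
proof -
  obtain c where c: "closed_path G v c" and least: "\<And>d. closed_path G v d \<Longrightarrow> length c \<le> length d"
    using assms ex_has_least_nat[of "closed_path G v" _ length] by blast
  have cv: "awalk v c v" "c \<noteq> []" using c by (auto simp: closed_path_def)
  have split: "awalk v (take i c) (tail G (c ! i)) \<and> awalk (tail G (c ! i)) (drop i c) v" if "i < length c" for i
  proof -
    have "awalk v (take i c @ drop i c) v" using cv by simp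
    then obtain x where x: "awalk v (take i c) x" "awalk x (drop i c) v" by (auto simp del: append_take_drop_id)
    have "drop i c = c ! i # drop (Suc i) c" using that by (simp add: Cons_nth_drop_Suc)
    then have "x = tail G (c ! i)" using x(2) by (auto simp: awalk_Cons_iff)
    then show ?thesis using x by simp
  qed
  have "tail G (c ! i) \<noteq> tail G (c ! j)" if "i < j" "j < length c" for i j
  proof
    assume eq: "tail G (c ! i) = tail G (c ! j)"
    have "awalk v (take i c @ drop j c) v"
      using split[of i] split[of j] that eq by (intro awalk_appendI[of v "take i c" "tail G (c ! i)"]) auto
    then have "closed_path G v (take i c @ drop j c)" using that by (auto simp: closed_path_def)
    from least[OF this] show False using that by simp
  qed
  then have "c ! i = c ! j" if "i < length c" "j < length c" "tail G (c ! i) = tail G (c ! j)" for i j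
    using that by (metis linorder_neqE_nat)
  then have "inj_on (tail G) (set c)" unfolding inj_on_def by (metis in_set_conv_nth)
  then show ?thesis using c by blast
qed

text \<open>
  With injective sources, the edges of \<open>c\<close> form a cycle without exits to vertices that lead back to \<open>v\<close>.
\<close>

lemma not_condition_K:
  assumes "\<not> condition_K G"
  shows "\<exists>v c. closed_path G v c \<and> inj_on (tail G) (set c) \<and> (\<forall>q. closed_path G v q \<longrightarrow> set q = set c)"
proof -
  obtain u p v where p: "closed_path G u p" and v: "v \<in> set (awalk_verts u p)"
    and all: "\<And>q. closed_path G v q \<Longrightarrow> set q = set p"
    using assms unfolding condition_K_def by blast
  have up: "awalk u p u" "p \<noteq> []" using p by (auto simp: closed_path_def)
  obtain q r where qr: "p = q @ r" "awalk u q v" "awalk v r u"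
    using awalk_decomp[OF up(1) v] by blast
  have "closed_path G v (r @ q)" using awalk_appendI[OF qr(3,2)] up(2) qr(1) by (auto simp: closed_path_def)
  then obtain c where c: "closed_path G v c" "inj_on (tail G) (set c)" using shortest_closed_path by blast
  then show ?thesis using all by blast
qed

end

section \<open>The four conditions\<close>

context leavitt
begin

lemma homogeneous_breaking_element: "homogeneous 0 (breaking_element H v)"
  unfolding breaking_element_def word_append[symmetric]
  by (intro homogeneous_minus homogeneous_sum homogeneous_word) auto

lemma vertices_in_graded_core: "lifted_ideal J \<Longrightarrow> vertices_in (graded_core N J) = vertices_in J"
  using homogeneous_graded_core[OF _ homogeneous_word[of "[Vertex _]" 0]] graded_core_subset[of J N]
  unfolding vertices_in_def by auto

lemma condition_K_graded:
  assumes K: "condition_K E" and I: "lifted_ideal I"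
  shows "graded I"
proof -
  have "I = graded_core 0 I"
  proof (rule vertices_determine_ideal)
    show "lifted_ideal (graded_core 0 I)" by (rule lifted_graded_core[OF I])
    show "graded (graded_core 0 I)" by (rule graded_graded_core[OF I])
    show "graded_core 0 I \<subseteq> I" by (rule graded_core_subset[OF I])
    show "V v \<in> graded_core 0 I" if "V v \<in> I" for v
      by (rule homogeneous_graded_core[OF I homogeneous_word that]) (rule refl)
    show "breaking_element H v \<in> graded_core 0 I" if "breaking_element H v \<in> I" for H v
      by (rule homogeneous_graded_core[OF I homogeneous_breaking_element that])
  qed (use K I in auto)
  then show ?thesis using graded_graded_core[OF I] by simp
qed

lemma prime_irreducible:
  assumes "prime_lifted J"
  shows "irreducible_lifted J"
proof -
  have *: "J \<noteq> A \<inter> B" if A: "lifted_ideal A" "J \<subset> A" and B: "lifted_ideal B" "J \<subset> B" for A B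
  proof
    assume J: "J = A \<inter> B"
    have "a * b \<in> J" if "a \<in> A" "b \<in> B" for a b
      unfolding J using that lifted_idealD(2,6)[OF A(1)] lifted_idealD(2,5)[OF B(1)] Alg_Mul by blast
    then have "A \<subseteq> J \<or> B \<subseteq> J" using assms A(1) B(1) unfolding prime_lifted_def by blast
    then show False using A(2) B(2) by blast
  qed
  have "lifted_ideal J" "J \<noteq> Alg" using assms unfolding prime_lifted_def by simp_all
  then show ?thesis unfolding irreducible_lifted_def by (intro conjI allI impI *)
qed

lemma ideal_sum_lifted:
  assumes A: "lifted_ideal A" and B: "lifted_ideal B"
  shows "lifted_ideal {a + b | a b. a \<in> A \<and> b \<in> B}"
  unfolding lifted_ideal_def
proof (intro conjI ballI)
  show "{a + b | a b. a \<in> A \<and> b \<in> B} \<subseteq> Alg" using lifted_idealD(2)[OF A] lifted_idealD(2)[OF B] by auto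
  show "lpa_ideal E \<subseteq> {a + b | a b. a \<in> A \<and> b \<in> B}"
  proof
    fix x :: "('v, 'e) lpa_gen list \<Rightarrow>\<^sub>0 'k" assume "x \<in> lpa_ideal E"
    then have "x \<in> A" "0 \<in> B" "x = x + 0" using lifted_idealD(1)[OF A] lifted_idealD(4)[OF B] by auto
    then show "x \<in> {a + b | a b. a \<in> A \<and> b \<in> B}" by blast
  qed
next
  fix x y assume "x \<in> {a + b | a b. a \<in> A \<and> b \<in> B}" "y \<in> {a + b | a b. a \<in> A \<and> b \<in> B}"
  then obtain a b a' b' where "x = a + b" "y = a' + b'" "a \<in> A" "b \<in> B" "a' \<in> A" "b' \<in> B" by blast
  then have "x + y = (a + a') + (b + b')" "a + a' \<in> A" "b + b' \<in> B"
    using lifted_idealD(3)[OF A] lifted_idealD(3)[OF B] by (auto simp: ac_simps)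
  then show "x + y \<in> {a + b | a b. a \<in> A \<and> b \<in> B}" by blast
next
  fix x y assume "x \<in> {a + b | a b. a \<in> A \<and> b \<in> B}" and y: "y \<in> Mul"
  then obtain a b where x: "x = a + b" and ab: "a \<in> A" "b \<in> B" by blast
  have "y * x = y * a + y * b" "x * y = a * y + b * y" by (simp_all add: x distrib_left distrib_right)
  then show "y * x \<in> {a + b | a b. a \<in> A \<and> b \<in> B}" "x * y \<in> {a + b | a b. a \<in> A \<and> b \<in> B}"
    using lifted_idealD(5,6)[OF A ab(1) y] lifted_idealD(5,6)[OF B ab(2) y] by blast+
qed

text \<open>
  The square of \<open>C = (A + J) \<inter> (B + J)\<close> lies in \<open>J\<close>, and \<open>C\<close> is determined by the idempotents in it.
\<close>

lemma irreducible_prime: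
  assumes gr: "\<And>I. lifted_ideal I \<Longrightarrow> graded I" and irr: "irreducible_lifted J"
  shows "prime_lifted J"
proof -
  have J: "lifted_ideal J" using irr by (simp add: irreducible_lifted_def)
  interpret J: leavitt_ideal E K J using J by unfold_locales
  have *: "A \<subseteq> J \<or> B \<subseteq> J" if A: "lifted_ideal A" and B: "lifted_ideal B" and AB: "\<forall>a\<in>A. \<forall>b\<in>B. a * b \<in> J" for A B
  proof (rule ccontr)
    assume n: "\<not> (A \<subseteq> J \<or> B \<subseteq> J)"
    define AJ where "AJ = {a + b | a b. a \<in> A \<and> b \<in> J}"
    define BJ where "BJ = {a + b | a b. a \<in> B \<and> b \<in> J}"
    have lAJ: "lifted_ideal AJ" and lBJ: "lifted_ideal BJ"
      unfolding AJ_def BJ_def by (intro ideal_sum_lifted A B J)+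
    have "J \<subseteq> AJ" "J \<subseteq> BJ" "A \<subseteq> AJ" "B \<subseteq> BJ"
      unfolding AJ_def BJ_def using lifted_idealD(4)[OF A] lifted_idealD(4)[OF B] J.J_zero
      by (force intro: exI[of _ 0])+
    then have s: "J \<subset> AJ" "J \<subset> BJ" using n by blast+
    \<comment> \<open>\<open>J\<close> is irreducible, so this intersection is larger than \<open>J\<close>.\<close>
    define C where "C = AJ \<inter> BJ"
    have lC: "lifted_ideal C" using lAJ lBJ unfolding C_def lifted_ideal_def by blast
    have JC: "J \<subset> C" using s irr lAJ lBJ unfolding C_def irreducible_lifted_def by blast
    have CC: "c * d \<in> J" if cd: "c \<in> C" "d \<in> C" for c d
    proof -
      obtain a j b j' where c: "c = a + j" "a \<in> A" "j \<in> J" and d: "d = b + j'" "b \<in> B" "j' \<in> J"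
        using cd unfolding C_def AJ_def BJ_def by blast
      have m: "a \<in> Mul" "b \<in> Mul" "j' \<in> Mul"
        using c d lifted_idealD(2)[OF A] lifted_idealD(2)[OF B] J.J_Alg Alg_Mul by blast+
      have "c * d = a * b + (a * j' + j * (b + j'))" by (simp add: c d algebra_simps)
      moreover have "a * b \<in> J" using AB c d by blast
      moreover have "a * j' \<in> J" by (rule J.J_lmult[OF d(3) m(1)])
      moreover have "j * (b + j') \<in> J" by (rule J.J_rmult[OF c(3)]) (use m in auto)
      ultimately show ?thesis using J.J_add by simp
    qed
    have "C = J"
    proof (rule vertices_determine_ideal[OF J gr[OF J] lC])
      show "J \<subseteq> C" using JC by blast
      show "V v \<in> J" if "v \<in> verts E" "V v \<in> C" for v
        using CC[OF that(2,2)] J.cong_mem[OF J.V_V[OF that(1,1)]] by simp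
      show "breaking_element (vertices_in J) v \<in> J"
        if v: "v \<in> breaking_vertices E (vertices_in J)" and b: "breaking_element (vertices_in J) v \<in> C" for v
      proof -
        have "finite {e. e \<in> out_arcs E v \<and> head E e \<notin> vertices_in J}" "v \<in> verts E"
          using v unfolding breaking_vertices_iff by blast+
        from J.breaking_element_idem[OF this] show ?thesis using CC[OF b b] J.cong_mem by blast
      qed
    qed (use gr[OF lC] in blast)
    then show False using JC by blast
  qed
  have "J \<noteq> Alg" using irr by (simp add: irreducible_lifted_def)
  then show ?thesis using J unfolding prime_lifted_def by (intro conjI allI impI *)
qed

lemma completely_irreducible_least:
  assumes "completely_irreducible_lifted P"
  shows "\<exists>M. lifted_ideal M \<and> P \<subset> M \<and> (\<forall>A. lifted_ideal A \<longrightarrow> P \<subset> A \<longrightarrow> M \<subseteq> A)"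
proof -
  obtain x where P: "lifted_ideal P" and x: "x \<in> Alg" "x \<notin> P" "\<And>A. lifted_ideal A \<Longrightarrow> P \<subset> A \<Longrightarrow> x \<in> A"
    using assms unfolding completely_irreducible_lifted_def by blast
  define M where "M = {y \<in> Alg. \<forall>A. lifted_ideal A \<longrightarrow> P \<subset> A \<longrightarrow> y \<in> A}"
  have "lifted_ideal M"
    unfolding lifted_ideal_def
  proof (intro conjI ballI)
    show "lpa_ideal E \<subseteq> M"
      using lifted_idealD(1,2)[OF P] unfolding M_def by blast
    show "M \<subseteq> Alg" by (auto simp: M_def)
    show "a + b \<in> M" if "a \<in> M" "b \<in> M" for a b using that lifted_idealD(3) unfolding M_def by blast
    show "y * a \<in> M" "a * y \<in> M" if "a \<in> M" "y \<in> Mul" for a y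
      using that lifted_idealD(5,6) Alg_intros(3,4) unfolding M_def by blast+
  qed
  moreover have "P \<subseteq> M" using lifted_idealD(2)[OF P] unfolding M_def by blast
  moreover have "x \<in> M" using x unfolding M_def by blast
  ultimately show ?thesis using x(2) unfolding M_def by blast
qed

end

context leavitt
begin

abbreviation "quotient_strong_CSP H \<equiv>
  strong_CSP (quotient_graph E H) (verts (quotient_graph E H))"

text \<open>
  If all breaking elements lie in \<open>P\<close>, an ideal properly above \<open>P\<close> differs from \<open>P\<close> in its vertices, and the vertex
  provided by strong CSP is among them.
\<close>

lemma common_vertex_imp_completely_irreducible:
  assumes K: "condition_K E" and P: "prime_lifted P"
    and CSP: "quotient_strong_CSP (vertices_in P)"
    and brk: "\<And>v. v \<in> breaking_vertices E (vertices_in P) \<Longrightarrow> breaking_element (vertices_in P) v \<in> P"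
  shows "completely_irreducible_lifted P"
proof -
  let ?H = "vertices_in P"
  have lP: "lifted_ideal P" using P unfolding prime_lifted_def by simp
  interpret P: leavitt_ideal E K P using lP by unfold_locales
  have ne: "verts E - ?H \<noteq> {}" using P.prime_downward_directed[OF P] unfolding downward_directed_def by simp
  obtain w where w: "w \<in> verts E - ?H"
    and wY: "\<And>Y. Y \<noteq> {} \<Longrightarrow> hereditary (quotient_graph E ?H) Y \<Longrightarrow> saturated (quotient_graph E ?H) Y \<Longrightarrow> w \<in> Y"
    using CSP unfolding strong_CSP_quotient_iff[OF P.hereditary_vertices_in ne] by blast
  have "V w \<in> A" if A: "lifted_ideal A" "P \<subset> A" for A
  proof -
    have PA: "P \<subseteq> A" using A(2) by blast
    have "vertices_in A - ?H \<noteq> {}"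
    proof
      assume e: "vertices_in A - ?H = {}"
      have "A = P"
      proof (rule vertices_determine_ideal[OF lP condition_K_graded[OF K lP] A(1) PA])
        show "V v \<in> P" if "v \<in> verts E" "V v \<in> A" for v using e that unfolding vertices_in_def by blast
      qed (use brk K in auto)
      then show False using A(2) by blast
    qed
    then have "w \<in> vertices_in A - ?H" by (rule wY) (rule vertices_in_quotient[OF lP A(1) PA brk], assumption)+
    then show ?thesis by (simp add: vertices_in_def)
  qed
  moreover have "V w \<in> Alg" "V w \<notin> P" using w by (auto simp: vertices_in_def)
  ultimately show ?thesis using lP unfolding completely_irreducible_lifted_def by blast
qed

text \<open>
  Write \<open>b\<^sub>v\<close> for the breaking element of \<open>v\<close>.  An ideal \<open>A\<close> properly above \<open>P\<close> contains some \<open>y \<notin> P\<close> that is a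
  vertex or a breaking element.  Primeness gives \<open>y t b\<^sub>u \<notin> P\<close> for a word \<open>t\<close>, and since \<open>e\<^sup>* b\<^sub>u \<in> P\<close> for
  all edges \<open>e\<close>, the word may be taken to be a path \<open>p\<close> to \<open>u\<close>.  If \<open>y\<close> is a vertex, \<open>y p = p\<close> and
  \<open>p\<^sup>* p = u\<close> lies in \<open>A\<close>, hence so does \<open>b\<^sub>u\<close>.  If \<open>y\<close> is a breaking element, it kills every edge that
  leads to \<open>u\<close>, so \<open>p\<close> is trivial and \<open>y = b\<^sub>u\<close>.
\<close>

lemma missing_breaking_element_imp_completely_irreducible:
  assumes K: "condition_K E" and P: "prime_lifted P"
    and u: "u \<in> breaking_vertices E (vertices_in P)" "breaking_element (vertices_in P) u \<notin> P"
  shows "completely_irreducible_lifted P"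
proof -
  let ?H = "vertices_in P" and ?b = "\<lambda>v. breaking_element (vertices_in P) v"
  have lP: "lifted_ideal P" using P unfolding prime_lifted_def by simp
  interpret P: leavitt_ideal E K P using lP by unfold_locales
  have uE: "u \<in> verts E" and ufin: "finite {e. e \<in> out_arcs E u \<and> head E e \<notin> ?H}"
    using u(1) unfolding breaking_vertices_iff by blast+
  have "?b u \<in> A" if A: "lifted_ideal A" "P \<subset> A" for A
  proof (rule ccontr)
    assume nb: "?b u \<notin> A"
    interpret A: leavitt_ideal E K A using A(1) by unfold_locales
    have PA: "P \<subseteq> A" using A(2) by blast
    have bM: "?b u \<in> Mul" and VuM: "V u \<in> Mul" using uE by (auto intro: breaking_element_Mul)
    have Vb: "P.cong (V u * ?b u) (?b u)" by (rule P.V_breaking_element[OF uE])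
    have reach: "\<exists>v p. awalk v p u \<and> y * path v p * ?b u \<notin> P" if y: "y \<in> Alg" "y \<notin> P" for y
    proof -
      obtain t where t: "t \<in> lists (lpa_gens E)" "y * word t * ?b u \<notin> P"
        using P.prime_elementwise[OF P y breaking_element_Alg[OF uE] u(2)] by blast
      have yM: "y \<in> Mul" using Alg_Mul[OF y(1)] .
      show ?thesis
      proof (cases "t = []")
        case True
        have "P.cong (y * path u [] * ?b u) (y * ?b u)"
          using P.cong_lmult[OF Vb yM] by (simp add: P.path_Nil mult.assoc)
        then have "y * path u [] * ?b u \<notin> P" using t True P.cong_mem by (simp add: word_Nil)
        then show ?thesis using uE by (intro exI[of _ u] exI[of _ "[]"]) (simp add: awalk_Nil_iff)
      next
        case False
        from P.word_normal_form[OF t(1) False] consider "P.cong (word t) 0"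
          | a p c q x where "awalk a p x" "awalk c q x" "P.cong (word t) (path a p * ghost c q)"
          unfolding P.normal_form_def by blast
        then show ?thesis
        proof cases
          case 1
          have "P.cong (y * word t * ?b u) 0" by (rule P.zero_rmult[OF P.zero_lmult[OF 1 yM] bM])
          then show ?thesis using t by (simp add: P.cong_zero_iff)
        next
          case (2 a p c q x)
          have pM: "path a p \<in> Mul" "ghost c q \<in> Mul" "y * path a p \<in> Mul" using 2 yM by auto
          have "P.cong (y * word t * ?b u) (y * (path a p * ghost c q) * ?b u)"
            by (rule P.cong_rmult[OF P.cong_lmult[OF 2(3) yM] bM])
          then have n: "y * path a p * (ghost c q * ?b u) \<notin> P" using t P.cong_mem by (simp add: mult.assoc)
          have gb: "ghost c q * ?b u \<notin> P" using n P.J_lmult[OF _ pM(3)] by blast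
          have c: "c = u"
          proof (rule ccontr)
            assume "c \<noteq> u"
            then have "P.cong (ghost c q * V u) 0" using P.ghost_V[OF 2(2) uE] by simp
            then have "ghost c q * V u * ?b u \<in> P" using P.zero_rmult bM P.cong_zero_iff by blast
            moreover have "P.cong (ghost c q * (V u * ?b u)) (ghost c q * ?b u)" by (rule P.cong_lmult[OF Vb pM(2)])
            ultimately show False using gb P.cong_mem by (simp add: mult.assoc)
          qed
          have "q = []"
          proof (cases q)
            case (Cons f q')
            have f: "f \<in> arcs E" "f \<in> out_arcs E u" and q': "awalk (head E f) q' x"
              using P.awalk_ConsD[of u f q' x] 2(2) c Cons by auto
            have "Gh f * ?b u \<in> P"
            proof (cases "head E f \<in> ?H")
              case True
              then have "V (head E f) \<in> P" by (simp add: vertices_in_def)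
              then show ?thesis using P.J_rmult[OF P.head_in_J(2)[OF f(1)] bM] by blast
            next
              case False
              then show ?thesis using P.Gh_breaking_element[OF ufin f(2)] by (simp add: P.cong_zero_iff)
            qed
            then have "ghost (head E f) q' * (Gh f * ?b u) \<in> P" by (rule P.J_lmult) (use q' in auto)
            moreover have "P.cong (ghost c q * ?b u) (ghost (head E f) q' * Gh f * ?b u)"
              using P.cong_rmult[OF P.ghost_Cons[of u f q' x] bM] 2(2) c Cons by simp
            ultimately show ?thesis using gb P.cong_mem by (simp add: mult.assoc)
          qed simp
          then have "ghost c q = V u" "x = u" using c 2(2) by (auto simp: P.ghost_Nil awalk_Nil_iff)
          then have "y * path a p * (V u * ?b u) \<notin> P" using n by simp
          then have "y * path a p * ?b u \<notin> P" using P.cong_mem[OF P.cong_lmult[OF Vb pM(3)]] by blast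
          then show ?thesis using 2(1) \<open>x = u\<close> by blast
        qed
      qed
    qed
    have "(\<exists>v\<in>verts E. V v \<in> A \<and> V v \<notin> P) \<or>
        (\<exists>v\<in>breaking_vertices E ?H. ?b v \<in> A \<and> ?b v \<notin> P)"
    proof (rule ccontr)
      assume "\<not> ?thesis"
      then have "A = P"
        by (intro vertices_determine_ideal[OF lP condition_K_graded[OF K lP] A(1) PA]) (use K in auto)
      then show False using A(2) by blast
    qed
    then show False
    proof (elim disjE bexE conjE)
      fix v assume v: "v \<in> verts E" "V v \<in> A" "V v \<notin> P"
      obtain a p where p: "awalk a p u" "V v * path a p * ?b u \<notin> P" using reach[of "V v"] v by auto
      have "a = v"
      proof (rule ccontr)
        assume "a \<noteq> v"
        then have "P.cong (V v * path a p) 0" using P.V_path[OF p(1) v(1)] by simp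
        then show False using p(2) P.zero_rmult bM P.cong_zero_iff by blast
      qed
      then have vp: "awalk v p u" using p(1) by simp
      have "V v * path v p \<in> A" by (rule A.J_rmult[OF v(2)]) (use vp in auto)
      then have "path v p \<in> A" using A.cong_mem[OF A.V_path[OF vp v(1)]] by simp
      then have "ghost v p * path v p \<in> A" by (rule A.J_lmult) (use vp in auto)
      then have "V u \<in> A" using A.cong_mem[OF A.ghost_path_same[OF vp]] by simp
      from A.J_rmult[OF this bM] have "?b u \<in> A" using A.cong_mem[OF A.V_breaking_element[OF uE]] by blast
      then show False using nb by blast
    next
      fix v assume v: "v \<in> breaking_vertices E ?H" "?b v \<in> A" "?b v \<notin> P"
      have vE: "v \<in> verts E" and vfin: "finite {e. e \<in> out_arcs E v \<and> head E e \<notin> ?H}"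
        using v(1) unfolding breaking_vertices_iff by blast+
      have vM: "?b v \<in> Mul" by (rule breaking_element_Mul[OF vE])
      obtain a p where p: "awalk a p u" "?b v * path a p * ?b u \<notin> P"
        using reach[OF breaking_element_Alg[OF vE] v(3)] by blast
      have n: "?b v * path a p \<notin> P" using p(2) P.J_rmult[OF _ bM] by blast
      have pM: "path a p \<in> Mul" using p by auto
      have "P.cong (?b v * V v * path a p) (?b v * path a p)"
        by (rule P.cong_rmult[OF P.breaking_element_V[OF vE] pM])
      then have n': "?b v * (V v * path a p) \<notin> P" using n P.cong_mem by (simp add: mult.assoc)
      have a: "a = v"
      proof (rule ccontr)
        assume "a \<noteq> v"
        then have "P.cong (V v * path a p) 0" using P.V_path[OF p(1) vE] by simp
        then show False using n' P.J_lmult vM P.cong_zero_iff by blast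
      qed
      show False
      proof (cases p)
        case Nil
        then have "v = u" using p(1) a by (simp add: awalk_Nil_iff)
        then show False using v(2) nb by simp
      next
        case (Cons e q)
        have e: "e \<in> arcs E" "e \<in> out_arcs E v" and q: "awalk (head E e) q u"
          using P.awalk_ConsD[of v e q u] p(1) a Cons by auto
        have "head E e \<notin> ?H"
          using P.hereditary_vertices_in q u(1) unfolding breaking_vertices_iff hereditary_def connects_def by blast
        then have "P.cong (?b v * Ed e) 0" using P.breaking_element_Ed[OF vfin e(2)] by simp
        then have "P.cong (?b v * Ed e * path (head E e) q) 0" by (rule P.zero_rmult) (use q in auto)
        moreover have "P.cong (?b v * path a p) (?b v * (Ed e * path (head E e) q))"
          using P.cong_lmult[OF P.path_Cons[of v e q u] vM] p(1) a Cons by simp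
        ultimately show False using n P.cong_mem P.cong_zero_iff by (simp add: mult.assoc)
      qed
    qed
  qed
  then show ?thesis
    using lP u(2) breaking_element_Alg[OF uE] unfolding completely_irreducible_lifted_def by blast
qed

theorem strong_CSP_imp_completely_irreducible:
  assumes K: "condition_K E" and P: "prime_lifted P"
    and CSP: "\<And>H. admissible_pair E H (breaking_vertices E H) \<Longrightarrow> downward_directed E (verts E - H) \<Longrightarrow> quotient_strong_CSP H"
  shows "completely_irreducible_lifted P"
proof -
  have lP: "lifted_ideal P" using P unfolding prime_lifted_def by simp
  interpret P: leavitt_ideal E K P using lP by unfold_locales
  have "quotient_strong_CSP (vertices_in P)"
    by (rule CSP) (simp_all add: admissible_pair_def P.hereditary_vertices_in P.saturated_vertices_in
        P.prime_downward_directed[OF P])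
  then show ?thesis
    using common_vertex_imp_completely_irreducible[OF K P] missing_breaking_element_imp_completely_irreducible[OF K P] by blast
qed

text \<open>
  This ideal is generated by \<open>H\<close> and the breaking elements of \<open>H\<close>; its quotient is the Leavitt path algebra
  of the quotient graph.
\<close>

definition canonical_prime :: "'v set \<Rightarrow> (('v, 'e) lpa_gen list \<Rightarrow>\<^sub>0 'k) set" where
  "canonical_prime H = graded_core 0 (kernel H)"

lemma canonical_prime_props:
  assumes H: "hereditary E H" "saturated E H"
  shows "lifted_ideal (canonical_prime H)" "graded (canonical_prime H)" "vertices_in (canonical_prime H) = H"
  unfolding canonical_prime_def
  using lifted_graded_core[OF kernel_lifted[OF H]] graded_graded_core[OF kernel_lifted[OF H]]
    vertices_in_graded_core[OF kernel_lifted[OF H]] vertices_in_kernel[OF H] by simp_all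

lemma canonical_prime_breaking:
  assumes H: "hereditary E H" "saturated E H" and v: "v \<in> verts E"
    and "finite {e \<in> out_arcs E v. head E e \<notin> H0}" "H0 \<subseteq> H"
    and "v \<in> H \<or> (\<exists>e\<in>out_arcs E v. head E e \<notin> H)"
  shows "breaking_element H0 v \<in> canonical_prime H"
  unfolding canonical_prime_def
  by (rule homogeneous_graded_core[OF kernel_lifted[OF H] homogeneous_breaking_element breaking_element_kernel[OF H(1)]])
    (fact assms)+

lemma canonical_prime_breaking_vertices:
  assumes H: "hereditary E H" "saturated E H" and v: "v \<in> breaking_vertices E H"
  shows "breaking_element H v \<in> canonical_prime H"
  by (rule canonical_prime_breaking[OF H]) (use v in \<open>unfold breaking_vertices_iff, blast+\<close>)

lemma canonical_prime_prime:
  assumes H: "hereditary E H" "saturated E H" and dir: "downward_directed E (verts E - H)"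
  shows "prime_lifted (canonical_prime H)"
  by (rule prime_criterion[OF canonical_prime_props(1,2)[OF H]])
    (use canonical_prime_breaking_vertices[OF H] dir in \<open>simp_all add: canonical_prime_props(3)[OF H]\<close>)

text \<open>
  The kernels themselves are not compared.  The intersection of the two ideals has the vertices and
  breaking elements of the smaller one, so it is equal to it.
\<close>

lemma canonical_prime_mono:
  assumes H: "hereditary E H" "saturated E H"
    and Y: "hereditary (quotient_graph E H) Y" "saturated (quotient_graph E H) Y"
  shows "canonical_prime H \<subseteq> canonical_prime (H \<union> Y)"
proof -
  note U = union_hereditary_saturated[OF H Y]
  define I where "I = canonical_prime H \<inter> canonical_prime (H \<union> Y)"
  have lI: "lifted_ideal I"
    using canonical_prime_props(1)[OF H] canonical_prime_props(1)[OF U] unfolding I_def lifted_ideal_def by blast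
  have gI: "graded I"
    using canonical_prime_props(2)[OF H] canonical_prime_props(2)[OF U] unfolding I_def graded_def by blast
  have vI: "vertices_in I = H"
  proof -
    have "vertices_in I = vertices_in (canonical_prime H) \<inter> vertices_in (canonical_prime (H \<union> Y))"
      unfolding I_def vertices_in_def by blast
    then show ?thesis unfolding canonical_prime_props(3)[OF H] canonical_prime_props(3)[OF U] by blast
  qed
  have "canonical_prime H = I"
  proof (rule vertices_determine_ideal[OF lI gI canonical_prime_props(1)[OF H]])
    show "I \<subseteq> canonical_prime H" unfolding I_def by blast
    show "V v \<in> I" if "v \<in> verts E" "V v \<in> canonical_prime H" for v
    proof -
      have "v \<in> vertices_in (canonical_prime H)" using that by (simp add: vertices_in_def)
      then have "v \<in> vertices_in I" unfolding vI canonical_prime_props(3)[OF H] .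
      then show ?thesis by (simp add: vertices_in_def)
    qed
    fix v assume "v \<in> breaking_vertices E (vertices_in I)"
    then have v: "v \<in> breaking_vertices E H" unfolding vI .
    then have v': "v \<in> verts E" "v \<notin> H" "finite {e \<in> out_arcs E v. head E e \<notin> H}"
      "{e \<in> out_arcs E v. head E e \<notin> H} \<noteq> {}"
      unfolding breaking_vertices_iff by blast+
    have "v \<in> H \<union> Y \<or> (\<exists>e\<in>out_arcs E v. head E e \<notin> H \<union> Y)"
    proof (rule ccontr)
      assume n: "\<not> ?thesis"
      have "regular_vertex (quotient_graph E H) v"
        unfolding regular_vertex_def out_arcs_quotient verts_quotient using v' by blast
      moreover have "head (quotient_graph E H) ` out_arcs (quotient_graph E H) v \<subseteq> Y"
        using n unfolding out_arcs_quotient by (auto simp: quotient_graph_def)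
      ultimately show False using Y(2) n unfolding saturated_def by blast
    qed
    then have "breaking_element H v \<in> canonical_prime (H \<union> Y)"
      using v' by (intro canonical_prime_breaking[OF U]) auto
    then show "breaking_element (vertices_in I) v \<in> I"
      unfolding vI using canonical_prime_breaking_vertices[OF H v] unfolding I_def by blast
  qed (use canonical_prime_props(2)[OF H] in blast)
  then show ?thesis unfolding I_def by blast
qed

text \<open>
  A vertex outside \<open>H\<close> in the least ideal properly above the canonical prime of \<open>H\<close> lies in all canonical primes of larger
  sets of vertices.
\<close>

theorem completely_irreducible_imp_strong_CSP:
  assumes two: "\<And>P. prime_lifted P \<Longrightarrow> graded P \<Longrightarrow> completely_irreducible_lifted P"
    and K: "condition_K E" and H: "hereditary E H" "saturated E H" and dir: "downward_directed E (verts E - H)"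
  shows "quotient_strong_CSP H"
proof -
  let ?P = "canonical_prime H"
  note props = canonical_prime_props[OF H]
  have ne: "verts E - H \<noteq> {}" using dir unfolding downward_directed_def by simp
  obtain M where M: "lifted_ideal M" "?P \<subset> M" and least: "\<And>A. lifted_ideal A \<Longrightarrow> ?P \<subset> A \<Longrightarrow> M \<subseteq> A"
    using completely_irreducible_least[OF two[OF canonical_prime_prime[OF H dir] props(2)]] by blast
  have "\<exists>w\<in>verts E. V w \<in> M \<and> V w \<notin> ?P"
  proof (rule ccontr)
    assume n: "\<not> ?thesis"
    have PM: "?P \<subseteq> M" using M(2) by blast
    have "M = ?P"
      by (rule vertices_determine_ideal[OF props(1,2) M(1) PM])
        (use n K canonical_prime_breaking_vertices[OF H] in \<open>auto simp: props(3)\<close>)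
    then show False using M(2) by blast
  qed
  then obtain w where w: "w \<in> verts E" "V w \<in> M" "V w \<notin> ?P" by blast
  have wH: "w \<notin> H"
  proof
    assume "w \<in> H"
    then have "w \<in> vertices_in ?P" using props(3) by simp
    then show False using w(3) by (simp add: vertices_in_def)
  qed
  have "w \<in> Y" if Y: "Y \<noteq> {}" "hereditary (quotient_graph E H) Y" "saturated (quotient_graph E H) Y" for Y
  proof -
    note U = union_hereditary_saturated[OF H Y(2,3)]
    obtain y where y: "y \<in> Y" "y \<in> verts E - H" using Y(1,2) unfolding hereditary_def verts_quotient by blast
    have "vertices_in (canonical_prime (H \<union> Y)) \<noteq> vertices_in ?P"
      unfolding canonical_prime_props(3)[OF U] props(3) using y by blast
    then have "?P \<noteq> canonical_prime (H \<union> Y)" by (intro notI) simp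
    with canonical_prime_mono[OF H Y(2,3)] have "?P \<subset> canonical_prime (H \<union> Y)" by (rule psubsetI)
    from least[OF canonical_prime_props(1)[OF U] this] w(2) have "V w \<in> canonical_prime (H \<union> Y)" by (rule subsetD)
    then have "w \<in> vertices_in (canonical_prime (H \<union> Y))" using w(1) by (simp add: vertices_in_def)
    then show "w \<in> Y" unfolding canonical_prime_props(3)[OF U] using wH by blast
  qed
  then show ?thesis
    unfolding strong_CSP_quotient_iff[OF H(1) ne] using w(1) wH by blast
qed

text \<open>
  If (K) fails at \<open>v\<close>, the canonical prime of the set of vertices not leading to \<open>v\<close> is the intersection
  of the graded cores of the kernel modulo \<open>n \<bar>c\<bar>\<close>, and it is different from each of them because of
  \<open>v - c\<^sup>n\<close>.
\<close>

theorem completely_irreducible_imp_condition_K: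
  assumes two: "\<And>P. prime_lifted P \<Longrightarrow> graded P \<Longrightarrow> completely_irreducible_lifted P"
  shows "condition_K E"
proof (rule ccontr)
  assume "\<not> condition_K E"
  then obtain v c where c: "closed_path E v c" and inj: "inj_on (tail E) (set c)"
    and all: "\<And>q. closed_path E v q \<Longrightarrow> set q = set c"
    using not_condition_K by blast
  have cv: "awalk v c v" "c \<noteq> []" using c by (auto simp: closed_path_def)
  have vE: "v \<in> verts E" using cv by auto
  define H where "H = {x \<in> verts E. \<not> connects E x v}"
  have vH: "v \<notin> H" using connects_refl[OF vE] by (simp add: H_def)
  have next_edge: "\<exists>e\<in>out_arcs E x. head E e \<notin> H" if "x \<in> verts E - H" for x
  proof -
    obtain p where p: "awalk x p v" using \<open>x \<in> verts E - H\<close> by (auto simp: H_def connects_def)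
    have "\<exists>p. p \<noteq> [] \<and> awalk x p v"
      using p cv by (cases "p = []") (auto simp: awalk_Nil_iff)
    then obtain e q where "awalk x (e # q) v" by (metis neq_Nil_conv)
    then have "e \<in> out_arcs E x" "connects E (head E e) v" by (auto simp: awalk_Cons_iff connects_def)
    then show ?thesis by (auto simp: H_def)
  qed
  have hH: "hereditary E H"
    unfolding hereditary_def H_def using connects_trans connects_verts by blast
  have sH: "saturated E H"
    unfolding saturated_def
  proof (intro conjI allI impI)
    show "H \<subseteq> verts E" by (auto simp: H_def)
    fix x assume x: "regular_vertex E x" "head E ` out_arcs E x \<subseteq> H"
    show "x \<in> H"
    proof (rule ccontr)
      assume "x \<notin> H"
      then have "x \<in> verts E - H" using x(1) by (simp add: regular_vertex_def)
      from next_edge[OF this] show False using x(2) by blast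
    qed
  qed
  have dir: "downward_directed E (verts E - H)"
    unfolding downward_directed_def
  proof (intro conjI ballI)
    show "verts E - H \<noteq> {}" using vE vH by blast
    fix x y assume "x \<in> verts E - H" "y \<in> verts E - H"
    then have "connects E x v" "connects E y v" by (auto simp: H_def)
    then show "\<exists>w\<in>verts E - H. connects E x w \<and> connects E y w" using vE vH by blast
  qed
  let ?P = "canonical_prime H"
  note props = canonical_prime_props[OF hH sH] and lK = kernel_lifted[OF hH sH]
  have VvP: "V v \<notin> kernel H"
    using vertices_in_kernel[OF hH sH] vE vH by (auto simp: vertices_in_def)
  obtain x where x: "x \<in> Alg" "x \<notin> ?P" "\<And>A. lifted_ideal A \<Longrightarrow> ?P \<subset> A \<Longrightarrow> x \<in> A"
    using two[OF canonical_prime_prime[OF hH sH dir] props(2)] unfolding completely_irreducible_lifted_def by blast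
  obtain M where M: "\<And>N. N \<ge> M \<Longrightarrow> x \<in> graded_core N (kernel H) \<Longrightarrow> x \<in> graded_core 0 (kernel H)"
    using graded_core_large_modulus[OF lK x(1)] by blast
  have on_c: "e \<in> set c" if e: "e \<in> out_arcs E y" "head E e \<notin> H" and y: "connects E v y" for e y
  proof -
    obtain g where g: "awalk v g y" using y by (auto simp: connects_def)
    have eh: "head E e \<in> verts E" using e(1) by auto
    then obtain d where d: "awalk (head E e) d v" using e(2) by (auto simp: H_def connects_def)
    have "awalk y (e # d) v" using d e(1) connects_verts[OF y] by (auto simp: awalk_Cons_iff)
    then have "closed_path E v (g @ e # d)" using awalk_appendI[OF g] by (auto simp: closed_path_def)
    from all[OF this] show ?thesis by auto
  qed
  have uniq: "f = f'" if f: "f \<in> rays H" "step_source (f 0) = v" and f': "f' \<in> rays H" "step_source (f' 0) = v" for f f'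
  proof -
    have edge: "\<exists>e. s = Inl e \<and> e \<in> out_arcs E (step_source s) \<and> head E e \<notin> H" if s: "s \<in> steps H" for s
    proof (cases s)
      case (Inl e)
      then show ?thesis using s by (auto simp: steps_def)
    next
      case (Inr y)
      then have y: "y \<in> verts E - H" "\<And>e. e \<in> out_arcs E y \<Longrightarrow> head E e \<in> H" using s by (auto simp: steps_def)
      then show ?thesis using next_edge[OF y(1)] by blast
    qed
    have "f i = f' i \<and> connects E v (step_source (f i))" for i
    proof -
      have same: "s = s'" if ss: "s \<in> steps H" "s' \<in> steps H" "step_source s = step_source s'" "connects E v (step_source s)" for s s'
      proof -
        obtain e e' where e: "s = Inl e" "e \<in> out_arcs E (step_source s)" "head E e \<notin> H"
          and e': "s' = Inl e'" "e' \<in> out_arcs E (step_source s')" "head E e' \<notin> H"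
          using edge[OF ss(1)] edge[OF ss(2)] by blast
        have "e \<in> set c" "e' \<in> set c" using on_c[OF e(2,3)] on_c[OF e'(2,3)] ss by auto
        moreover have "tail E e = tail E e'" using e(2) e'(2) ss(3) by auto
        ultimately show ?thesis using inj e(1) e'(1) by (auto dest: inj_onD)
      qed
      show ?thesis
      proof (induction i)
        case 0
        have "connects E v (step_source (f 0))" using connects_refl[OF vE] f(2) by simp
        then show ?case using same[OF rays_steps[OF f(1)] rays_steps[OF f'(1)], of 0 0] f(2) f'(2) by simp
      next
        case (Suc i)
        obtain e where e: "f i = Inl e" "e \<in> out_arcs E (step_source (f i))"
          using edge[OF rays_steps[OF f(1), of i]] by blast
        have fe: "f' i = Inl e" using Suc e(1) by simp
        have src: "step_source (f (Suc i)) = head E e" "step_source (f' (Suc i)) = head E e"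
          using rays_source[OF f(1), of i] rays_source[OF f'(1), of i] e(1) fe by simp_all
        have "connects E v (step_source (f i))" using Suc by (rule conjunct2)
        from connects_trans[OF this connects_arc[OF e(2)]] have "connects E v (head E e)" .
        then show ?case
          using same[OF rays_steps[OF f(1), of "Suc i"] rays_steps[OF f'(1), of "Suc i"]] src by simp
      qed
    qed
    then show ?thesis by blast
  qed
  \<comment> \<open>A power of \<open>c\<close> whose length, the modulus of the graded core, separates the degrees of \<open>x\<close>.\<close>
  define n where "n = Suc (nat M)"
  define d where "d = concat (replicate n c)"
  interpret Ker: leavitt_ideal E K "kernel H" using lK by unfold_locales
  have dv: "awalk v d v" unfolding d_def by (rule Ker.awalk_concat_replicate[OF cv(1)])
  have len: "n \<le> length d" unfolding d_def by (rule length_concat_replicate_ge[OF cv(2)])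
  then have dc: "closed_path E v d" using dv by (auto simp: closed_path_def n_def)
  let ?N = "int (length d)" and ?q = "V v - path v d"
  have N: "?N \<ge> M" "?N \<noteq> 0" using len by (auto simp: n_def)
  have qk: "?q \<in> kernel H" by (rule closed_path_kernel[OF hH dc vH]) (rule uniq)
  have part: "degree_part m i ?q = (if 0 mod m = i mod m then V v else 0) - (if ?N mod m = i mod m then path v d else 0)" for m i
    unfolding degree_part_minus degree_part_homogeneous[OF homogeneous_path] degree_part_word by simp
  let ?A = "graded_core ?N (kernel H)"
  have "?q \<in> ?A"
    unfolding graded_core_def mem_Collect_eq part using qk Ker.J_zero Ker.J_Alg[OF qk] by simp
  moreover have "?q \<notin> ?P"
  proof
    assume "?q \<in> ?P"
    then have "degree_part 0 0 ?q \<in> kernel H" unfolding canonical_prime_def graded_core_def by blast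
    then show False using VvP N(2) by (simp add: part)
  qed
  moreover have "?P \<subseteq> ?A" unfolding canonical_prime_def by (rule graded_core_zero_subset[OF lK])
  ultimately have "?P \<subset> ?A" by blast
  then have "x \<in> ?A" by (rule x(3)[OF lifted_graded_core[OF lK]])
  then have "x \<in> ?P" unfolding canonical_prime_def by (rule M[OF N(1)])
  then show False using x(2) by blast
qed

lemma all_ideals_iff:
  assumes "\<And>J. lifted_ideal J \<Longrightarrow> Q (cls ` J) \<longleftrightarrow> Q' J"
  shows "(\<forall>I. two_sided_ideal L I \<longrightarrow> Q I) \<longleftrightarrow> (\<forall>J. lifted_ideal J \<longrightarrow> Q' J)"
  unfolding ideal_iff_image using assms by auto

theorem four_conditions:
  defines "c1 \<equiv> \<forall>I. irreducible_ideal L I \<longrightarrow> completely_irreducible_ideal L I"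
    and "c2 \<equiv> \<forall>P. prime_ideal L P \<and> graded_ideal L (lpa_component K E) P \<longrightarrow> completely_irreducible_ideal L P"
    and "c3 \<equiv> (\<forall>I. two_sided_ideal L I \<longrightarrow> graded_ideal L (lpa_component K E) I) \<and>
      (\<forall>P. prime_ideal L P \<longrightarrow> completely_irreducible_ideal L P)"
    and "c4 \<equiv> condition_K E \<and> (\<forall>H. admissible_pair E H (breaking_vertices E H) \<and>
      downward_directed E (verts E - H) \<longrightarrow> quotient_strong_CSP H)"
  shows "(c1 \<longleftrightarrow> c2) \<and> (c2 \<longleftrightarrow> c3) \<and> (c3 \<longleftrightarrow> c4)"
proof -
  have ideals: "irreducible_ideal L I \<Longrightarrow> two_sided_ideal L I" "prime_ideal L I \<Longrightarrow> two_sided_ideal L I" for I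
    by (simp_all add: irreducible_ideal_def prime_ideal_def proper_ideal_def)
  have c1: "c1 \<longleftrightarrow> (\<forall>J. lifted_ideal J \<longrightarrow> irreducible_lifted J \<longrightarrow> completely_irreducible_lifted J)"
    using all_ideals_iff[of "\<lambda>I. irreducible_ideal L I \<longrightarrow> completely_irreducible_ideal L I"
        "\<lambda>J. irreducible_lifted J \<longrightarrow> completely_irreducible_lifted J"]
      irreducible_iff completely_irreducible_iff ideals(1) unfolding c1_def by simp metis
  have c2: "c2 \<longleftrightarrow> (\<forall>J. lifted_ideal J \<longrightarrow> prime_lifted J \<and> graded J \<longrightarrow> completely_irreducible_lifted J)"
    using all_ideals_iff[of "\<lambda>P. prime_ideal L P \<and> graded_ideal L (lpa_component K E) P \<longrightarrow> completely_irreducible_ideal L P"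
        "\<lambda>J. prime_lifted J \<and> graded J \<longrightarrow> completely_irreducible_lifted J"]
      prime_ideal_iff graded_ideal_iff completely_irreducible_iff ideals(2) unfolding c2_def by simp metis
  have c3: "c3 \<longleftrightarrow> (\<forall>J. lifted_ideal J \<longrightarrow> graded J) \<and>
      (\<forall>J. lifted_ideal J \<longrightarrow> prime_lifted J \<longrightarrow> completely_irreducible_lifted J)"
    using all_ideals_iff[of "graded_ideal L (lpa_component K E)" graded, OF graded_ideal_iff]
      all_ideals_iff[of "\<lambda>P. prime_ideal L P \<longrightarrow> completely_irreducible_ideal L P"
        "\<lambda>J. prime_lifted J \<longrightarrow> completely_irreducible_lifted J"]
      prime_ideal_iff completely_irreducible_iff ideals(2) unfolding c3_def by simp metis
  have 12: "c2" if c1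
    unfolding c2 using that[unfolded c1] prime_irreducible by blast
  have 24: "c4" if c2
  proof -
    have t: "completely_irreducible_lifted P" if "prime_lifted P" "graded P" for P
      using \<open>c2\<close>[unfolded c2] that unfolding prime_lifted_def by blast
    have K: "condition_K E" by (rule completely_irreducible_imp_condition_K) (rule t)
    have "quotient_strong_CSP H"
      if "admissible_pair E H (breaking_vertices E H)" "downward_directed E (verts E - H)" for H
    proof (rule completely_irreducible_imp_strong_CSP[OF _ K])
      show "hereditary E H" "saturated E H" using that(1) by (simp_all add: admissible_pair_def)
    qed (use t that(2) in blast)+
    then show ?thesis unfolding c4_def using K by blast
  qed
  have 43: "c3" if c4
  proof -
    have K: "condition_K E" using that unfolding c4_def by (rule conjunct1)
    have "completely_irreducible_lifted P" if "prime_lifted P" for P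
      by (rule strong_CSP_imp_completely_irreducible[OF K that]) (use \<open>c4\<close> in \<open>unfold c4_def, blast\<close>)
    then show ?thesis unfolding c3 using condition_K_graded[OF K] by blast
  qed
  have 31: "c1" if c3
    using that unfolding c1 c3 using irreducible_prime by blast
  show ?thesis using 12 24 43 31 by argo
qed

end

theorem proposition5p11:
  fixes E :: "('v, 'e) pre_digraph"
  assumes "wf_digraph E" and "verts E \<noteq> {}"
  shows
    "let L = leavitt_path_algebra TYPE('k::field) E;
         graded = graded_ideal L (lpa_component TYPE('k) E);
         one = (\<forall>I. irreducible_ideal L I \<longrightarrow> completely_irreducible_ideal L I);
         two = (\<forall>P. prime_ideal L P \<and> graded P \<longrightarrow> completely_irreducible_ideal L P);
         three = ((\<forall>I. two_sided_ideal L I \<longrightarrow> graded I) \<and>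
                  (\<forall>P. prime_ideal L P \<longrightarrow> completely_irreducible_ideal L P));
         four = (condition_K E \<and>
                 (\<forall>H. admissible_pair E H (breaking_vertices E H) \<and>
                      downward_directed E (verts E - H) \<longrightarrow>
                      strong_CSP (quotient_graph E H) (verts (quotient_graph E H))))
     in (one \<longleftrightarrow> two) \<and> (two \<longleftrightarrow> three) \<and> (three \<longleftrightarrow> four)"
proof -
  interpret leavitt E "TYPE('k)"
    using assms(1) by (rule leavitt.intro)
  show ?thesis
    unfolding Let_def by (rule four_conditions)
qed

end
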